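(* Let $\xi$ be a tidy formula of the modal $\mu$-calculus. Then the parity formula $\mathbb{G}_\xi=(\mathrm{Clos}(\xi),\rightarrow_C\restriction_{\mathrm{Clos}(\xi)},L_n\restriction_{\mathrm{Clos}(\xi)},\Omega_g\restriction_{\mathrm{Clos}(\xi)},\xi)$, which is based on the closure graph of $\xi$, is equivalent to $\xi$, has exactly $|\mathrm{Clos}(\xi)|$ vertices, and satisfies $\mathit{ind}(\mathbb{G}_\xi)\le \mathit{ad}(\xi)$.
   Context: Syntax. Formulas of the modal $\mu$-calculus are taken in negation normal form: $\phi ::= \top \mid \bot \mid p \mid \neg p \mid x \mid \phi\land\phi\mid\phi\lor\phi\mid\Diamond\phi\mid\Box\phi\mid\mu x.\phi\mid\nu x.\phi$, where $p$ ranges over proposition letters and $x$ over an infinite supply of variables (which occur only positively). The formulas $\top,\bot,p,\neg p,x$ are atomic. $\mathrm{FV}(\phi)$ and $\mathrm{BV}(\phi)$ are the sets of free and bound variables of $\phi$; $\phi$ is tidy if $\mathrm{FV}(\phi)\cap\mathrm{BV}(\phi)=\varnothing$. A fixpoint formula is one of the form $\eta x.\chi$ with $\eta\in\{\mu,\nu\}$; it has type $\eta$, where $\mu$ counts as odd and $\nu$ as even parity, and $\bar\eta$ denotes the other operator. $\chi[\xi/x]$ is the result of replacing every free occurrence of $x$ in $\chi$ by $\xi$; $\xi$ is free for $x$ in $\chi$ if no free variable of $\xi$ becomes bound in $\chi[\xi/x]$. $|\phi|$ is the length of $\phi$ (number of nodes of its syntax tree). Traces and closure. The trace relation $\rightarrow_C$: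 $\phi_0\odot\phi_1\rightarrow_C\phi_i$ for $\odot\in\{\land,\lor\}$, $i\in\{0,1\}$; $\heartsuit\phi\rightarrow_C\phi$ for $\heartsuit\in\{\Diamond,\Box\}$; $\eta x.\phi\rightarrow_C\phi[\eta x.\phi/x]$; atomic formulas have no successors. $\twoheadrightarrow_C$ is the reflexive transitive closure of $\rightarrow_C$, $\mathrm{Clos}(\phi)=\{\psi\mid\phi\twoheadrightarrow_C\psi\}$ (a finite set), and a trace is a finite or infinite sequence of formulas with consecutive members related by $\rightarrow_C$. Write $\phi\equiv_C\psi$ iff $\phi\twoheadrightarrow_C\psi$ and $\psi\twoheadrightarrow_C\phi$; its equivalence classes are (closure) clusters, and $C(\phi)$ is the cluster of $\phi$. Free subformulas. $\phi\trianglelefteq_f\psi$ iff $\psi=\chi[\phi/y]$ for some formula $\chi$ and variable $y$ with $y\in\mathrm{FV}(\chi)$ and $\phi$ free for $y$ in $\chi$; $\phi\triangleleft_f\psi$ iff moreover $\phi\neq\psi$. Closure order. For a formula $\psi$, write $\rho\twoheadrightarrow_C^{\psi}\sigma$ iff there is a trace $\rho=\chi_0\rightarrow_C\cdots\rightarrow_C\chi_n=\sigma$ ($n\ge0$) with $\psi\trianglelefteq_f\chi_i$ for all $i\le n$. For fixpoint formulas $\phi,\psi$: $\phi\sqsubseteq_C\psi$ iff $\psi\twoheadrightarrow_C^{\psi}\phi$; $\phi\sqsubset_C\psi$ iff $\phi\sqsubseteq_C\psi$ and $\psi\not\sqsubseteq_C\phi$. Chains. An alternating $\sqsubset_C$-chain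 of length $n$ is a sequence $\eta_1x_1.\chi_1,\dots,\eta_nx_n.\chi_n$ of tidy fixpoint formulas with $\eta_ix_i.\chi_i\sqsubset_C\eta_{i+1}x_{i+1}.\chi_{i+1}$ and $\eta_{i+1}=\bar\eta_i$ for all $i<n$; it starts at the first and leads up to the last formula. For a tidy fixpoint formula $\xi$, $h^\uparrow(\xi)$ (resp. $h^\downarrow(\xi)$) is the maximal length of an alternating $\sqsubset_C$-chain starting at (resp. leading up to) $\xi$. For a cluster $C$, $\mathit{cd}(C)$ is the maximal length of an alternating $\sqsubset_C$-chain inside $C$. Global priority map and $\mathbb{G}_\xi$. For a tidy fixpoint formula $\psi=\eta y.\phi$ let $d=\mathit{cd}(C(\psi))-h^\uparrow(\psi)$ and set $\Omega_g(\psi)=d$ if $d$ has parity $\eta$ and $\Omega_g(\psi)=d+1$ otherwise; $\Omega_g$ is undefined on non-fixpoint formulas. The natural labelling is $L_n(\phi)=\phi$ for atomic $\phi$, $L_n(\heartsuit\psi)=\heartsuit$, $L_n(\psi_0\odot\psi_1)=\odot$, $L_n(\eta x.\psi)=\epsilon$. Parity formulas. A parity formula is a tuple $(V,E,L,\Omega,v_I)$ with $V$ finite, $E\subseteq V\times V$, $L$ labelling each vertex by an atomic formula (such vertices have no successors), by $\Diamond,\Box$ or $\epsilon$ (exactly one successor) or by $\land,\lor$, $\Omega$ a partial map $V\to\omega$, $v_I\in V$, such that every cycle contains a vertex in $\mathrm{Dom}(\Omega)$. Its semantics on a Kripke model $\mathbb{S}=(S,R,V)$ (valuation on letters and free variables)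 is given by the evaluation game with positions $(v,s)$: at an atomic-labelled $v$ the match ends and $\exists$ wins iff $s$ satisfies the atom; at $\lor$ (resp. $\land$) $\exists$ (resp. $\forall$) picks an $E$-successor $u$ and moves to $(u,s)$; at $\Diamond$ (resp. $\Box$) $\exists$ (resp. $\forall$) picks $t$ with $sRt$ and moves to $(u,t)$, $u$ the successor; at $\epsilon$ the move is to $(u,s)$; a player who cannot move loses; an infinite match is won by $\exists$ iff the largest priority occurring infinitely often is even. $\mathbb{S},s\Vdash\mathbb{G}$ iff $\exists$ wins from $(v_I,s)$; $\mathbb{G}$ is equivalent to a formula $\xi$ iff $\mathbb{S},s\Vdash\mathbb{G}\Leftrightarrow\mathbb{S},s\Vdash\xi$ for all pointed models. A cluster of a parity formula is a class of mutually $E$-reachable vertices; its index is the maximal $n$ for which there are $v_1,\dots,v_n$ in the cluster with $\Omega(v_1)<\cdots<\Omega(v_n)$ and consecutive priorities of different parity; $\mathit{ind}(\mathbb{G})$ is the maximal index of its clusters. Alternation hierarchy. The classes $\mathrm{AH}_\eta(n)$ ($\eta\in\{\mu,\nu\}$, $n\in\omega$) are the least classes such that: (1) all atomic formulas belong to $\mathrm{AH}_\eta(0)$; (2) each $\mathrm{AH}_\eta(n)$ is closed under $\land,\lor,\Diamond,\Box$; (3) if $\chi\in\mathrm{AH}_\eta(n)$ then $\bar\eta x.\chi\in\mathrm{AH}_\eta(n)$; (4) if $\chi,\xi\in\mathrm{AH}_\eta(n)$ and $\xi$ is free for $x$ in $\chi$ then $\chi[\xi/x]\in\mathrm{AH}_\eta(n)$;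 (5) $\mathrm{AH}_\mu(n)\cup\mathrm{AH}_\nu(n)\subseteq\mathrm{AH}_\eta(n+1)$. $\mathit{ad}(\xi)$ is the least $n$ with $\xi\in\mathrm{AH}_\mu(n)\cap\mathrm{AH}_\nu(n)$. *)

theory Defs
  imports Main
begin

datatype fp = Mu | Nu

datatype 'p fm =
    Top | Bot | Prop 'p | NProp 'p | Var nat
  | And "'p fm" "'p fm" | Or "'p fm" "'p fm"
  | Dia "'p fm" | Box "'p fm"
  | Fix fp nat "'p fm"

fun dual :: "fp \<Rightarrow> fp" where
  "dual Mu = Nu" | "dual Nu = Mu"

fun fp_odd :: "fp \<Rightarrow> bool" where
  "fp_odd Mu = True" | "fp_odd Nu = False"

fun atomic :: "'p fm \<Rightarrow> bool" where
  "atomic Top = True" | "atomic Bot = True" | "atomic (Prop p) = True"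
| "atomic (NProp p) = True" | "atomic (Var x) = True" | "atomic _ = False"

fun is_fix :: "'p fm \<Rightarrow> bool" where
  "is_fix (Fix e x c) = True" | "is_fix _ = False"

fun fix_type :: "'p fm \<Rightarrow> fp" where
  "fix_type (Fix e x c) = e" | "fix_type _ = Mu"

fun FV :: "'p fm \<Rightarrow> nat set" where
  "FV (Var x) = {x}"
| "FV (And a b) = FV a \<union> FV b" | "FV (Or a b) = FV a \<union> FV b"
| "FV (Dia a) = FV a" | "FV (Box a) = FV a"
| "FV (Fix e y c) = FV c - {y}"
| "FV _ = {}"

fun BV :: "'p fm \<Rightarrow> nat set" where
  "BV (And a b) = BV a \<union> BV b" | "BV (Or a b) = BV a \<union> BV b"
| "BV (Dia a) = BV a" | "BV (Box a) = BV a"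
| "BV (Fix e y c) = insert y (BV c)"
| "BV _ = {}"

definition tidy :: "'p fm \<Rightarrow> bool" where
  "tidy \<phi> \<longleftrightarrow> FV \<phi> \<inter> BV \<phi> = {}"

fun subst :: "'p fm \<Rightarrow> 'p fm \<Rightarrow> nat \<Rightarrow> 'p fm" where
  "subst (Var y) s x = (if y = x then s else Var y)"
| "subst (And a b) s x = And (subst a s x) (subst b s x)"
| "subst (Or a b) s x = Or (subst a s x) (subst b s x)"
| "subst (Dia a) s x = Dia (subst a s x)"
| "subst (Box a) s x = Box (subst a s x)"
| "subst (Fix e y c) s x = (if y = x then Fix e y c else Fix e y (subst c s x))"
| "subst a s x = a"

fun free_for :: "'p fm \<Rightarrow> nat \<Rightarrow> 'p fm \<Rightarrow> bool" where
  "free_for s x (And a b) = (free_for s x a \<and> free_for s x b)"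
| "free_for s x (Or a b) = (free_for s x a \<and> free_for s x b)"
| "free_for s x (Dia a) = free_for s x a"
| "free_for s x (Box a) = free_for s x a"
| "free_for s x (Fix e y c) =
     (y = x \<or> x \<notin> FV c \<or> (y \<notin> FV s \<and> free_for s x c))"
| "free_for s x _ = True"

fun succs :: "'p fm \<Rightarrow> 'p fm set" where
  "succs (And a b) = {a, b}" | "succs (Or a b) = {a, b}"
| "succs (Dia a) = {a}" | "succs (Box a) = {a}"
| "succs (Fix e x c) = {subst c (Fix e x c) x}"
| "succs _ = {}"

definition trace_rel :: "('p fm \<times> 'p fm) set" where
  "trace_rel = {(a, b). b \<in> succs a}"

definition Clos :: "'p fm \<Rightarrow> 'p fm set" where
  "Clos \<phi> = {\<psi>. (\<phi>, \<psi>) \<in> trace_rel\<^sup>*}"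

definition clos_cluster :: "'p fm \<Rightarrow> 'p fm set" where
  "clos_cluster \<phi> = {\<psi>. (\<phi>, \<psi>) \<in> trace_rel\<^sup>* \<and> (\<psi>, \<phi>) \<in> trace_rel\<^sup>*}"

definition free_sub :: "'p fm \<Rightarrow> 'p fm \<Rightarrow> bool" where
  "free_sub \<phi> \<psi> \<longleftrightarrow> (\<exists>\<chi> y. y \<in> FV \<chi> \<and> free_for \<phi> y \<chi> \<and> \<psi> = subst \<chi> \<phi> y)"

definition trace_rel_within :: "'p fm \<Rightarrow> ('p fm \<times> 'p fm) set" where
  "trace_rel_within \<psi> = {(a, b). b \<in> succs a \<and> free_sub \<psi> a \<and> free_sub \<psi> b}"

definition clos_le :: "'p fm \<Rightarrow> 'p fm \<Rightarrow> bool" where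
  "clos_le \<phi> \<psi> \<longleftrightarrow> is_fix \<phi> \<and> is_fix \<psi> \<and> free_sub \<psi> \<psi> \<and>
      (\<psi>, \<phi>) \<in> (trace_rel_within \<psi>)\<^sup>*"

definition clos_less :: "'p fm \<Rightarrow> 'p fm \<Rightarrow> bool" where
  "clos_less \<phi> \<psi> \<longleftrightarrow> clos_le \<phi> \<psi> \<and> \<not> clos_le \<psi> \<phi>"

definition alt_chain :: "'p fm list \<Rightarrow> bool" where
  "alt_chain cs \<longleftrightarrow> cs \<noteq> [] \<and> (\<forall>\<phi> \<in> set cs. tidy \<phi> \<and> is_fix \<phi>) \<and>
     (\<forall>i. Suc i < length cs \<longrightarrow>
        clos_less (cs ! i) (cs ! Suc i) \<and> fix_type (cs ! Suc i) = dual (fix_type (cs ! i)))"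

definition h_up :: "'p fm \<Rightarrow> nat" where
  "h_up \<xi> = Max {length cs | cs. alt_chain cs \<and> hd cs = \<xi>}"

definition h_down :: "'p fm \<Rightarrow> nat" where
  "h_down \<xi> = Max {length cs | cs. alt_chain cs \<and> last cs = \<xi>}"

definition cd :: "'p fm set \<Rightarrow> nat" where
  "cd C = Max (insert 0 {length cs | cs. alt_chain cs \<and> set cs \<subseteq> C})"

definition Omega_g :: "'p fm \<Rightarrow> nat option" where
  "Omega_g \<psi> = (if is_fix \<psi> \<and> tidy \<psi> then
      (let d = cd (clos_cluster \<psi>) - h_up \<psi> in
        Some (if odd d = fp_odd (fix_type \<psi>) then d else d + 1))
    else None)"

datatype 'p lab = LAtom "'p fm" | LDia | LBox | LEps | LAnd | LOr

fun L_n :: "'p fm \<Rightarrow> 'p lab" where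
  "L_n (And a b) = LAnd" | "L_n (Or a b) = LOr"
| "L_n (Dia a) = LDia" | "L_n (Box a) = LBox"
| "L_n (Fix e x c) = LEps"
| "L_n a = LAtom a"

fun sem :: "('s \<times> 's) set \<Rightarrow> ('p \<Rightarrow> 's set) \<Rightarrow> (nat \<Rightarrow> 's set) \<Rightarrow> 'p fm \<Rightarrow> 's set" where
  "sem R V U Top = UNIV"
| "sem R V U Bot = {}"
| "sem R V U (Prop p) = V p"
| "sem R V U (NProp p) = - V p"
| "sem R V U (Var x) = U x"
| "sem R V U (And a b) = sem R V U a \<inter> sem R V U b"
| "sem R V U (Or a b) = sem R V U a \<union> sem R V U b"
| "sem R V U (Dia a) = {s. \<exists>t. (s, t) \<in> R \<and> t \<in> sem R V U a}"
| "sem R V U (Box a) = {s. \<forall>t. (s, t) \<in> R \<longrightarrow> t \<in> sem R V U a}"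
| "sem R V U (Fix Mu x a) = lfp (\<lambda>A. sem R V (U(x := A)) a)"
| "sem R V U (Fix Nu x a) = gfp (\<lambda>A. sem R V (U(x := A)) a)"

record ('v, 'p) pform =
  PV :: "'v set"
  PE :: "('v \<times> 'v) set"
  PL :: "'v \<Rightarrow> 'p lab"
  POm :: "'v \<Rightarrow> nat option"
  PI :: "'v"

definition parity_formula :: "('v, 'p) pform \<Rightarrow> bool" where
  "parity_formula G \<longleftrightarrow>
     finite (PV G) \<and> PE G \<subseteq> PV G \<times> PV G \<and> PI G \<in> PV G \<and>
     {v. POm G v \<noteq> None} \<subseteq> PV G \<and>
     (\<forall>v \<in> PV G. case PL G v of
         LAtom a \<Rightarrow> atomic a \<and> (\<forall>u. (v, u) \<notin> PE G)
       | LDia \<Rightarrow> (\<exists>!u. (v, u) \<in> PE G)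
       | LBox \<Rightarrow> (\<exists>!u. (v, u) \<in> PE G)
       | LEps \<Rightarrow> (\<exists>!u. (v, u) \<in> PE G)
       | _ \<Rightarrow> True) \<and>
     \<comment> \<open>every cycle contains a vertex in the domain of the priority map\<close>
     (\<forall>v. (v, v) \<notin> (PE G \<inter> {(a, b). POm G a = None \<and> POm G b = None})\<^sup>+)"

definition moves :: "('v, 'p) pform \<Rightarrow> ('s \<times> 's) set \<Rightarrow> 'v \<times> 's \<Rightarrow> ('v \<times> 's) set" where
  "moves G R p = (case p of (v, s) \<Rightarrow> (case PL G v of
       LAtom a \<Rightarrow> {}
     | LDia \<Rightarrow> {(u, t) | u t. (v, u) \<in> PE G \<and> (s, t) \<in> R}
     | LBox \<Rightarrow> {(u, t) | u t. (v, u) \<in> PE G \<and> (s, t) \<in> R}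
     | _ \<Rightarrow> {(u, s) | u. (v, u) \<in> PE G}))"

text \<open>positions where Eloise (the existential player) moves; at epsilon-positions
  the move is forced, we assign them to Eloise\<close>
definition eloise_pos :: "('v, 'p) pform \<Rightarrow> 'v \<times> 's \<Rightarrow> bool" where
  "eloise_pos G p \<longleftrightarrow> PL G (fst p) \<in> {LOr, LDia, LEps}"

definition legal_strategy :: "('v, 'p) pform \<Rightarrow> ('s \<times> 's) set \<Rightarrow> (('v \<times> 's) list \<Rightarrow> 'v \<times> 's) \<Rightarrow> bool" where
  "legal_strategy G R \<sigma> \<longleftrightarrow> (\<forall>h. h \<noteq> [] \<and> eloise_pos G (last h) \<and> moves G R (last h) \<noteq> {}
       \<longrightarrow> \<sigma> h \<in> moves G R (last h))"

definition fin_match :: "('v, 'p) pform \<Rightarrow> ('s \<times> 's) set \<Rightarrow> (('v \<times> 's) list \<Rightarrow> 'v \<times> 's)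
    \<Rightarrow> 'v \<times> 's \<Rightarrow> ('v \<times> 's) list \<Rightarrow> bool" where
  "fin_match G R \<sigma> p0 ps \<longleftrightarrow> ps \<noteq> [] \<and> hd ps = p0 \<and>
     (\<forall>i. Suc i < length ps \<longrightarrow> ps ! Suc i \<in> moves G R (ps ! i) \<and>
         (eloise_pos G (ps ! i) \<longrightarrow> ps ! Suc i = \<sigma> (take (Suc i) ps))) \<and>
     moves G R (last ps) = {}"

definition inf_match :: "('v, 'p) pform \<Rightarrow> ('s \<times> 's) set \<Rightarrow> (('v \<times> 's) list \<Rightarrow> 'v \<times> 's)
    \<Rightarrow> 'v \<times> 's \<Rightarrow> (nat \<Rightarrow> 'v \<times> 's) \<Rightarrow> bool" where
  "inf_match G R \<sigma> p0 \<pi> \<longleftrightarrow> \<pi> 0 = p0 \<and>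
     (\<forall>i. \<pi> (Suc i) \<in> moves G R (\<pi> i) \<and>
         (eloise_pos G (\<pi> i) \<longrightarrow> \<pi> (Suc i) = \<sigma> (map \<pi> [0..<Suc i])))"

definition fin_won :: "('v, 'p) pform \<Rightarrow> ('s \<times> 's) set \<Rightarrow> ('p \<Rightarrow> 's set) \<Rightarrow> (nat \<Rightarrow> 's set)
    \<Rightarrow> ('v \<times> 's) list \<Rightarrow> bool" where
  "fin_won G R V U ps \<longleftrightarrow> (case last ps of (v, s) \<Rightarrow>
     (case PL G v of LAtom a \<Rightarrow> s \<in> sem R V U a
                   | _ \<Rightarrow> \<not> eloise_pos G (v, s)))"

definition inf_won :: "('v, 'p) pform \<Rightarrow> (nat \<Rightarrow> 'v \<times> 's) \<Rightarrow> bool" where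
  "inf_won G \<pi> \<longleftrightarrow> even (Max {n. infinite {i. POm G (fst (\<pi> i)) = Some n}})"

definition pf_sat :: "('v, 'p) pform \<Rightarrow> ('s \<times> 's) set \<Rightarrow> ('p \<Rightarrow> 's set) \<Rightarrow> (nat \<Rightarrow> 's set)
    \<Rightarrow> 's \<Rightarrow> bool" where
  "pf_sat G R V U s \<longleftrightarrow> (\<exists>\<sigma>. legal_strategy G R \<sigma> \<and>
     (\<forall>ps. fin_match G R \<sigma> (PI G, s) ps \<longrightarrow> fin_won G R V U ps) \<and>
     (\<forall>\<pi>. inf_match G R \<sigma> (PI G, s) \<pi> \<longrightarrow> inf_won G \<pi>))"

definition pf_cluster :: "('v, 'p) pform \<Rightarrow> 'v \<Rightarrow> 'v set" where
  "pf_cluster G v = {u \<in> PV G. (v, u) \<in> (PE G)\<^sup>* \<and> (u, v) \<in> (PE G)\<^sup>*}"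

definition cluster_index :: "('v, 'p) pform \<Rightarrow> 'v set \<Rightarrow> nat" where
  "cluster_index G C = Max {length vs | vs. set vs \<subseteq> C \<and> (\<forall>v \<in> set vs. POm G v \<noteq> None) \<and>
      (\<forall>i. Suc i < length vs \<longrightarrow>
         the (POm G (vs ! i)) < the (POm G (vs ! Suc i)) \<and>
         odd (the (POm G (vs ! i))) \<noteq> odd (the (POm G (vs ! Suc i))))}"

definition ind :: "('v, 'p) pform \<Rightarrow> nat" where
  "ind G = Max {cluster_index G (pf_cluster G v) | v. v \<in> PV G}"

inductive AH :: "fp \<Rightarrow> nat \<Rightarrow> 'p fm \<Rightarrow> bool" where
  AH_atom: "atomic \<phi> \<Longrightarrow> AH e 0 \<phi>"
| AH_and: "AH e n a \<Longrightarrow> AH e n b \<Longrightarrow> AH e n (And a b)"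
| AH_or: "AH e n a \<Longrightarrow> AH e n b \<Longrightarrow> AH e n (Or a b)"
| AH_dia: "AH e n a \<Longrightarrow> AH e n (Dia a)"
| AH_box: "AH e n a \<Longrightarrow> AH e n (Box a)"
| AH_fix: "AH e n c \<Longrightarrow> AH e n (Fix (dual e) x c)"
| AH_subst: "AH e n c \<Longrightarrow> AH e n s \<Longrightarrow> free_for s x c \<Longrightarrow> AH e n (subst c s x)"
| AH_up: "AH Mu n \<phi> \<or> AH Nu n \<phi> \<Longrightarrow> AH e (Suc n) \<phi>"

definition ad :: "'p fm \<Rightarrow> nat" where
  "ad \<xi> = (LEAST n. AH Mu n \<xi> \<and> AH Nu n \<xi>)"

definition G_of :: "'p fm \<Rightarrow> ('p fm, 'p) pform" where
  "G_of \<xi> = \<lparr> PV = Clos \<xi>,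
              PE = {(a, b). a \<in> Clos \<xi> \<and> b \<in> Clos \<xi> \<and> (a, b) \<in> trace_rel},
              PL = (\<lambda>\<phi>. if \<phi> \<in> Clos \<xi> then L_n \<phi> else LAtom Top),
              POm = (\<lambda>\<phi>. if \<phi> \<in> Clos \<xi> then Omega_g \<phi> else None),
              PI = \<xi> \<rparr>"

end

theory Submission
  imports Defs "HOL-Library.Infinite_Set"
begin

text \<open>
  \<^emph>\<open>Index.\<close> A strongly connected set of formulas has a dominator: a fixpoint formula in the set that
  is a free subformula of all its members. An alternating chain in the closure order yields an
  increasing chain of strongly connected sets with dominators of alternating type. Such chains lift
  along the substitution maps between closures, unless the substituted formula dominates, and so
  their length is bounded by induction on the generation of the alternation hierarchy. Within a
  cluster, the dominator fixes the type of all maximal elements, which gives the bound on the index.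

  \<^emph>\<open>Equivalence.\<close> On every infinite match a single fixpoint formula recurs and is eventually a free
  subformula of everything; it is above all other recurring formulas in the closure order, hence
  carries the largest recurring priority, of the parity of its type. A strategy at true positions is built
  by induction on the size of the formula, replaying a strategy for the body at each
  regeneration; for least fixpoints each regeneration lowers a well-founded rank, so that they
  cannot dominate a match. Applied to the dual formula, the same construction defeats every
  strategy of Eloise at false positions.
\<close>

subsection \<open>Substitution\<close>

text \<open>Both halves descend from a fixpoint formula to its body along a substitution map between
  closure graphs. This map preserves successors except at the substituted variable, but it is not
  injective. For the index, the preimage of a strongly connected set under it need not be strongly
  connected, so chains of formulas cannot be pulled back directly. Chains of sets can: a dominator
  is unique, so its type is a property of the set. Chains ending in the type dual to
  \<open>e\<close> get one extra unit of length, because level \<open>n\<close> for \<open>e\<close>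
  is closed under fixpoints of that dual type; membership in both classes at level \<open>ad\<close>
  removes the unit again. For the equivalence, a closure formula alone tells neither which point of
  the body is being played nor at which state the fixpoint was last regenerated. Hence strategies
  carry a memory, which is recovered from the history of the match.\<close>

lemma finite_FV: "finite (FV \<phi>)"
  by (induction \<phi>) auto

lemma finite_BV: "finite (BV \<phi>)"
  by (induction \<phi>) auto

lemma subst_not_free: "x \<notin> FV \<phi> \<Longrightarrow> subst \<phi> \<sigma> x = \<phi>"
  by (induction \<phi>) auto

lemma FV_subst_subset: "FV (subst \<phi> \<sigma> x) \<subseteq> (FV \<phi> - {x}) \<union> FV \<sigma>"
  by (induction \<phi>) auto

lemma FV_subst_superset: "FV \<phi> - {x} \<subseteq> FV (subst \<phi> \<sigma> x)"
  by (induction \<phi>) auto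

lemma BV_subst_subset: "BV (subst \<phi> \<sigma> x) \<subseteq> BV \<phi> \<union> BV \<sigma>"
  by (induction \<phi>) auto

lemma BV_subst_superset: "BV \<phi> \<subseteq> BV (subst \<phi> \<sigma> x)"
  by (induction \<phi>) auto

lemma BV_subst_arg: "x \<in> FV \<phi> \<Longrightarrow> BV \<sigma> \<subseteq> BV (subst \<phi> \<sigma> x)"
  by (induction \<phi>) auto

lemma BV_subst_Var: "BV (subst \<phi> (Var z) x) = BV \<phi>"
  by (induction \<phi>) auto

lemma size_subst_Var: "size (subst \<phi> (Var z) x) = size \<phi>"
  by (induction \<phi>) auto

lemma is_fix_subst: "is_fix \<phi> \<Longrightarrow> is_fix (subst \<phi> \<sigma> x) \<and> fix_type (subst \<phi> \<sigma> x) = fix_type \<phi>"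
  by (cases \<phi>) auto

lemma subst_rename:
  assumes "z \<notin> FV \<phi>" "z \<notin> BV \<phi>"
  shows "subst (subst \<phi> (Var z) x) \<sigma> z = subst \<phi> \<sigma> x"
  using assms by (induction \<phi>) (auto simp: subst_not_free)

lemma subst_commute:
  assumes "y \<noteq> z" "y \<notin> FV \<sigma>" "z \<notin> BV \<phi>"
  shows "subst (subst \<phi> \<alpha> y) \<sigma> z = subst (subst \<phi> \<sigma> z) (subst \<alpha> \<sigma> z) y"
  using assms by (induction \<phi>) (auto simp: subst_not_free)

text \<open>Unfolding a fixpoint commutes with the substitution by \<open>subst_commute\<close>; the
  other cases are immediate. \<open>Var z\<close> is excluded because there the trace enters
  \<open>\<sigma>\<close>.\<close>

lemma succs_subst:
  assumes "\<rho> \<noteq> Var z" "z \<notin> BV \<rho>" "BV \<rho> \<inter> FV \<sigma> = {}"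
  shows "succs (subst \<rho> \<sigma> z) = (\<lambda>a. subst a \<sigma> z) ` succs \<rho>"
  using assms by (cases \<rho>) (auto simp: subst_commute)

lemma ex_fresh: "\<exists>z::nat. z \<notin> FV \<phi> \<and> z \<notin> BV \<phi>"
proof -
  have "finite (FV \<phi> \<union> BV \<phi>)" by (simp add: finite_FV finite_BV)
  then show ?thesis using ex_new_if_finite[OF infinite_UNIV_nat] by blast
qed

subsection \<open>Free subformulas\<close>

text \<open>A structural form of \<open>free_sub\<close>: the context with a hole becomes a descent
  in the syntax tree, and the side condition at \<open>Fix\<close> forbids capture on the way. It
  opens transitivity and antisymmetry to induction.\<close>

fun fs :: "'p fm \<Rightarrow> 'p fm \<Rightarrow> bool" where
  "fs \<psi> (And a b) \<longleftrightarrow> And a b = \<psi> \<or> fs \<psi> a \<or> fs \<psi> b"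
| "fs \<psi> (Or a b) \<longleftrightarrow> Or a b = \<psi> \<or> fs \<psi> a \<or> fs \<psi> b"
| "fs \<psi> (Dia a) \<longleftrightarrow> Dia a = \<psi> \<or> fs \<psi> a"
| "fs \<psi> (Box a) \<longleftrightarrow> Box a = \<psi> \<or> fs \<psi> a"
| "fs \<psi> (Fix e y c) \<longleftrightarrow> Fix e y c = \<psi> \<or> (y \<notin> FV \<psi> \<and> fs \<psi> c)"
| "fs \<psi> a \<longleftrightarrow> a = \<psi>"

lemma fs_refl [simp]: "fs \<psi> \<psi>"
  by (cases \<psi>) auto

lemma free_for_not_free: "y \<notin> FV \<chi> \<Longrightarrow> free_for \<phi> y \<chi>"
  by (induction \<chi>) auto

lemma fs_if_subst: "y \<in> FV \<chi> \<Longrightarrow> free_for \<phi> y \<chi> \<Longrightarrow> fs \<phi> (subst \<chi> \<phi> y)"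
  by (induction \<chi>) auto

lemma fs_imp_subst:
  assumes "fs \<psi> \<rho>" "y \<notin> FV \<rho>" "y \<notin> BV \<rho>"
  shows "\<exists>\<chi>. y \<in> FV \<chi> \<and> free_for \<psi> y \<chi> \<and> \<rho> = subst \<chi> \<psi> y"
  using assms
proof (induction \<rho>)
  case (And a b)
  consider "And a b = \<psi>" | "fs \<psi> a" | "fs \<psi> b" using And.prems(1) by auto
  then show ?case
  proof cases
    case 2
    then obtain \<chi> where "y \<in> FV \<chi>" "free_for \<psi> y \<chi>" "a = subst \<chi> \<psi> y" using And by auto
    then show ?thesis using And.prems
      by (intro exI[of _ "And \<chi> b"]) (auto simp: subst_not_free free_for_not_free)
  next
    case 3
    then obtain \<chi> where "y \<in> FV \<chi>" "free_for \<psi> y \<chi>" "b = subst \<chi> \<psi> y" using And by auto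
    then show ?thesis using And.prems
      by (intro exI[of _ "And a \<chi>"]) (auto simp: subst_not_free free_for_not_free)
  qed (auto intro!: exI[of _ "Var y"])
next
  case (Or a b)
  consider "Or a b = \<psi>" | "fs \<psi> a" | "fs \<psi> b" using Or.prems(1) by auto
  then show ?case
  proof cases
    case 2
    then obtain \<chi> where "y \<in> FV \<chi>" "free_for \<psi> y \<chi>" "a = subst \<chi> \<psi> y" using Or by auto
    then show ?thesis using Or.prems
      by (intro exI[of _ "Or \<chi> b"]) (auto simp: subst_not_free free_for_not_free)
  next
    case 3
    then obtain \<chi> where "y \<in> FV \<chi>" "free_for \<psi> y \<chi>" "b = subst \<chi> \<psi> y" using Or by auto
    then show ?thesis using Or.prems
      by (intro exI[of _ "Or a \<chi>"]) (auto simp: subst_not_free free_for_not_free)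
  qed (auto intro!: exI[of _ "Var y"])
next
  case (Dia a)
  show ?case
  proof (cases "Dia a = \<psi>")
    case False
    then obtain \<chi> where "y \<in> FV \<chi>" "free_for \<psi> y \<chi>" "a = subst \<chi> \<psi> y" using Dia by auto
    then show ?thesis by (intro exI[of _ "Dia \<chi>"]) auto
  qed (auto intro!: exI[of _ "Var y"])
next
  case (Box a)
  show ?case
  proof (cases "Box a = \<psi>")
    case False
    then obtain \<chi> where "y \<in> FV \<chi>" "free_for \<psi> y \<chi>" "a = subst \<chi> \<psi> y" using Box by auto
    then show ?thesis by (intro exI[of _ "Box \<chi>"]) auto
  qed (auto intro!: exI[of _ "Var y"])
next
  case (Fix e w c)
  show ?case
  proof (cases "Fix e w c = \<psi>")
    case False
    then obtain \<chi> where "y \<in> FV \<chi>" "free_for \<psi> y \<chi>" "c = subst \<chi> \<psi> y" using Fix by auto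
    then show ?thesis using False Fix.prems by (intro exI[of _ "Fix e w \<chi>"]) auto
  qed (auto intro!: exI[of _ "Var y"])
qed (auto intro!: exI[of _ "Var y"])

lemma free_sub_iff_fs: "free_sub \<phi> \<psi> \<longleftrightarrow> fs \<phi> \<psi>"
proof
  assume "free_sub \<phi> \<psi>"
  then show "fs \<phi> \<psi>" unfolding free_sub_def using fs_if_subst by blast
next
  assume "fs \<phi> \<psi>"
  moreover obtain y where "y \<notin> FV \<psi>" "y \<notin> BV \<psi>" using ex_fresh by blast
  ultimately show "free_sub \<phi> \<psi>" unfolding free_sub_def using fs_imp_subst by blast
qed

lemma fs_FV: "fs \<phi> \<psi> \<Longrightarrow> FV \<phi> \<subseteq> FV \<psi>"
  by (induction \<psi>) auto

lemma fs_trans: "fs \<beta> \<gamma> \<Longrightarrow> fs \<alpha> \<beta> \<Longrightarrow> fs \<alpha> \<gamma>"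
  by (induction \<gamma>) (auto dest: fs_FV)

lemma fs_size: "fs \<phi> \<psi> \<Longrightarrow> \<phi> = \<psi> \<or> size \<phi> < size \<psi>"
  by (induction \<psi>) auto

lemma fs_antisym: "fs \<phi> \<psi> \<Longrightarrow> fs \<psi> \<phi> \<Longrightarrow> \<phi> = \<psi>"
  using fs_size[of \<phi> \<psi>] fs_size[of \<psi> \<phi>] by auto

lemma fs_subst:
  assumes "fs \<alpha> \<rho>" "BV \<rho> \<inter> FV \<sigma> = {}"
  shows "fs (subst \<alpha> \<sigma> z) (subst \<rho> \<sigma> z)"
  using assms
proof (induction \<rho>)
  case (Fix e y c)
  show ?case
  proof (cases "Fix e y c = \<alpha> \<or> y = z")
    case True
    then show ?thesis using Fix by (auto simp: subst_not_free)
  next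
    case False
    then have "y \<notin> FV (subst \<alpha> \<sigma> z)" using Fix.prems FV_subst_subset[of \<alpha> \<sigma> z] by auto
    then show ?thesis using Fix False by auto
  qed
qed auto

lemma fs_subst_arg:
  assumes "z \<in> FV \<rho>" "BV \<rho> \<inter> FV \<sigma> = {}"
  shows "fs \<sigma> (subst \<rho> \<sigma> z)"
  using assms by (induction \<rho>) auto

subsection \<open>Traces and the closure\<close>

lemma trace_rel_iff [simp]: "(a, b) \<in> trace_rel \<longleftrightarrow> b \<in> succs a"
  by (simp add: trace_rel_def)

lemma FV_succs: "b \<in> succs a \<Longrightarrow> FV b \<subseteq> FV a"
  using FV_subst_subset by (cases a) fastforce+

lemma BV_succs: "b \<in> succs a \<Longrightarrow> BV b \<subseteq> BV a"
  using BV_subst_subset by (cases a) fastforce+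

lemma FV_trace: "(a, b) \<in> trace_rel\<^sup>* \<Longrightarrow> FV b \<subseteq> FV a"
  by (induction rule: rtrancl_induct) (auto dest: FV_succs)

lemma BV_trace: "(a, b) \<in> trace_rel\<^sup>* \<Longrightarrow> BV b \<subseteq> BV a"
  by (induction rule: rtrancl_induct) (auto dest: BV_succs)

lemma tidy_trace: "tidy a \<Longrightarrow> (a, b) \<in> trace_rel\<^sup>* \<Longrightarrow> tidy b"
  using FV_trace[of a b] BV_trace[of a b] unfolding tidy_def by blast

lemma Clos_refl [simp]: "\<phi> \<in> Clos \<phi>"
  by (simp add: Clos_def)

lemma Clos_step: "\<rho> \<in> Clos \<phi> \<Longrightarrow> \<rho>' \<in> succs \<rho> \<Longrightarrow> \<rho>' \<in> Clos \<phi>"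
  unfolding Clos_def by (auto intro: rtrancl_into_rtrancl)

lemma Clos_trans: "\<rho> \<in> Clos \<phi> \<Longrightarrow> \<sigma> \<in> Clos \<rho> \<Longrightarrow> \<sigma> \<in> Clos \<phi>"
  unfolding Clos_def by auto

lemma Clos_FV: "\<rho> \<in> Clos \<phi> \<Longrightarrow> FV \<rho> \<subseteq> FV \<phi>"
  by (auto simp: Clos_def dest: FV_trace)

lemma Clos_BV: "\<rho> \<in> Clos \<phi> \<Longrightarrow> BV \<rho> \<subseteq> BV \<phi>"
  by (auto simp: Clos_def dest: BV_trace)

lemma Clos_tidy: "tidy \<phi> \<Longrightarrow> \<rho> \<in> Clos \<phi> \<Longrightarrow> tidy \<rho>"
  by (auto simp: Clos_def dest: tidy_trace)

lemma Clos_induct [consumes 1, case_names base step]: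
  assumes "\<rho> \<in> Clos \<phi>" "P \<phi>" "\<And>\<rho> \<rho>'. \<rho> \<in> Clos \<phi> \<Longrightarrow> P \<rho> \<Longrightarrow> \<rho>' \<in> succs \<rho> \<Longrightarrow> P \<rho>'"
  shows "P \<rho>"
proof -
  have "(\<phi>, \<rho>) \<in> trace_rel\<^sup>*" using assms(1) by (simp add: Clos_def)
  then show ?thesis
    by (induction rule: rtrancl_induct) (use assms(2,3) in \<open>auto simp: Clos_def\<close>)
qed

lemma Clos_cases: "\<rho> \<in> Clos \<phi> \<Longrightarrow> \<rho> = \<phi> \<or> (\<exists>a \<in> succs \<phi>. \<rho> \<in> Clos a)"
  unfolding Clos_def by (auto elim: converse_rtranclE)

lemma size_succs: "b \<in> succs a \<Longrightarrow> \<not> is_fix a \<Longrightarrow> size b < size a"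
  by (cases a) auto

lemma tidy_succs: "tidy a \<Longrightarrow> b \<in> succs a \<Longrightarrow> tidy b"
  using tidy_trace by (metis r_into_rtrancl trace_rel_iff)

text \<open>The conditions under which \<open>h\<close> is a homomorphism of closure graphs away
  from \<open>Var z\<close>. It is used with \<open>\<sigma>\<close> the fixpoint formula itself,
  for unfolding, and with the argument of the substitution rule of the alternation
  hierarchy.\<close>

locale subst_context =
  fixes \<phi> \<sigma> :: "'p fm" and z
  assumes tidy_phi: "tidy \<phi>" and disj: "BV \<phi> \<inter> FV \<sigma> = {}" and z_notin_BV: "z \<notin> BV \<phi>"
begin

abbreviation h where "h \<rho> \<equiv> subst \<rho> \<sigma> z"

lemma Clos_disj: "\<rho> \<in> Clos \<phi> \<Longrightarrow> BV \<rho> \<inter> FV \<sigma> = {}"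
  using Clos_BV disj by blast

lemma Clos_z: "\<rho> \<in> Clos \<phi> \<Longrightarrow> z \<notin> BV \<rho>"
  using Clos_BV z_notin_BV by blast

lemma succs_lift: "\<rho> \<in> Clos \<phi> \<Longrightarrow> \<rho> \<noteq> Var z \<Longrightarrow> succs (h \<rho>) = h ` succs \<rho>"
  by (intro succs_subst) (auto simp: Clos_disj Clos_z)

lemma fs_lift: "\<rho> \<in> Clos \<phi> \<Longrightarrow> fs \<alpha> \<rho> \<Longrightarrow> fs (h \<alpha>) (h \<rho>)"
  using Clos_disj fs_subst by blast

text \<open>Free variables only shrink along traces, so a formula from which \<open>Var z\<close> is
  reachable has \<open>z\<close> free.\<close>

lemma fs_sigma_lift:
  assumes "\<rho> \<in> Clos \<phi>" "Var z \<in> Clos \<rho>"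
  shows "fs \<sigma> (h \<rho>)"
  using assms Clos_disj Clos_FV[of "Var z" \<rho>] by (intro fs_subst_arg) auto

end

text \<open>In a tidy \<open>Fix e x c\<close> the body \<open>c\<close> need not be tidy, as \<open>x\<close> may be bound
  again inside \<open>c\<close>. Renaming the free occurrences of \<open>x\<close> to a fresh \<open>z\<close> repairs this,
  so inductions go by size and descend to \<open>subst c (Var z) x\<close>.\<close>

locale fresh_unfolding =
  fixes e x c z and \<psi> c' :: "'p fm"
  assumes tidy_psi: "tidy (Fix e x c)"
    and z_FV: "z \<notin> FV (Fix e x c)" and z_BV: "z \<notin> BV (Fix e x c)"
    and psi_def: "\<psi> = Fix e x c" and c'_def: "c' = subst c (Var z) x"
begin

lemma size_c': "size c' < size \<psi>"
  by (simp add: c'_def psi_def size_subst_Var)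

lemma z_not_c: "z \<notin> FV c" "z \<notin> BV c" "z \<noteq> x"
  using z_FV z_BV by auto

lemma BV_c': "BV c' = BV c"
  by (simp add: c'_def BV_subst_Var)

lemma FV_c': "FV c' \<subseteq> insert z (FV \<psi>)"
  using FV_subst_subset[of c "Var z" x] by (auto simp: c'_def psi_def)

lemma tidy_c': "tidy c'"
  using tidy_psi FV_c' z_BV unfolding tidy_def psi_def BV_c' by auto

lemma unfold_psi: "subst c' \<psi> z = subst c \<psi> x"
  unfolding c'_def using subst_rename z_not_c by blast

lemma succs_psi: "succs \<psi> = {subst c' \<psi> z}"
  by (simp add: unfold_psi) (simp add: psi_def)

sublocale subst_context c' \<psi> z
  using tidy_psi tidy_c' z_not_c
  by unfold_locales (auto simp: BV_c' tidy_def psi_def)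

text \<open>The image of \<open>Clos c'\<close> is closed under successors: only the leaf
  \<open>Var z\<close> could lead out of it, and its image is \<open>\<psi>\<close>, whose sole
  successor \<open>subst c' \<psi> z\<close> is again an image. Finiteness of closures by induction
  on size rests on this.\<close>

lemma Clos_psi: "\<rho> \<in> Clos \<psi> \<Longrightarrow> \<rho> = \<psi> \<or> \<rho> \<in> (\<lambda>a. subst a \<psi> z) ` Clos c'"
proof (induction rule: Clos_induct)
  case (step \<rho> \<rho>')
  have succ: "\<rho>' \<in> succs \<rho>" by fact
  have "\<rho>' \<in> (\<lambda>a. subst a \<psi> z) ` Clos c'" if "\<rho> = \<psi>" using succ that by (simp add: succs_psi)
  moreover have "\<rho>' \<in> (\<lambda>a. subst a \<psi> z) ` Clos c'" if s: "\<sigma> \<in> Clos c'" "\<rho> = subst \<sigma> \<psi> z" "\<rho> \<noteq> \<psi>" for \<sigma>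
  proof -
    have "\<sigma> \<noteq> Var z" using s by auto
    then obtain \<sigma>' where "\<sigma>' \<in> succs \<sigma>" "\<rho>' = subst \<sigma>' \<psi> z"
      using succ s succs_lift[of \<sigma>] by auto
    then show ?thesis using Clos_step s(1) by blast
  qed
  ultimately show ?case using step.IH by blast
qed simp

end

lemma fresh_unfolding_exists:
  assumes "tidy (Fix e x c)"
  obtains z where "fresh_unfolding e x c z (Fix e x c) (subst c (Var z) x)"
  using ex_fresh[of "Fix e x c"] assms unfolding fresh_unfolding_def by blast

lemma finite_Clos: "tidy \<phi> \<Longrightarrow> finite (Clos \<phi>)"
proof (induction "size \<phi>" arbitrary: \<phi> rule: less_induct)
  case less
  show ?case
  proof (cases "is_fix \<phi>")
    case True
    then obtain e x c where \<phi>: "\<phi> = Fix e x c" by (cases \<phi>) auto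
    obtain z where z: "fresh_unfolding e x c z (Fix e x c) (subst c (Var z) x)"
      using fresh_unfolding_exists less.prems \<phi> by blast
    interpret fresh_unfolding e x c z "Fix e x c" "subst c (Var z) x" by (rule z)
    have "finite (Clos (subst c (Var z) x))" using less.hyps size_c' tidy_c' \<phi> by blast
    moreover have "Clos \<phi> \<subseteq> insert \<phi> ((\<lambda>a. subst a \<phi> z) ` Clos (subst c (Var z) x))"
      using Clos_psi \<phi> by blast
    ultimately show ?thesis by (meson finite.insertI finite_imageI finite_subset)
  next
    case False
    have "Clos \<phi> \<subseteq> insert \<phi> (\<Union>a\<in>succs \<phi>. Clos a)" using Clos_cases by blast
    moreover have "finite (succs \<phi>)" by (cases \<phi>) auto
    moreover have "finite (Clos a)" if "a \<in> succs \<phi>" for a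
      using less False that size_succs tidy_succs by blast
    ultimately show ?thesis by (meson finite.insertI finite_UN_I finite_subset)
  qed
qed

lemma within_iff: "(a, b) \<in> trace_rel_within \<psi> \<longleftrightarrow> b \<in> succs a \<and> fs \<psi> a \<and> fs \<psi> b"
  by (simp add: trace_rel_within_def free_sub_iff_fs)

lemma within_subset: "(a, b) \<in> (trace_rel_within \<psi>)\<^sup>* \<Longrightarrow> (a, b) \<in> trace_rel\<^sup>*"
  by (erule rtrancl_mono[THEN subsetD, rotated]) (auto simp: within_iff)

text \<open>In the fixpoint case the trace is found in the renamed body and carried over by the
  substitution, which fixes \<open>\<alpha>\<close> because \<open>z\<close> is not free in it. This
  supplies the way back that puts comparable formulas into one cluster.\<close>

lemma fs_trace_within:
  assumes "fs \<alpha> \<rho>" "tidy \<rho>"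
  shows "(\<rho>, \<alpha>) \<in> (trace_rel_within \<alpha>)\<^sup>*"
  using assms
proof (induction "size \<rho>" arbitrary: \<rho> rule: less_induct)
  case less
  show ?case
  proof (cases "\<rho> = \<alpha>")
    case neq: False
    show ?thesis
    proof (cases "is_fix \<rho>")
      case False
      obtain \<rho>' where r: "\<rho>' \<in> succs \<rho>" "fs \<alpha> \<rho>'" using False neq less.prems(1) by (cases \<rho>) auto
      then have "(\<rho>', \<alpha>) \<in> (trace_rel_within \<alpha>)\<^sup>*"
        using less False size_succs tidy_succs by blast
      then show ?thesis using r less.prems(1) by (auto simp: within_iff intro: converse_rtrancl_into_rtrancl)
    next
      case True
      then obtain e x c where \<rho>: "\<rho> = Fix e x c" by (cases \<rho>) auto
      have fa: "x \<notin> FV \<alpha>" "fs \<alpha> c" using less.prems(1) neq \<rho> by auto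
      obtain z where z: "fresh_unfolding e x c z (Fix e x c) (subst c (Var z) x)"
        using fresh_unfolding_exists less.prems \<rho> by blast
      interpret fresh_unfolding e x c z "Fix e x c" "subst c (Var z) x" by (rule z)
      let ?c = "subst c (Var z) x"
      have zalpha: "z \<notin> FV \<alpha>" using fs_FV[OF less.prems(1)] z_FV \<rho> by blast
      have "fs (subst \<alpha> (Var z) x) ?c" using fs_subst[OF fa(2), of "Var z" x] z_not_c by auto
      then have "fs \<alpha> ?c" using fa by (simp add: subst_not_free)
      then have "(?c, \<alpha>) \<in> (trace_rel_within \<alpha>)\<^sup>*"
        using less.hyps[of ?c] size_c' tidy_c' \<rho> by simp
      moreover have "u \<in> Clos ?c \<and> (subst ?c \<rho> z, subst u \<rho> z) \<in> (trace_rel_within \<alpha>)\<^sup>*"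
        if "(?c, u) \<in> (trace_rel_within \<alpha>)\<^sup>*" for u
        using that
      proof (induction rule: rtrancl_induct)
        case (step y y')
        have y: "y' \<in> succs y" "fs \<alpha> y" "fs \<alpha> y'" "y \<in> Clos ?c"
          using step by (auto simp: within_iff)
        have y': "y' \<in> Clos ?c" using y Clos_step by blast
        have sub: "fs \<alpha> (subst u \<rho> z)" if "u \<in> Clos ?c" "fs \<alpha> u" for u
          using fs_subst[OF that(2), of \<rho> z] Clos_disj[OF that(1)] \<rho> zalpha by (simp add: subst_not_free)
        have "y \<noteq> Var z" using y(1) by auto
        then have "subst y' \<rho> z \<in> succs (subst y \<rho> z)" using succs_lift[OF y(4)] y(1) \<rho> by auto
        then show ?case using step.IH y y' sub
          by (auto simp: within_iff intro: rtrancl_into_rtrancl)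
      qed simp
      ultimately have "(subst ?c \<rho> z, subst \<alpha> \<rho> z) \<in> (trace_rel_within \<alpha>)\<^sup>*" by blast
      then have "(subst ?c \<rho> z, \<alpha>) \<in> (trace_rel_within \<alpha>)\<^sup>*" using zalpha by (simp add: subst_not_free)
      moreover have "fs \<alpha> (subst ?c \<rho> z)" 
        using fs_subst[OF \<open>fs \<alpha> ?c\<close>, of \<rho> z] Clos_disj[of ?c] \<rho> zalpha by (simp add: subst_not_free)
      ultimately show ?thesis using less.prems(1) succs_psi \<rho>
        by (auto simp: within_iff intro: converse_rtrancl_into_rtrancl)
    qed
  qed simp
qed

subsection \<open>Strongly connected sets and their dominators\<close>

text \<open>Since \<open>rtrancl\<close> is reflexive, a singleton without a loop qualifies. This
  admits the one-element cluster of a fixpoint formula that does not return to itself.\<close>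

definition sconn :: "'p fm set \<Rightarrow> bool" where
  "sconn S \<longleftrightarrow> finite S \<and> S \<noteq> {} \<and> (\<forall>a\<in>S. \<forall>b\<in>S. (a, b) \<in> (trace_rel \<inter> S \<times> S)\<^sup>*)"

definition dominates :: "'p fm \<Rightarrow> 'p fm set \<Rightarrow> bool" where
  "dominates \<psi> S \<longleftrightarrow> \<psi> \<in> S \<and> is_fix \<psi> \<and> (\<forall>\<rho>\<in>S. fs \<psi> \<rho>)"

text \<open>The back condition of a bounded morphism from \<open>L\<close> to \<open>S\<close>, with
  no demand that \<open>g\<close> be injective.\<close>

definition lifts :: "('p fm \<Rightarrow> 'p fm) \<Rightarrow> 'p fm set \<Rightarrow> 'p fm set \<Rightarrow> bool" where
  "lifts g L S \<longleftrightarrow> g ` L \<subseteq> S \<and> (\<forall>\<rho>\<in>L. succs (g \<rho>) \<inter> S \<subseteq> g ` (succs \<rho> \<inter> L))"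

lemma dominates_unique: "dominates \<psi> S \<Longrightarrow> dominates \<psi>' S \<Longrightarrow> \<psi> = \<psi>'"
  unfolding dominates_def using fs_antisym by blast

lemma dominates_image:
  assumes "dominates \<psi> S" "\<forall>\<rho>\<in>S. BV \<rho> \<inter> FV \<sigma> = {}"
  shows "dominates (subst \<psi> \<sigma> z) ((\<lambda>a. subst a \<sigma> z) ` S)"
  using assms fs_subst is_fix_subst unfolding dominates_def by blast

lemma Restr_rtrancl_mem: "(a, b) \<in> (r \<inter> S \<times> S)\<^sup>* \<Longrightarrow> a \<in> S \<Longrightarrow> b \<in> S"
  by (induction rule: rtrancl_induct) auto

lemma Restr_rtrancl: "(a, b) \<in> (r \<inter> S \<times> S)\<^sup>* \<Longrightarrow> (a, b) \<in> r\<^sup>*"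
  by (rule subsetD[OF rtrancl_mono]) auto

lemma sconn_Clos: "sconn S \<Longrightarrow> a \<in> S \<Longrightarrow> S \<subseteq> Clos a"
  unfolding sconn_def Clos_def by (auto intro!: Restr_rtrancl[of _ _ trace_rel S])

text \<open>Take \<open>S'\<close> to be a terminal strongly connected component of \<open>L\<close>: since all edges of \<open>S\<close> lift
  to \<open>L\<close>, it still covers all of \<open>S\<close>.\<close>

lemma lifts_terminal:
  assumes lf: "lifts g L S" and L: "finite L" "L \<noteq> {}" and S: "sconn S"
  obtains S' where "S' \<subseteq> L" "sconn S'" "g ` S' = S" "lifts g S' S"
proof -
  let ?E = "trace_rel \<inter> L \<times> L"
  define reach where "reach \<rho> = {\<sigma>. (\<rho>, \<sigma>) \<in> ?E\<^sup>*}" for \<rho>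
  have rL: "reach \<rho> \<subseteq> L" if "\<rho> \<in> L" for \<rho>
    using that unfolding reach_def by (auto dest: Restr_rtrancl_mem)
  \<comment> \<open>A point whose reachable set has least cardinality lies in a terminal component:
    whatever it reaches has the same reachable set.\<close>
  obtain \<rho> where \<rho>: "\<rho> \<in> L" "\<And>\<sigma>. \<sigma> \<in> L \<Longrightarrow> card (reach \<rho>) \<le> card (reach \<sigma>)"
    using ex_min_if_finite[of "(\<lambda>\<rho>. card (reach \<rho>)) ` L"] L by (auto simp: not_less)
  define S' where "S' = reach \<rho>"
  have S'L: "S' \<subseteq> L" using rL \<rho> S'_def by blast
  have rS': "reach \<sigma> = S'" if "\<sigma> \<in> S'" for \<sigma>
  proof -
    have "reach \<sigma> \<subseteq> S'" using that unfolding S'_def reach_def by auto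
    moreover have "card S' \<le> card (reach \<sigma>)" using \<rho> that S'L S'_def by blast
    moreover have "finite S'" using S'L L finite_subset by blast
    ultimately show ?thesis by (simp add: card_seteq)
  qed
  have path: "(\<sigma>, \<tau>) \<in> (trace_rel \<inter> S' \<times> S')\<^sup>*" if "(\<sigma>, \<tau>) \<in> ?E\<^sup>*" "\<sigma> \<in> S'" for \<sigma> \<tau>
    using that
  proof (induction rule: rtrancl_induct)
    case (step y y')
    then have "y \<in> S'" "y' \<in> S'"
      using rS'[OF step.prems] unfolding reach_def by (auto intro: rtrancl_into_rtrancl)
    then show ?case using step by (auto intro: rtrancl_into_rtrancl)
  qed simp
  have "sconn S'"
    unfolding sconn_def
  proof (intro conjI ballI)
    show "finite S'" using S'L L finite_subset by blast
    show "S' \<noteq> {}" unfolding S'_def reach_def by auto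
    fix a b assume "a \<in> S'" "b \<in> S'"
    then show "(a, b) \<in> (trace_rel \<inter> S' \<times> S')\<^sup>*"
      using rS' path unfolding reach_def by blast
  qed
  have lf': "lifts g S' S"
    unfolding lifts_def
  proof (intro conjI ballI subsetI)
    show "\<And>s. s \<in> g ` S' \<Longrightarrow> s \<in> S" using lf S'L unfolding lifts_def by blast
    fix \<sigma> \<tau> assume \<sigma>: "\<sigma> \<in> S'" "\<tau> \<in> succs (g \<sigma>) \<inter> S"
    then obtain \<tau>' where \<tau>': "\<tau>' \<in> succs \<sigma>" "\<tau>' \<in> L" "\<tau> = g \<tau>'"
      using lf S'L unfolding lifts_def by blast
    then have "\<tau>' \<in> reach \<sigma>" using \<sigma> S'L unfolding reach_def by auto
    then show "\<tau> \<in> g ` (succs \<sigma> \<inter> S')" using \<tau>' rS' \<sigma> by blast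
  qed
  have "S \<subseteq> g ` S'"
  proof
    fix s assume "s \<in> S"
    moreover have "g \<rho> \<in> S" using lf \<rho> unfolding lifts_def by blast
    ultimately have "(g \<rho>, s) \<in> (trace_rel \<inter> S \<times> S)\<^sup>*" using S unfolding sconn_def by blast
    then show "s \<in> g ` S'"
    proof (induction rule: rtrancl_induct)
      case base
      then show ?case unfolding S'_def reach_def by auto
    next
      case (step y y')
      then obtain \<sigma> where "\<sigma> \<in> S'" "y = g \<sigma>" by blast
      then show ?case using step(2) lf' unfolding lifts_def by fastforce
    qed
  qed
  then have "g ` S' = S" using lf' unfolding lifts_def by blast
  then show ?thesis using that S'L \<open>sconn S'\<close> lf' by blast
qed

text \<open>If some member of the preimage of \<open>S\<close> cannot reach \<open>Var z\<close>
  inside that preimage, the part reachable from it avoids the only point where edges fail to lift.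
  Otherwise every member has a trace to \<open>Var z\<close>, and so its image contains
  \<open>\<psi>\<close>.\<close>

lemma (in fresh_unfolding) dominates_or_lifts:
  assumes S: "sconn S" "S \<subseteq> Clos \<psi>"
  obtains "dominates \<psi> S"
    | L where "L \<subseteq> Clos c'" "L \<noteq> {}" "Var z \<notin> L" "lifts h L S"
proof -
  define L0 where "L0 = {\<rho> \<in> Clos c'. h \<rho> \<in> S}"
  let ?E = "trace_rel \<inter> L0 \<times> L0"
  show ?thesis
  proof (cases "\<exists>\<rho>\<in>L0. (\<rho>, Var z) \<notin> ?E\<^sup>*")
    case True
    then obtain \<rho> where \<rho>: "\<rho> \<in> L0" "(\<rho>, Var z) \<notin> ?E\<^sup>*" by blast
    define L where "L = {\<sigma>. (\<rho>, \<sigma>) \<in> ?E\<^sup>*}"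
    have L: "L \<subseteq> L0" using \<rho> unfolding L_def by (auto dest: Restr_rtrancl_mem)
    have "lifts h L S"
      unfolding lifts_def
    proof (intro conjI ballI subsetI)
      show "\<And>s. s \<in> h ` L \<Longrightarrow> s \<in> S" using L L0_def by blast
      fix \<sigma> \<tau> assume \<sigma>: "\<sigma> \<in> L" "\<tau> \<in> succs (h \<sigma>) \<inter> S"
      have "\<sigma> \<noteq> Var z" using \<sigma> \<rho> L_def by auto
      moreover have c: "\<sigma> \<in> Clos c'" using \<sigma> L L0_def by blast
      ultimately obtain \<tau>' where \<tau>': "\<tau>' \<in> succs \<sigma>" "\<tau> = h \<tau>'" using succs_lift \<sigma> by blast
      then have "\<tau>' \<in> L0" using c \<sigma> Clos_step unfolding L0_def by blast
      then have "\<tau>' \<in> L" using \<sigma> \<tau>' L unfolding L_def by (auto intro: rtrancl_into_rtrancl)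
      then show "\<tau> \<in> h ` (succs \<sigma> \<inter> L)" using \<tau>' by blast
    qed
    moreover have "L \<noteq> {}" "Var z \<notin> L" "L \<subseteq> Clos c'" using \<rho> L L0_def L_def by auto
    ultimately show ?thesis using that by blast
  next
    case False
    have fs: "fs \<psi> (h \<rho>)" if "\<rho> \<in> L0" for \<rho>
    proof -
      have "(\<rho>, Var z) \<in> trace_rel\<^sup>*" using False that by (auto intro!: Restr_rtrancl[of _ _ trace_rel L0])
      then show ?thesis using that fs_sigma_lift unfolding L0_def Clos_def by blast
    qed
    have "\<psi> \<in> S"
    proof (cases "L0 = {}")
      case True
      then show ?thesis using S Clos_psi unfolding L0_def sconn_def by blast
    next
      case f: False
      then have "Var z \<in> L0" using False by (auto dest: Restr_rtrancl_mem)
      then show ?thesis unfolding L0_def by simp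
    qed
    moreover have "fs \<psi> \<rho>" if r: "\<rho> \<in> S" for \<rho>
    proof (cases "\<rho> = \<psi>")
      case False
      then obtain \<rho>' where "\<rho>' \<in> Clos c'" "\<rho> = h \<rho>'" using Clos_psi S r by blast
      then show ?thesis using fs[of \<rho>'] r L0_def by blast
    qed simp
    ultimately have "dominates \<psi> S" unfolding dominates_def by (simp add: psi_def)
    then show ?thesis using that by blast
  qed
qed

lemma sconn_succ:
  assumes "sconn S" "a \<in> S" "b \<in> S" "b \<in> succs a" "\<rho> \<in> S"
  shows "succs \<rho> \<inter> S \<noteq> {}"
proof -
  have "(\<rho>, a) \<in> (trace_rel \<inter> S \<times> S)\<^sup>*" using assms unfolding sconn_def by blast
  then show ?thesis by (cases rule: converse_rtranclE) (use assms in auto)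
qed

text \<open>For a fixpoint formula, either it dominates or the problem lifts to the smaller body,
  and the dominator found there is mapped forward. For any other formula, \<open>S\<close> lies in
  the closure of one successor. The edge in \<open>S\<close> rules out sets such as a single
  atom.\<close>

lemma dominator_exists:
  assumes "tidy \<phi>" "S \<subseteq> Clos \<phi>" "sconn S" "a \<in> S" "b \<in> S" "b \<in> succs a"
  shows "\<exists>\<psi>. dominates \<psi> S"
  using assms
proof (induction "size \<phi>" arbitrary: \<phi> S a b rule: less_induct)
  case less
  show ?case
  proof (cases "is_fix \<phi>")
    case True
    then obtain e x c where \<phi>: "\<phi> = Fix e x c" by (cases \<phi>) auto
    obtain z where z: "fresh_unfolding e x c z (Fix e x c) (subst c (Var z) x)"
      using fresh_unfolding_exists less.prems \<phi> by blast
    define c' where "c' = subst c (Var z) x"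
    interpret fresh_unfolding e x c z \<phi> c' using z \<phi> c'_def by simp
    from less.prems(3,2) show ?thesis
    proof (cases rule: dominates_or_lifts)
      case (2 L)
      have "finite L" using 2 finite_Clos tidy_c' finite_subset by blast
      obtain S' where S': "S' \<subseteq> L" "sconn S'" "h ` S' = S" "lifts h S' S"
        by (rule lifts_terminal[OF 2(4) \<open>finite L\<close> 2(2) less.prems(3)])
      then obtain \<rho> where "\<rho> \<in> S'" unfolding sconn_def by blast
      moreover have "succs (h \<rho>) \<inter> S \<noteq> {}" using sconn_succ less.prems S' calculation by blast
      ultimately obtain \<sigma> where "\<rho> \<in> S'" "\<sigma> \<in> S'" "\<sigma> \<in> succs \<rho>" using S'(4) unfolding lifts_def by blast
      then obtain \<psi>' where "dominates \<psi>' S'"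
        using less.hyps[of c' S'] size_c' tidy_c' S' 2 by blast
      then have "dominates (h \<psi>') (h ` S')" using dominates_image Clos_disj S' 2 by blast
      then show ?thesis using S' by blast
    qed blast
  next
    case False
    have "\<exists>d\<in>succs \<phi>. S \<inter> Clos d \<noteq> {}"
    proof (cases "a = \<phi>")
      case True
      then show ?thesis using less.prems(5,6) Clos_refl[of b] by blast
    next
      case False
      then show ?thesis using less.prems(2,4) Clos_cases[of a \<phi>] by blast
    qed
    then obtain d u where d: "d \<in> succs \<phi>" "u \<in> S" "u \<in> Clos d" by blast
    have "S \<subseteq> Clos d" using sconn_Clos[OF less.prems(3) d(2)] Clos_trans[OF d(3)] by blast
    then show ?thesis
      using less.hyps[OF size_succs[OF d(1) False] tidy_succs[OF less.prems(1) d(1)]] less.prems(3-6) by blast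
  qed
qed

subsection \<open>Alternating chains of strongly connected sets\<close>

text \<open>\<open>loop_chain m t S\<close>: there is a chain of \<open>m\<close> strongly connected sets ending in \<open>S\<close> whose
  dominators alternate in type; \<open>t\<close> is the type of the dominator of \<open>S\<close>. Unlike alternating chains
  of formulas, these can be lifted along a substitution.\<close>

inductive loop_chain :: "nat \<Rightarrow> fp \<Rightarrow> 'p fm set \<Rightarrow> bool" where
  single: "sconn S \<Longrightarrow> dominates \<psi> S \<Longrightarrow> loop_chain 1 (fix_type \<psi>) S"
| extend: "loop_chain m t S0 \<Longrightarrow> S0 \<subseteq> S \<Longrightarrow> sconn S \<Longrightarrow> dominates \<psi> S \<Longrightarrow> fix_type \<psi> = dual t
    \<Longrightarrow> loop_chain (Suc m) (dual t) S"

lemma loop_chain_sconn: "loop_chain m t S \<Longrightarrow> sconn S"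
  by (auto elim: loop_chain.cases)

text \<open>The counterpart of \<open>AH e n\<close> for the closure graph: the slack of one for the
  type dual to \<open>e\<close> pays for the rule that adds a fixpoint of that type.\<close>

definition depth_le :: "fp \<Rightarrow> nat \<Rightarrow> 'p fm \<Rightarrow> bool" where
  "depth_le e n \<phi> \<longleftrightarrow> (\<forall>m t S. loop_chain m t S \<longrightarrow> S \<subseteq> Clos \<phi> \<longrightarrow> m \<le> n + (if t = e then 0 else 1))"

text \<open>A dominator of \<open>S'\<close> is mapped to a dominator of \<open>S\<close>, which by
  uniqueness is \<open>\<psi>\<close>; so the type survives. Without an edge \<open>S'\<close> is a
  singleton, and as its member is not \<open>Var z\<close>, it is a fixpoint formula because its
  image is.\<close>

lemma (in subst_context) dominator_lift:
  assumes S': "S' \<subseteq> Clos \<phi>" "Var z \<notin> S'" "sconn S'" "lifts h S' S" "h ` S' = S"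
    and S: "sconn S" "dominates \<psi> S"
  obtains \<psi>' where "dominates \<psi>' S'" "fix_type \<psi>' = fix_type \<psi>"
proof -
  have "\<exists>\<psi>'. dominates \<psi>' S'"
  proof (cases "\<exists>a\<in>S'. \<exists>b\<in>S'. b \<in> succs a")
    case True
    then show ?thesis using dominator_exists tidy_phi S' by blast
  next
    case False
    obtain \<rho> where \<rho>: "\<rho> \<in> S'" using S' unfolding sconn_def by blast
    have "S' = {\<rho>}"
    proof -
      have "\<sigma> = \<rho>" if "\<sigma> \<in> S'" for \<sigma>
      proof -
        have "(\<rho>, \<sigma>) \<in> (trace_rel \<inter> S' \<times> S')\<^sup>*" using S' that \<rho> unfolding sconn_def by blast
        then show ?thesis by (cases rule: converse_rtranclE) (use False in auto)
      qed
      then show ?thesis using \<rho> by blast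
    qed
    moreover from this have "is_fix (h \<rho>)" using S S' unfolding dominates_def by auto
    then have "is_fix \<rho>" using \<rho> S'(2) by (cases \<rho>) (auto split: if_splits)
    ultimately have "dominates \<rho> S'" unfolding dominates_def by auto
    then show ?thesis by blast
  qed
  then obtain \<psi>' where d: "dominates \<psi>' S'" by blast
  then have "dominates (h \<psi>') S" using dominates_image[OF d, of \<sigma> z] Clos_disj S' by blast
  then have "h \<psi>' = \<psi>" using dominates_unique S by blast
  then have "fix_type \<psi>' = fix_type \<psi>" using d is_fix_subst unfolding dominates_def by metis
  then show ?thesis using that d by blast
qed

lemma (in subst_context) loop_chain_lift:
  assumes "loop_chain m t S" "L \<subseteq> Clos \<phi>" "L \<noteq> {}" "Var z \<notin> L" "lifts h L S"
  shows "\<exists>S'\<subseteq>L. loop_chain m t S'"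
  using assms
proof (induction arbitrary: L rule: loop_chain.induct)
  case (single S \<psi>)
  have "finite L" using single finite_Clos tidy_phi finite_subset by blast
  obtain S' where S': "S' \<subseteq> L" "sconn S'" "h ` S' = S" "lifts h S' S"
    by (rule lifts_terminal[OF single.prems(4) \<open>finite L\<close> single.prems(2) single.hyps(1)])
  have c: "S' \<subseteq> Clos \<phi>" "Var z \<notin> S'" using S' single by auto
  obtain \<psi>' where \<psi>': "dominates \<psi>' S'" "fix_type \<psi>' = fix_type \<psi>"
    by (rule dominator_lift[OF c S'(2,4,3) single.hyps])
  then have "loop_chain 1 (fix_type \<psi>) S'" using loop_chain.single[OF S'(2) \<psi>'(1)] by simp
  then show ?case using S' by blast
next
  case (extend m t S0 S \<psi>)
  have "finite L" using extend.prems(1) finite_Clos tidy_phi finite_subset by blast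
  obtain S' where S': "S' \<subseteq> L" "sconn S'" "h ` S' = S" "lifts h S' S"
    by (rule lifts_terminal[OF extend.prems(4) \<open>finite L\<close> extend.prems(2) extend.hyps(3)])
  have c: "S' \<subseteq> Clos \<phi>" "Var z \<notin> S'" using S'(1) extend.prems(1,3) by auto
  obtain \<psi>' where \<psi>': "dominates \<psi>' S'" "fix_type \<psi>' = fix_type \<psi>"
    by (rule dominator_lift[OF c S'(2,4,3) extend.hyps(3,4)])
  \<comment> \<open>The preimage of \<open>S0\<close> is taken inside the lift already chosen for
    \<open>S\<close>, so that the lifted sets remain nested.\<close>
  define L0 where "L0 = {\<rho> \<in> S'. h \<rho> \<in> S0}"
  have "S0 \<noteq> {}" using loop_chain_sconn[OF extend.hyps(1)] unfolding sconn_def by blast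
  then have "L0 \<noteq> {}" using S'(3) extend.hyps(2) unfolding L0_def by blast
  moreover have "lifts h L0 S0" using S'(4) extend.hyps(2) unfolding lifts_def L0_def by blast
  moreover have "L0 \<subseteq> Clos \<phi>" "Var z \<notin> L0" using c unfolding L0_def by auto
  ultimately obtain S0' where "S0' \<subseteq> L0" "loop_chain m t S0'" using extend.IH by blast
  then have "loop_chain (Suc m) (dual t) S'"
    using loop_chain.extend[of m t S0' S' \<psi>'] S'(2) \<psi>' extend.hyps(5) unfolding L0_def by auto
  then show ?case using S' by blast
qed

text \<open>If \<open>\<psi>\<close> dominates the top set, that set has the type with slack, and
  the set below it has type \<open>e'\<close> and length at most \<open>n\<close> by induction. In
  the other case the whole chain lifts to the body.\<close>

lemma (in fresh_unfolding) depth_le_fix: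
  assumes "depth_le e' n c'" "e = dual e'"
  shows "depth_le e' n \<psi>"
  unfolding depth_le_def
proof (intro allI impI)
  fix m t S assume "loop_chain m t S" "S \<subseteq> Clos \<psi>"
  then show "m \<le> n + (if t = e' then 0 else 1)"
  proof (induction rule: loop_chain.induct)
    case (single S \<psi>')
    from single(1,3) show ?case
    proof (cases rule: dominates_or_lifts)
      case 1
      then have "\<psi>' = \<psi>" using single.hyps(2) dominates_unique by blast
      then show ?thesis using assms by (cases e') (auto simp: psi_def)
    next
      case (2 L)
      then show ?thesis using loop_chain_lift[OF loop_chain.single[OF single(1,2)], of L] assms(1)
        unfolding depth_le_def by blast
    qed
  next
    case (extend m t S0 S \<psi>')
    from extend(3,7) show ?case
    proof (cases rule: dominates_or_lifts)
      case 1
      then have "\<psi>' = \<psi>" using extend.hyps(4) dominates_unique by blast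
      then have "t = e'" using assms extend by (cases e'; cases t) (auto simp: psi_def)
      then show ?thesis using extend by (cases e') auto
    next
      case (2 L)
      then show ?thesis using loop_chain_lift[OF loop_chain.extend[OF extend(1-5)], of L] assms(1)
        unfolding depth_le_def by blast
    qed
  qed
qed

lemma (in subst_context) Clos_subst: "\<rho> \<in> Clos (h \<phi>) \<Longrightarrow> \<rho> \<in> h ` Clos \<phi> \<or> \<rho> \<in> Clos \<sigma>"
proof (induction rule: Clos_induct)
  case (step \<rho> \<rho>')
  have succ: "\<rho>' \<in> succs \<rho>" by fact
  have "\<rho>' \<in> h ` Clos \<phi>" if s: "\<sigma>' \<in> Clos \<phi>" "\<rho> = h \<sigma>'" "\<rho> \<notin> Clos \<sigma>" for \<sigma>'
  proof -
    have "\<sigma>' \<noteq> Var z" using s by auto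
    then obtain \<tau> where "\<tau> \<in> succs \<sigma>'" "\<rho>' = h \<tau>" using succ s succs_lift[of \<sigma>'] by auto
    then show ?thesis using Clos_step s(1) by blast
  qed
  then show ?case using step.IH succ Clos_step by blast
qed simp

text \<open>A strongly connected set that meets \<open>Clos \<sigma>\<close> stays inside it. One
  that does not has a preimage avoiding \<open>Var z\<close>, so its chain lifts to
  \<open>Clos \<phi>\<close>.\<close>

lemma (in subst_context) depth_le_subst:
  assumes "depth_le e n \<phi>" "depth_le e n \<sigma>"
  shows "depth_le e n (h \<phi>)"
  unfolding depth_le_def
proof (intro allI impI)
  fix m t S assume S: "loop_chain m t S" "S \<subseteq> Clos (h \<phi>)"
  show "m \<le> n + (if t = e then 0 else 1)"
  proof (cases "S \<inter> Clos \<sigma> = {}")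
    case False
    then obtain u where u: "u \<in> S" "u \<in> Clos \<sigma>" by blast
    have "S \<subseteq> Clos \<sigma>"
      using sconn_Clos[OF loop_chain_sconn[OF S(1)] u(1)] Clos_trans[OF u(2)] by blast
    then show ?thesis using assms(2) S(1) unfolding depth_le_def by blast
  next
    case True
    define L where "L = {\<rho> \<in> Clos \<phi>. h \<rho> \<in> S}"
    have z: "Var z \<notin> L" using True unfolding L_def by auto
    have "S \<noteq> {}" using loop_chain_sconn S unfolding sconn_def by blast
    then have "L \<noteq> {}" using Clos_subst S(2) True unfolding L_def by blast
    moreover have "lifts h L S"
      unfolding lifts_def
    proof (intro conjI ballI subsetI)
      show "\<And>s. s \<in> h ` L \<Longrightarrow> s \<in> S" using L_def by blast
      fix \<rho> \<tau> assume \<rho>: "\<rho> \<in> L" "\<tau> \<in> succs (h \<rho>) \<inter> S"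
      have "\<rho> \<noteq> Var z" using \<rho> z by auto
      then obtain \<tau>' where "\<tau>' \<in> succs \<rho>" "\<tau> = h \<tau>'" using succs_lift \<rho> L_def by blast
      then show "\<tau> \<in> h ` (succs \<rho> \<inter> L)" using \<rho> Clos_step unfolding L_def by blast
    qed
    ultimately obtain S' where "S' \<subseteq> L" "loop_chain m t S'"
      using loop_chain_lift[OF S(1), of L] z L_def by blast
    then show ?thesis using assms(1) unfolding depth_le_def L_def by blast
  qed
qed

text \<open>A dominator is a fixpoint formula, hence lies in the closure of some successor, and
  strong connectivity draws the rest of the set along.\<close>

lemma depth_le_succs:
  assumes "\<And>a. a \<in> succs \<phi> \<Longrightarrow> depth_le e n a" "\<not> is_fix \<phi>"
  shows "depth_le e n \<phi>"
  unfolding depth_le_def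
proof (intro allI impI)
  fix m t S assume S: "loop_chain m t S" "S \<subseteq> Clos \<phi>"
  from S(1) have "\<exists>\<psi>. dominates \<psi> S" by cases auto
  then obtain \<psi> where "\<psi> \<in> S" "is_fix \<psi>" unfolding dominates_def by blast
  then obtain a where a: "a \<in> succs \<phi>" "\<psi> \<in> Clos a" using S(2) assms(2) Clos_cases[of \<psi> \<phi>] by blast
  have "S \<subseteq> Clos a"
    using sconn_Clos[OF loop_chain_sconn[OF S(1)] \<open>\<psi> \<in> S\<close>] Clos_trans[OF a(2)] by blast
  then show "m \<le> n + (if t = e then 0 else 1)" using assms(1)[OF a(1)] S unfolding depth_le_def by blast
qed

subsection \<open>Renaming of free variables\<close>

text \<open>The rules generating the alternation hierarchy pass through formulas that are not tidy.
  Their induction is therefore carried out for all tidy results of capture-free renamings.\<close>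

fun rename :: "(nat \<Rightarrow> nat) \<Rightarrow> 'p fm \<Rightarrow> 'p fm" where
  "rename r (Var x) = Var (r x)"
| "rename r (And a b) = And (rename r a) (rename r b)"
| "rename r (Or a b) = Or (rename r a) (rename r b)"
| "rename r (Dia a) = Dia (rename r a)"
| "rename r (Box a) = Box (rename r a)"
| "rename r (Fix e x c) = Fix e x (rename (r(x := x)) c)"
| "rename r a = a"

fun nocap :: "(nat \<Rightarrow> nat) \<Rightarrow> 'p fm \<Rightarrow> bool" where
  "nocap r (And a b) \<longleftrightarrow> nocap r a \<and> nocap r b"
| "nocap r (Or a b) \<longleftrightarrow> nocap r a \<and> nocap r b"
| "nocap r (Dia a) \<longleftrightarrow> nocap r a"
| "nocap r (Box a) \<longleftrightarrow> nocap r a"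
| "nocap r (Fix e x c) \<longleftrightarrow> x \<notin> r ` (FV c - {x}) \<and> nocap (r(x := x)) c"
| "nocap r _ \<longleftrightarrow> True"

lemma rename_cong: "\<forall>x\<in>FV \<phi>. r x = r' x \<Longrightarrow> rename r \<phi> = rename r' \<phi>"
proof (induction \<phi> arbitrary: r r')
  case (Fix e x c)
  have "rename (r(x := x)) c = rename (r'(x := x)) c" by (rule Fix.IH) (use Fix.prems in auto)
  then show ?case by simp
next
  case (And a b)
  then show ?case using And.IH[of r r'] by (metis FV.simps(2) UnI1 UnI2 rename.simps(2))
next
  case (Or a b)
  then show ?case using Or.IH[of r r'] by (metis FV.simps(3) UnI1 UnI2 rename.simps(3))
next
  case (Dia a)
  then show ?case using Dia.IH[of r r'] by (metis FV.simps(4) rename.simps(4))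
next
  case (Box a)
  then show ?case using Box.IH[of r r'] by (metis FV.simps(5) rename.simps(5))
qed simp_all

lemma nocap_cong: "\<forall>x\<in>FV \<phi>. r x = r' x \<Longrightarrow> nocap r \<phi> \<Longrightarrow> nocap r' \<phi>"
proof (induction \<phi> arbitrary: r r')
  case (Fix e x c)
  have "\<forall>y\<in>FV c. (r(x := x)) y = (r'(x := x)) y" using Fix.prems(1) by auto
  moreover have "nocap (r(x := x)) c" using Fix.prems(2) by simp
  ultimately have "nocap (r'(x := x)) c" by (rule Fix.IH)
  moreover have "r ` (FV c - {x}) = r' ` (FV c - {x})" by (rule image_cong) (use Fix.prems in auto)
  ultimately show ?case using Fix.prems(2) by simp
next
  case (And a b)
  then show ?case using And.IH[of r r'] by (metis FV.simps(2) UnI1 UnI2 nocap.simps(1))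
next
  case (Or a b)
  then show ?case using Or.IH[of r r'] by (metis FV.simps(3) UnI1 UnI2 nocap.simps(2))
next
  case (Dia a)
  then show ?case using Dia.IH[of r r'] by (metis FV.simps(4) nocap.simps(3))
next
  case (Box a)
  then show ?case using Box.IH[of r r'] by (metis FV.simps(5) nocap.simps(4))
qed simp_all

lemma rename_id: "rename id \<phi> = \<phi>"
  by (induction \<phi>) (auto simp: fun_upd_idem)

lemma nocap_id: "nocap id \<phi>"
  by (induction \<phi>) (auto simp: fun_upd_idem)

lemma BV_rename [simp]: "BV (rename r \<phi>) = BV \<phi>"
  by (induction \<phi> arbitrary: r) auto

lemma FV_rename_subset: "FV (rename r \<phi>) \<subseteq> r ` FV \<phi>"
proof (induction \<phi> arbitrary: r)
  case (Fix e x c)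
  have "FV (rename (r(x := x)) c) \<subseteq> (r(x := x)) ` FV c" by (rule Fix.IH)
  also have "\<dots> \<subseteq> insert x (r ` (FV c - {x}))" by auto
  finally show ?case by auto
qed fastforce+

lemma FV_rename: "nocap r \<phi> \<Longrightarrow> FV (rename r \<phi>) = r ` FV \<phi>"
proof (induction \<phi> arbitrary: r)
  case (Fix e x c)
  have "nocap (r(x := x)) c" using Fix.prems by simp
  then have "FV (rename (r(x := x)) c) = (r(x := x)) ` FV c" by (rule Fix.IH)
  also have "\<dots> - {x} = r ` (FV c - {x})" using Fix.prems by (auto simp: image_iff)
  finally show ?case by simp
qed auto

text \<open>The fresh variable of an unfolding is absorbed into the renaming, so the induction
  hypothesis for the body applies to the unfolded body.\<close>

lemma subst_rename_Var:
  assumes "r x = x" "\<forall>y \<in> FV c - {x}. r y \<noteq> x"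
  shows "subst (rename r c) (Var z) x = rename (r(x := z)) c"
  using assms
proof (induction c arbitrary: r)
  case (Fix e y d)
  show ?case
  proof (cases "y = x")
    case False
    then have "subst (rename (r(y := y)) d) (Var z) x = rename (r(y := y, x := z)) d"
      using Fix.prems by (intro Fix.IH) auto
    moreover have "r(y := y, x := z) = r(x := z, y := y)" using False by (rule fun_upd_twist)
    ultimately show ?thesis using False by (simp del: fun_upd_apply)
  qed (simp del: fun_upd_apply)
qed auto

lemma nocap_upd: "nocap (r(x := w)) c \<Longrightarrow> z \<notin> BV c \<Longrightarrow> nocap (r(x := z)) c"
proof (induction c arbitrary: r)
  case (Fix e y d)
  have "nocap (r(x := z, y := y)) d"
  proof (cases "y = x")
    case False
    then have tw: "r(y := y, x := u) = r(x := u, y := y)" for u by (rule fun_upd_twist)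
    have "nocap (r(y := y, x := w)) d" using Fix.prems(1) unfolding tw nocap.simps by blast
    then have "nocap (r(y := y, x := z)) d" by (rule Fix.IH) (use Fix.prems in simp)
    then show ?thesis unfolding tw .
  qed (use Fix.prems in \<open>simp del: fun_upd_apply\<close>)
  moreover have "y \<notin> r(x := z) ` (FV d - {y})"
    using Fix.prems unfolding nocap.simps by (auto split: if_splits)
  ultimately show ?case unfolding nocap.simps by blast
qed auto

text \<open>The substituted variable receives a fresh name \<open>z\<close> of its own, since
  \<open>x\<close> may also be bound in \<open>c\<close> or free in \<open>s\<close>; the renamed
  \<open>c\<close> can then be tidy.\<close>

lemma rename_subst:
  assumes "free_for s x c" "z \<notin> BV c" "z \<notin> r ` FV c"
  shows "rename r (subst c s x) = subst (rename (r(x := z)) c) (rename r s) z"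
  using assms
proof (induction c arbitrary: r)
  case (Fix e y d)
  show ?case
  proof (cases "x \<in> FV (Fix e y d)")
    case True
    then have y: "y \<noteq> x" "y \<notin> FV s" "free_for s x d" using Fix.prems by auto
    have "rename (r(y := y)) (subst d s x) = subst (rename (r(y := y, x := z)) d) (rename (r(y := y)) s) z"
      using Fix.prems y by (intro Fix.IH) auto
    moreover have "rename (r(y := y)) s = rename r s" using y by (intro rename_cong) auto
    moreover have "r(y := y, x := z) = r(x := z, y := y)" using y(1) by (rule fun_upd_twist)
    ultimately show ?thesis using y Fix.prems by (simp del: fun_upd_apply)
  next
    case False
    have "z \<notin> FV (rename r (Fix e y d))" using FV_rename_subset Fix.prems by blast
    moreover have "rename (r(x := z)) (Fix e y d) = rename r (Fix e y d)"
      using False by (intro rename_cong) auto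
    ultimately show ?thesis using False by (metis subst_not_free)
  qed
qed auto

lemma nocap_subst: "nocap r (subst c s x) \<Longrightarrow> z \<notin> BV c \<Longrightarrow> nocap (r(x := z)) c"
proof (induction c arbitrary: r)
  case (Fix e y d)
  show ?case
  proof (cases "y = x")
    case True
    then have "nocap (r(x := r x)) (Fix e y d)"
      using Fix.prems(1) unfolding fun_upd_triv subst.simps by metis
    then show ?thesis using Fix.prems(2) by (rule nocap_upd)
  next
    case False
    then have "nocap (r(y := y)) (subst d s x)" using Fix.prems by simp
    then have "nocap (r(y := y, x := z)) d" by (rule Fix.IH) (use Fix.prems in simp)
    moreover have "y \<notin> (r(x := z)) ` (FV d - {y})"
      using False Fix.prems FV_subst_superset[of d x s] by (auto split: if_splits)
    moreover have "r(y := y, x := z) = r(x := z, y := y)" using False by (rule fun_upd_twist)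
    ultimately show ?thesis by (simp del: fun_upd_apply)
  qed
qed auto

lemma nocap_subst_arg: "nocap r (subst c s x) \<Longrightarrow> free_for s x c \<Longrightarrow> x \<in> FV c \<Longrightarrow> nocap r s"
proof (induction c arbitrary: r)
  case (Fix e y d)
  then have y: "y \<noteq> x" "y \<notin> FV s" "x \<in> FV d" "free_for s x d" by auto
  then have "nocap (r(y := y)) (subst d s x)" using Fix.prems(1) by simp
  then have "nocap (r(y := y)) s" using Fix.IH y by blast
  then show ?case using y nocap_cong[of s "r(y := y)" r] by auto
qed auto

lemma depth_le_Suc:
  assumes "depth_le e' n \<phi>"
  shows "depth_le e (Suc n) \<phi>"
  unfolding depth_le_def
proof (intro allI impI)
  fix m t S assume "loop_chain m t S" "S \<subseteq> Clos \<phi>"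
  then have "m \<le> n + (if t = e' then 0 else 1)" using assms unfolding depth_le_def by blast
  also have "\<dots> \<le> Suc n + (if t = e then 0 else 1)" by simp
  finally show "m \<le> Suc n + (if t = e then 0 else 1)" .
qed

lemma depth_le_AH:
  assumes "AH e n \<phi>" "nocap r \<phi>" "tidy (rename r \<phi>)"
  shows "depth_le e n (rename r \<phi>)"
  using assms
proof (induction arbitrary: r rule: AH.induct)
  case (AH_atom \<phi> e)
  then have "succs (rename r \<phi>) = {}" "\<not> is_fix (rename r \<phi>)" by (cases \<phi>; simp)+
  then show ?case by (intro depth_le_succs[of "rename r \<phi>"]) blast+
next
  case (AH_fix e n c x)
  define d where "d = rename (r(x := x)) c"
  have \<psi>: "rename r (Fix (dual e) x c) = Fix (dual e) x d" by (simp add: d_def)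
  obtain z where z: "fresh_unfolding (dual e) x d z (Fix (dual e) x d) (subst d (Var z) x)"
    using fresh_unfolding_exists AH_fix \<psi> by metis
  interpret fresh_unfolding "dual e" x d z "Fix (dual e) x d" "subst d (Var z) x" by (rule z)
  have c': "subst d (Var z) x = rename (r(x := z)) c"
    unfolding d_def using AH_fix.prems(1) by (subst subst_rename_Var) auto
  have "nocap (r(x := z)) c" using nocap_upd[of r x x c z] AH_fix.prems(1) z_not_c(2) by (simp add: d_def)
  then have "depth_le e n (subst d (Var z) x)" using AH_fix.IH c' tidy_c' by metis
  then show ?case using depth_le_fix \<psi> by metis
next
  case (AH_subst e n c s x)
  show ?case
  \<comment> \<open>A vacuous substitution discards \<open>s\<close>, and then nothing forces the
    renamed \<open>s\<close> to be tidy; the case is settled by the hypothesis for \<open>c\<close>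
    alone.\<close>
  proof (cases "x \<in> FV c")
    case False
    then show ?thesis using AH_subst by (simp add: subst_not_free)
  next
    case True
    have "finite (BV c \<union> r ` FV c)" by (simp add: finite_BV finite_FV)
    then obtain z where z: "z \<notin> BV c" "z \<notin> r ` FV c"
      using ex_new_if_finite[OF infinite_UNIV_nat] by blast
    define c' where "c' = rename (r(x := z)) c"
    define s' where "s' = rename r s"
    have eq: "rename r (subst c s x) = subst c' s' z"
      unfolding c'_def s'_def using rename_subst AH_subst z by blast
    have nc: "nocap (r(x := z)) c" using AH_subst.prems z nocap_subst by blast
    have ns: "nocap r s" using AH_subst.prems AH_subst.hyps True nocap_subst_arg by blast
    \<comment> \<open>Apart from \<open>z\<close>, the free and bound variables of \<open>c'\<close>
      and \<open>s'\<close> are free and bound, respectively, in the result. Its tidiness therefore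
      yields the side conditions of \<open>subst_context\<close>.\<close>
    have FV: "FV (subst c' s' z) = r ` FV (subst c s x)" using FV_rename AH_subst.prems eq by metis
    have "FV s \<subseteq> FV (subst c s x)" using fs_FV fs_if_subst True AH_subst by blast
    then have FVs: "FV s' \<subseteq> FV (subst c' s' z)" unfolding FV using FV_rename[OF ns] s'_def by blast
    have FVc: "FV c' \<subseteq> insert z (FV (subst c' s' z))"
      unfolding FV using FV_rename[OF nc] FV_subst_superset[of c x s] c'_def by auto
    have BVc: "BV c' \<subseteq> BV (subst c' s' z)" by (rule BV_subst_superset)
    have zc: "z \<in> FV c'" using FV_rename[OF nc] True c'_def by auto
    have BVs: "BV s' \<subseteq> BV (subst c' s' z)" by (rule BV_subst_arg[OF zc])
    have t: "FV (subst c' s' z) \<inter> BV (subst c' s' z) = {}" using AH_subst.prems eq tidy_def by metis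
    have zB: "z \<notin> BV c'" using z c'_def by simp
    have "tidy c'" "tidy s'" "BV c' \<inter> FV s' = {}" using FVs FVc BVc BVs t zB unfolding tidy_def by blast+
    then interpret subst_context c' s' z using zB by unfold_locales
    have "depth_le e n c'" "depth_le e n s'"
      using AH_subst.IH nc ns \<open>tidy c'\<close> \<open>tidy s'\<close> c'_def s'_def by auto
    then show ?thesis using depth_le_subst eq by metis
  qed
next
  case (AH_up n \<phi> e)
  then have "depth_le Mu n (rename r \<phi>) \<or> depth_le Nu n (rename r \<phi>)" by blast
  then show ?case using depth_le_Suc by blast
qed (rule depth_le_succs; auto simp: tidy_def)+

lemma AH_add: "AH e n \<phi> \<Longrightarrow> AH e (n + k) \<phi>"
proof (induction k)
  case (Suc k)
  then have "AH e (n + k) \<phi>" by simp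
  then have "AH Mu (n + k) \<phi> \<or> AH Nu (n + k) \<phi>" using fp.exhaust by metis
  then show ?case unfolding add_Suc_right by (rule AH_up)
qed simp

text \<open>\<open>ad\<close> is a \<open>LEAST\<close>, so it has its defining property only once
  some level is known to contain the formula. One more fixpoint costs at most one level.\<close>

lemma AH_exists: "\<exists>n. \<forall>e. AH e n \<phi>"
proof (induction \<phi>)
  case (And a b)
  then obtain n k where "\<forall>e. AH e n a" "\<forall>e. AH e k b" by blast
  then show ?case using AH_add by (metis AH_and add.commute)
next
  case (Or a b)
  then obtain n k where "\<forall>e. AH e n a" "\<forall>e. AH e k b" by blast
  then show ?case using AH_add by (metis AH_or add.commute)
next
  case (Dia a)
  then show ?case using AH_dia by blast
next
  case (Box a)
  then show ?case using AH_box by blast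
next
  case (Fix e x c)
  then obtain n where "\<forall>e. AH e n c" by blast
  then have "AH (dual e) n (Fix e x c)" using AH_fix[of "dual e" n c x] by (cases e) auto
  then have "AH e' (Suc n) (Fix e x c)" for e' by (cases e) (auto intro: AH_up)
  then show ?case by blast
qed (rule exI[of _ 0], simp add: AH_atom)+

lemma depth_le_ad:
  assumes "tidy \<phi>"
  shows "depth_le e (ad \<phi>) \<phi>"
proof -
  have "AH Mu (ad \<phi>) \<phi> \<and> AH Nu (ad \<phi>) \<phi>"
    unfolding ad_def by (rule LeastI_ex) (use AH_exists in blast)
  then show ?thesis
    using depth_le_AH[of e "ad \<phi>" \<phi> id] assms by (cases e) (simp_all add: rename_id nocap_id)
qed

text \<open>Both classes contain the formula at level \<open>ad\<close>, so \<open>e\<close> can be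
  chosen as the type \<open>t\<close> of the top set, where there is no slack.\<close>

lemma loop_chain_le_ad:
  assumes "tidy \<phi>" "loop_chain m t S" "S \<subseteq> Clos \<phi>"
  shows "m \<le> ad \<phi>"
  using depth_le_ad[OF assms(1), of t] assms unfolding depth_le_def by fastforce

subsection \<open>The closure order and the index\<close>

text \<open>Kept generic because it is taken both of \<open>trace_rel\<close>, for clusters, and of
  \<open>trace_rel_within\<close>, for the sets of a loop chain.\<close>

definition rel_cluster :: "('a \<times> 'a) set \<Rightarrow> 'a \<Rightarrow> 'a set" where
  "rel_cluster r v = {u. (v, u) \<in> r\<^sup>* \<and> (u, v) \<in> r\<^sup>*}"

lemma rel_cluster_path:
  assumes "a \<in> rel_cluster r v" "b \<in> rel_cluster r v"
  shows "(a, b) \<in> (r \<inter> rel_cluster r v \<times> rel_cluster r v)\<^sup>*"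
proof -
  have "(a, b) \<in> r\<^sup>*" using assms unfolding rel_cluster_def by auto
  then show ?thesis using assms(1)
  proof (induction rule: converse_rtrancl_induct)
    case (step y y')
    have "(v, y') \<in> r\<^sup>*" using step by (auto simp: rel_cluster_def intro: rtrancl_into_rtrancl)
    moreover have "(y', v) \<in> r\<^sup>*" using step assms by (auto simp: rel_cluster_def)
    ultimately have "y' \<in> rel_cluster r v" by (simp add: rel_cluster_def)
    then show ?case using step by (auto intro: converse_rtrancl_into_rtrancl)
  qed simp
qed

lemma clos_cluster_eq: "clos_cluster = rel_cluster trace_rel"
  by (auto simp: clos_cluster_def rel_cluster_def)

lemma clos_cluster_refl [simp]: "v \<in> clos_cluster v"
  by (simp add: clos_cluster_def)

lemma clos_cluster_same: "u \<in> clos_cluster v \<Longrightarrow> clos_cluster u = clos_cluster v"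
  unfolding clos_cluster_def by auto

lemma clos_cluster_Clos: "clos_cluster v \<subseteq> Clos v"
  by (auto simp: clos_cluster_def Clos_def)

lemma sconn_clos_cluster: "tidy v \<Longrightarrow> sconn (clos_cluster v)"
  unfolding sconn_def
  using finite_subset[OF clos_cluster_Clos finite_Clos] rel_cluster_path[of _ trace_rel v]
    clos_cluster_refl[of v]
  by (auto simp: clos_cluster_eq)

lemma clos_le_iff: "clos_le \<phi> \<psi> \<longleftrightarrow> is_fix \<phi> \<and> is_fix \<psi> \<and> (\<psi>, \<phi>) \<in> (trace_rel_within \<psi>)\<^sup>*"
  by (simp add: clos_le_def free_sub_iff_fs)

lemma within_fs: "(a, b) \<in> (trace_rel_within \<psi>)\<^sup>* \<Longrightarrow> fs \<psi> a \<Longrightarrow> fs \<psi> b"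
  by (induction rule: rtrancl_induct) (auto simp: within_iff)

lemma within_mono:
  assumes "fs \<psi> \<phi>" "(a, b) \<in> (trace_rel_within \<phi>)\<^sup>*"
  shows "(a, b) \<in> (trace_rel_within \<psi>)\<^sup>*"
  by (rule subsetD[OF rtrancl_mono assms(2)])
    (use assms(1) fs_trans in \<open>auto simp: within_iff\<close>)

lemma clos_le_fs: "clos_le \<phi> \<psi> \<Longrightarrow> fs \<psi> \<phi>"
  unfolding clos_le_iff using within_fs fs_refl by blast

text \<open>Mutually comparable formulas are free subformulas of each other, hence equal.\<close>

lemma clos_less_iff: "clos_less \<phi> \<psi> \<longleftrightarrow> clos_le \<phi> \<psi> \<and> \<phi> \<noteq> \<psi>"
  unfolding clos_less_def using clos_le_fs fs_antisym by blast

lemma clos_le_trans: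
  assumes "clos_le \<phi> \<psi>" "clos_le \<psi> \<chi>"
  shows "clos_le \<phi> \<chi>"
proof -
  have "(\<psi>, \<phi>) \<in> (trace_rel_within \<chi>)\<^sup>*"
    using within_mono[OF clos_le_fs[OF assms(2)]] assms(1) unfolding clos_le_iff by blast
  then show ?thesis using assms unfolding clos_le_iff by auto
qed

text \<open>The order itself gives a trace from \<open>\<psi>\<close> to \<open>\<phi>\<close>; the
  way back is the descent from \<open>\<phi>\<close> to its free subformula
  \<open>\<psi>\<close>.\<close>

lemma clos_le_cluster:
  assumes "clos_le \<phi> \<psi>" "tidy \<phi>"
  shows "\<psi> \<in> clos_cluster \<phi>"
  using assms fs_trace_within[OF clos_le_fs[OF assms(1)] assms(2)] within_subset
  unfolding clos_le_iff clos_cluster_def by blast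

lemma dominates_clos_le:
  assumes "dominates \<psi> S" "sconn S" "\<phi> \<in> S" "is_fix \<phi>"
  shows "clos_le \<phi> \<psi>"
proof -
  have "(\<psi>, \<phi>) \<in> (trace_rel \<inter> S \<times> S)\<^sup>*" using assms unfolding sconn_def dominates_def by blast
  moreover have "trace_rel \<inter> S \<times> S \<subseteq> trace_rel_within \<psi>"
    using assms(1) by (auto simp: dominates_def within_iff)
  ultimately have "(\<psi>, \<phi>) \<in> (trace_rel_within \<psi>)\<^sup>*" using rtrancl_mono by blast
  then show ?thesis using assms by (simp add: clos_le_iff dominates_def)
qed

lemma clos_cluster_dominator:
  assumes "tidy v" "is_fix v"
  shows "\<exists>\<psi>. dominates \<psi> (clos_cluster v)"
proof (cases "\<exists>a\<in>clos_cluster v. \<exists>b\<in>clos_cluster v. b \<in> succs a")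
  case True
  then obtain a b where "a \<in> clos_cluster v" "b \<in> clos_cluster v" "b \<in> succs a" by blast
  then show ?thesis
    by (rule dominator_exists[OF assms(1) clos_cluster_Clos sconn_clos_cluster[OF assms(1)]])
next
  case False
  have "u = v" if u: "u \<in> clos_cluster v" for u
  proof -
    have "(v, u) \<in> (trace_rel \<inter> clos_cluster v \<times> clos_cluster v)\<^sup>*"
      using sconn_clos_cluster[OF assms(1)] u clos_cluster_refl[of v] unfolding sconn_def by blast
    then show ?thesis by (cases rule: converse_rtranclE) (use False in auto)
  qed
  then have "clos_cluster v = {v}" using clos_cluster_refl[of v] by blast
  then have "dominates v (clos_cluster v)" using assms(2) by (simp add: dominates_def)
  then show ?thesis by blast
qed

section \<open>Alternating chains, heights and priorities\<close>

definition alt_step :: "'p fm \<Rightarrow> 'p fm \<Rightarrow> bool" where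
  "alt_step a b \<longleftrightarrow> clos_less a b \<and> fix_type b = dual (fix_type a)"

lemma alt_chain_iff:
  "alt_chain cs \<longleftrightarrow> cs \<noteq> [] \<and> (\<forall>\<phi>\<in>set cs. tidy \<phi> \<and> is_fix \<phi>) \<and> successively alt_step cs"
  unfolding alt_chain_def alt_step_def successively_conv_nth by blast

lemma alt_chain_single: "alt_chain [\<phi>] \<longleftrightarrow> tidy \<phi> \<and> is_fix \<phi>"
  by (simp add: alt_chain_iff)

lemma alt_chain_Cons:
  "cs \<noteq> [] \<Longrightarrow> alt_chain (\<phi> # cs) \<longleftrightarrow> tidy \<phi> \<and> is_fix \<phi> \<and> alt_step \<phi> (hd cs) \<and> alt_chain cs"
  by (auto simp: alt_chain_iff successively_Cons)

lemma alt_chain_snoc: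
  "cs \<noteq> [] \<Longrightarrow> alt_chain (cs @ [\<phi>]) \<longleftrightarrow> tidy \<phi> \<and> is_fix \<phi> \<and> alt_step (last cs) \<phi> \<and> alt_chain cs"
  by (auto simp: alt_chain_iff successively_append_iff)

text \<open>Each step of a chain passes to a proper free subformula, so sizes fall. This bound makes
  the sets under \<open>Max\<close> in \<open>h_up\<close> and \<open>cd\<close> finite.\<close>

lemma alt_chain_length: "alt_chain cs \<Longrightarrow> length cs \<le> Suc (size (hd cs))"
proof (induction cs)
  case (Cons a cs)
  show ?case
  proof (cases "cs = []")
    case False
    then have "clos_less a (hd cs)" "alt_chain cs"
      using Cons.prems alt_chain_Cons[of cs a] by (auto simp: alt_step_def)
    moreover from this have "size (hd cs) < size a"
      using clos_le_fs fs_size unfolding clos_less_iff by metis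
    ultimately show ?thesis using Cons.IH by simp
  qed simp
qed (simp add: alt_chain_def)

lemma alt_chain_cluster: "alt_chain cs \<Longrightarrow> set cs \<subseteq> clos_cluster (hd cs)"
proof (induction cs)
  case (Cons a cs)
  show ?case
  proof (cases "cs = []")
    case False
    then have "clos_less a (hd cs)" "alt_chain cs" "tidy a"
      using Cons.prems alt_chain_Cons[of cs a] by (auto simp: alt_step_def)
    moreover from this have "hd cs \<in> clos_cluster a" using clos_le_cluster clos_less_iff by blast
    ultimately show ?thesis using Cons.IH clos_cluster_same[of "hd cs" a] by simp
  qed simp
qed (simp add: alt_chain_def)

lemma alt_chain_last_type:
  "alt_chain cs \<Longrightarrow> fp_odd (fix_type (last cs)) = (fp_odd (fix_type (hd cs)) = odd (length cs))"
proof (induction cs)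
  case (Cons a cs)
  show ?case
  proof (cases "cs = []")
    case False
    then have "fix_type (hd cs) = dual (fix_type a)" "alt_chain cs"
      using Cons.prems alt_chain_Cons[of cs a] by (auto simp: alt_step_def)
    moreover from this have "fp_odd (fix_type (hd cs)) \<longleftrightarrow> \<not> fp_odd (fix_type a)"
      by (cases "fix_type a") auto
    ultimately show ?thesis using Cons.IH False by auto
  qed simp
qed (simp add: alt_chain_def)

lemma finite_h_up: "finite {length cs | cs. alt_chain cs \<and> hd cs = \<xi>}"
  by (rule finite_subset[of _ "{..Suc (size \<xi>)}"]) (auto dest: alt_chain_length)

lemma h_up_ge: "alt_chain cs \<Longrightarrow> length cs \<le> h_up (hd cs)"
  unfolding h_up_def by (rule Max_ge[OF finite_h_up]) blast

lemma h_up_attained: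
  assumes "tidy \<xi>" "is_fix \<xi>"
  obtains cs where "alt_chain cs" "hd cs = \<xi>" "length cs = h_up \<xi>"
proof -
  have "alt_chain [\<xi>] \<and> hd [\<xi>] = \<xi>" using assms by (simp add: alt_chain_single)
  then have "{length cs | cs. alt_chain cs \<and> hd cs = \<xi>} \<noteq> {}" by blast
  from Max_in[OF finite_h_up this] show ?thesis using that unfolding h_up_def by auto
qed

lemma h_up_pos: "tidy \<xi> \<Longrightarrow> is_fix \<xi> \<Longrightarrow> 1 \<le> h_up \<xi>"
  using h_up_ge[of "[\<xi>]"] by (simp add: alt_chain_single)

lemma finite_cd:
  assumes "finite C"
  shows "finite (insert 0 {length cs | cs. alt_chain cs \<and> set cs \<subseteq> C})"
proof -
  have "length cs \<le> Suc (Max (size ` C))" if cs: "alt_chain cs" "set cs \<subseteq> C" for cs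
  proof -
    have "hd cs \<in> C" using cs by (auto simp: alt_chain_def)
    then have "size (hd cs) \<le> Max (size ` C)" using assms by simp
    then show ?thesis using alt_chain_length[OF cs(1)] by simp
  qed
  then have "{length cs | cs. alt_chain cs \<and> set cs \<subseteq> C} \<subseteq> {..Suc (Max (size ` C))}" by auto
  then show ?thesis using finite_subset by auto
qed

lemma cd_ge: "finite C \<Longrightarrow> alt_chain cs \<Longrightarrow> set cs \<subseteq> C \<Longrightarrow> length cs \<le> cd C"
  unfolding cd_def by (rule Max_ge[OF finite_cd]) auto

lemma cd_attained:
  assumes "finite C" "cd C \<noteq> 0"
  obtains cs where "alt_chain cs" "set cs \<subseteq> C" "length cs = cd C"
  using Max_in[OF finite_cd[OF assms(1)]] assms(2) that unfolding cd_def by auto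

lemma finite_clos_cluster: "tidy v \<Longrightarrow> finite (clos_cluster v)"
  using finite_subset[OF clos_cluster_Clos finite_Clos] .

lemma h_up_le_cd:
  assumes "tidy \<xi>" "is_fix \<xi>"
  shows "h_up \<xi> \<le> cd (clos_cluster \<xi>)"
proof -
  obtain cs where "alt_chain cs" "hd cs = \<xi>" "length cs = h_up \<xi>" using h_up_attained assms by blast
  then show ?thesis using cd_ge[OF finite_clos_cluster[OF assms(1)]] alt_chain_cluster by metis
qed

text \<open>Take a longest chain from \<open>\<psi>\<close>. For equal types its head is replaced by
  \<open>\<phi>\<close>; for different types \<open>\<phi>\<close> is put in front.\<close>

lemma h_up_clos_less:
  assumes "clos_less \<phi> \<psi>" "tidy \<phi>"
  shows "fix_type \<psi> = fix_type \<phi> \<Longrightarrow> h_up \<psi> \<le> h_up \<phi>"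
    and "fix_type \<psi> \<noteq> fix_type \<phi> \<Longrightarrow> h_up \<psi> < h_up \<phi>"
proof -
  have le: "clos_le \<phi> \<psi>" "is_fix \<phi>" "is_fix \<psi>" using assms by (auto simp: clos_less_iff clos_le_iff)
  have "tidy \<psi>" using clos_le_cluster[OF le(1) assms(2)] clos_cluster_Clos Clos_tidy[OF assms(2)] by blast
  then obtain cs where cs: "alt_chain cs" "hd cs = \<psi>" "length cs = h_up \<psi>"
    using h_up_attained le by blast
  then have ne: "cs \<noteq> []" by (auto simp: alt_chain_def)
  {
    assume ty: "fix_type \<psi> = fix_type \<phi>"
    have "alt_chain (\<phi> # tl cs)"
    proof (cases "tl cs = []")
      case True
      then show ?thesis using assms le by (simp add: alt_chain_single)
    next
      case False
      have s: "alt_step \<psi> (hd (tl cs))" "alt_chain (tl cs)"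
        using alt_chain_Cons[OF False, of \<psi>] cs ne by (auto simp: list.collapse)
      have "clos_le \<phi> (hd (tl cs))" "fs (hd (tl cs)) \<psi>" "hd (tl cs) \<noteq> \<psi>"
        using s le(1) clos_le_trans clos_le_fs unfolding alt_step_def clos_less_iff by blast+
      moreover have "hd (tl cs) \<noteq> \<phi>"
        using calculation(2,3) clos_le_fs[OF le(1)] fs_antisym by blast
      ultimately have "alt_step \<phi> (hd (tl cs))"
        using s ty unfolding alt_step_def clos_less_iff by auto
      then show ?thesis using s False assms le by (simp add: alt_chain_Cons)
    qed
    from h_up_ge[OF this] show "h_up \<psi> \<le> h_up \<phi>" using cs ne by (cases cs) auto
  }
  {
    assume "fix_type \<psi> \<noteq> fix_type \<phi>"
    then have "fix_type \<psi> = dual (fix_type \<phi>)" by (cases "fix_type \<psi>"; cases "fix_type \<phi>") auto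
    then have "alt_chain (\<phi> # cs)" using cs ne assms le by (simp add: alt_chain_Cons alt_step_def)
    from h_up_ge[OF this] show "h_up \<psi> < h_up \<phi>" using cs by simp
  }
qed

text \<open>Truncated subtraction in \<open>Omega_g\<close> is turned into an equation, which is
  sound because \<open>h_up\<close> does not exceed \<open>cd\<close> of the cluster.\<close>

lemma Omega_g_cases:
  assumes "tidy \<psi>" "is_fix \<psi>"
  obtains n d where "Omega_g \<psi> = Some n" "cd (clos_cluster \<psi>) = d + h_up \<psi>"
    "odd n = fp_odd (fix_type \<psi>)" "n = d \<or> n = Suc d"
  using assms h_up_le_cd[OF assms] that[of _ "cd (clos_cluster \<psi>) - h_up \<psi>"]
  by (auto simp: Omega_g_def Let_def split: if_splits)

text \<open>For equal types both values are rounded to the same parity, which preserves the order.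
  For different types the unrounded values differ by at least one, and this absorbs the
  rounding.\<close>

lemma Omega_g_mono:
  assumes "clos_le \<phi> \<psi>" "tidy \<phi>" "Omega_g \<phi> = Some m" "Omega_g \<psi> = Some n"
  shows "m \<le> n"
proof (cases "\<phi> = \<psi>")
  case False
  then have less: "clos_less \<phi> \<psi>" using assms by (simp add: clos_less_iff)
  have fx: "is_fix \<phi>" "is_fix \<psi>" using assms by (auto simp: clos_le_iff)
  have c: "\<psi> \<in> clos_cluster \<phi>" using clos_le_cluster assms by blast
  then have "tidy \<psi>" using clos_cluster_Clos Clos_tidy[OF assms(2)] by blast
  obtain d where d: "cd (clos_cluster \<phi>) = d + h_up \<phi>" "odd m = fp_odd (fix_type \<phi>)" "m = d \<or> m = Suc d"
    using Omega_g_cases[OF assms(2) fx(1)] assms(3) by auto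
  obtain k where k: "cd (clos_cluster \<phi>) = k + h_up \<psi>" "odd n = fp_odd (fix_type \<psi>)" "n = k \<or> n = Suc k"
    using Omega_g_cases[OF \<open>tidy \<psi>\<close> fx(2)] assms(4) clos_cluster_same[OF c] by auto
  show ?thesis
  proof (cases "fix_type \<psi> = fix_type \<phi>")
    case True
    then have "d \<le> k" "odd m = odd n" using h_up_clos_less(1)[OF less assms(2)] d k by auto
    then show ?thesis using d(3) k(3) by presburger
  next
    case False
    then have "d < k" using h_up_clos_less(2)[OF less assms(2)] d k by auto
    then show ?thesis using d(3) k(3) by presburger
  qed
qed (use assms in auto)

text \<open>Priorities in a cluster lie between \<open>0\<close> and \<open>cd\<close>, so only a chain using all of these values
  could be too long. Its first member would start, and its last member would have, a type
  determined by the parity of \<open>cd\<close>; comparing both with the dominator of the cluster shows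
  that these types disagree.\<close>

lemma priority_chain_le_cd:
  fixes v :: "'p fm"
  assumes v: "tidy v"
    and vs: "set vs \<subseteq> clos_cluster v" "\<forall>u\<in>set vs. Omega_g u \<noteq> None"
    and inc: "\<forall>i. Suc i < length vs \<longrightarrow> the (Omega_g (vs ! i)) < the (Omega_g (vs ! Suc i))"
  shows "length vs \<le> cd (clos_cluster v)"
proof (cases "vs = []")
  case False
  define C where "C = clos_cluster v"
  have finC: "finite C" using finite_clos_cluster v C_def by blast
  have prio: "tidy u \<and> is_fix u \<and> clos_cluster u = C" if "u \<in> set vs" for u
    using that vs clos_cluster_same[of u v] unfolding C_def by (auto simp: Omega_g_def split: if_splits)
  define a where "a = hd vs"
  define b where "b = last vs"
  have ab: "a \<in> set vs" "b \<in> set vs" using False by (auto simp: a_def b_def)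
  obtain m d where m: "Omega_g a = Some m" "cd C = d + h_up a" "odd m = fp_odd (fix_type a)" "m = d \<or> m = Suc d"
    using Omega_g_cases[of a] prio[OF ab(1)] by auto
  obtain n k where n: "Omega_g b = Some n" "cd C = k + h_up b" "odd n = fp_odd (fix_type b)" "n = k \<or> n = Suc k"
    using Omega_g_cases[of b] prio[OF ab(2)] by auto
  have "m + i \<le> the (Omega_g (vs ! i))" if "i < length vs" for i
    using that
  proof (induction i)
    case 0
    then show ?case using m False by (simp add: a_def hd_conv_nth)
  next
    case (Suc i)
    then show ?case using inc[rule_format, of i] by simp
  qed
  from this[of "length vs - 1"] have mn: "m + (length vs - 1) \<le> n"
    using False n by (simp add: b_def last_conv_nth)
  have hb: "1 \<le> h_up b" using h_up_pos prio[OF ab(2)] by blast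
  show ?thesis
  proof (rule ccontr)
    assume "\<not> ?thesis"
    then have "cd C < length vs" by (simp add: C_def)
    moreover have "n \<le> cd C" using n hb by auto
    \<comment> \<open>More than \<open>cd C\<close> increasing values in this range force the
      extremes \<open>m = 0\<close> and \<open>n = cd C\<close>. The latter is possible only by
      rounding up with \<open>h_up b = 1\<close>, the former only with \<open>d = 0\<close>.\<close>
    ultimately have eq: "m = 0" "n = cd C" "h_up b = 1" "h_up a = cd C" using mn n hb m by auto
    obtain cs where cs: "alt_chain cs" "hd cs = a" "length cs = cd C"
      using h_up_attained[of a] prio[OF ab(1)] eq by auto
    have ne: "cs \<noteq> []" using cs(1) by (simp add: alt_chain_def)
    have csC: "set cs \<subseteq> C" using alt_chain_cluster[OF cs(1)] cs(2) prio[OF ab(1)] by simp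
    have aC: "a \<in> C" "b \<in> C" using ab vs C_def by auto
    obtain \<psi> where \<psi>: "dominates \<psi> C"
      using clos_cluster_dominator[of a] prio[OF ab(1)] by auto
    have \<psi>C: "\<psi> \<in> C" "is_fix \<psi>" using \<psi> by (auto simp: dominates_def)
    have sC: "sconn C" using sconn_clos_cluster v C_def by blast
    have tC: "tidy u" if "u \<in> C" for u
      using that Clos_tidy[OF v] clos_cluster_Clos unfolding C_def by blast
    have less: "clos_less u \<psi>" if "u \<in> C" "is_fix u" "u \<noteq> \<psi>" for u
      using dominates_clos_le[OF \<psi> sC] that clos_less_iff by blast
    \<comment> \<open>The dominator is above every fixpoint formula of the cluster, while
      \<open>h_up b = 1\<close> leaves no room above \<open>b\<close> for one of the other
      type.\<close>
    have "fix_type b = fix_type \<psi>"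
    proof (rule ccontr)
      assume ty: "fix_type b \<noteq> fix_type \<psi>"
      then have "clos_less b \<psi>" using less aC prio[OF ab(2)] by blast
      then have "h_up \<psi> < h_up b" using h_up_clos_less(2) prio[OF ab(2)] ty by metis
      then show False using eq h_up_pos[OF tC \<psi>C(2)] \<psi>C by auto
    qed
    \<comment> \<open>Otherwise the dominator would prolong a chain that already has the maximal
      length \<open>cd C\<close>.\<close>
    moreover have "fix_type (last cs) = fix_type \<psi>"
    proof (rule ccontr)
      assume ty: "fix_type (last cs) \<noteq> fix_type \<psi>"
      have l: "last cs \<in> set cs" using ne by simp
      then have f: "is_fix (last cs)" using cs(1) by (auto simp: alt_chain_def)
      have "clos_less (last cs) \<psi>" using less[of "last cs"] f l csC ty by blast
      moreover have "fix_type \<psi> = dual (fix_type (last cs))"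
        using ty by (cases "fix_type \<psi>"; cases "fix_type (last cs)") auto
      ultimately have "alt_chain (cs @ [\<psi>])"
        using cs(1) ne \<psi>C tC by (simp add: alt_chain_snoc alt_step_def)
      then have "Suc (cd C) \<le> cd C" using cd_ge[OF finC, of "cs @ [\<psi>]"] csC \<psi>C cs by simp
      then show False by simp
    qed
    \<comment> \<open>Since \<open>m = 0\<close>, \<open>a\<close> has type \<open>Nu\<close>, so
      alternation gives \<open>last cs\<close> odd type exactly when \<open>cd C\<close> is even.
      But \<open>n = cd C\<close> gives \<open>b\<close> odd type exactly when \<open>cd C\<close>
      is odd.\<close>
    moreover have "\<not> fp_odd (fix_type a)" using m(3) eq(1) by simp
    then have "fp_odd (fix_type (last cs)) = even (cd C)"
      using alt_chain_last_type[OF cs(1)] unfolding cs(2,3) by simp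
    ultimately show False using n(3) eq(2) by simp
  qed
qed simp

text \<open>Each member \<open>\<phi>\<close> contributes the formulas mutually reachable with it
  through formulas containing \<open>\<phi>\<close>; it dominates them by construction. The sets
  grow along the chain because containing \<open>\<chi>\<close> implies containing its free
  subformula \<open>\<phi>\<close>.\<close>

lemma alt_chain_loop_chain:
  "alt_chain cs \<Longrightarrow>
    loop_chain (length cs) (fix_type (last cs)) (rel_cluster (trace_rel_within (last cs)) (last cs))"
proof (induction cs rule: rev_induct)
  case (snoc \<phi> cs)
  let ?K = "\<lambda>\<phi>. rel_cluster (trace_rel_within \<phi>) \<phi>"
  have \<phi>: "tidy \<phi>" "is_fix \<phi>" using snoc.prems by (auto simp: alt_chain_def)
  have fsK: "fs \<phi> \<rho>" if "\<rho> \<in> ?K \<phi>" for \<rho> and \<phi> :: "'a fm"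
    using that within_fs fs_refl unfolding rel_cluster_def by blast
  have dom: "dominates \<phi> (?K \<phi>)" using fsK \<phi> by (auto simp: dominates_def rel_cluster_def)
  have "?K \<phi> \<subseteq> Clos \<phi>" using within_subset unfolding rel_cluster_def Clos_def by blast
  then have fin: "finite (?K \<phi>)" using finite_Clos[OF \<phi>(1)] finite_subset by blast
  have sub: "trace_rel_within \<phi> \<inter> ?K \<phi> \<times> ?K \<phi> \<subseteq> trace_rel \<inter> ?K \<phi> \<times> ?K \<phi>" by (auto simp: within_iff)
  have "(a, b) \<in> (trace_rel \<inter> ?K \<phi> \<times> ?K \<phi>)\<^sup>*" if "a \<in> ?K \<phi>" "b \<in> ?K \<phi>" for a b
    using subsetD[OF rtrancl_mono[OF sub]] rel_cluster_path[OF that] by blast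
  then have sc: "sconn (?K \<phi>)" using fin dom unfolding sconn_def dominates_def by blast
  show ?case
  proof (cases "cs = []")
    case True
    then show ?thesis using loop_chain.single[OF sc dom] by simp
  next
    case False
    define \<chi> where "\<chi> = last cs"
    have st: "alt_step \<chi> \<phi>" "alt_chain cs" using alt_chain_snoc[OF False, of \<phi>] snoc.prems \<chi>_def by auto
    have t\<chi>: "tidy \<chi>" using st(2) False \<chi>_def by (auto simp: alt_chain_def)
    have le: "clos_le \<chi> \<phi>" using st by (auto simp: alt_step_def clos_less_iff)
    have fs: "fs \<phi> \<chi>" using clos_le_fs[OF le] .
    have to: "(\<phi>, \<chi>) \<in> (trace_rel_within \<phi>)\<^sup>*" using le by (simp add: clos_le_iff)
    have fro: "(\<chi>, \<phi>) \<in> (trace_rel_within \<phi>)\<^sup>*" using fs_trace_within[OF fs t\<chi>] .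
    have "?K \<chi> \<subseteq> ?K \<phi>"
    proof
      fix \<rho> assume "\<rho> \<in> ?K \<chi>"
      then have "(\<chi>, \<rho>) \<in> (trace_rel_within \<phi>)\<^sup>*" "(\<rho>, \<chi>) \<in> (trace_rel_within \<phi>)\<^sup>*"
        using within_mono[OF fs] unfolding rel_cluster_def by auto
      then show "\<rho> \<in> ?K \<phi>" using to fro unfolding rel_cluster_def by auto
    qed
    moreover have "loop_chain (length cs) (fix_type \<chi>) (?K \<chi>)" using snoc.IH[OF st(2)] \<chi>_def by simp
    moreover have "fix_type \<phi> = dual (fix_type \<chi>)" using st by (simp add: alt_step_def)
    ultimately show ?thesis using loop_chain.extend[of "length cs" "fix_type \<chi>" "?K \<chi>" "?K \<phi>" \<phi>] sc dom
      by simp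
  qed
qed (simp add: alt_chain_def)

lemma cd_le_ad:
  assumes "tidy \<xi>" "v \<in> Clos \<xi>"
  shows "cd (clos_cluster v) \<le> ad \<xi>"
proof (cases "cd (clos_cluster v) = 0")
  case False
  have "tidy v" using Clos_tidy assms by blast
  then obtain cs where cs: "alt_chain cs" "set cs \<subseteq> clos_cluster v" "length cs = cd (clos_cluster v)"
    using cd_attained[OF finite_clos_cluster False] by blast
  have "last cs \<in> Clos \<xi>"
    using cs clos_cluster_Clos[of v] Clos_trans[OF assms(2)] by (force simp: alt_chain_def)
  moreover have "rel_cluster (trace_rel_within (last cs)) (last cs) \<subseteq> Clos (last cs)"
    using within_subset unfolding rel_cluster_def Clos_def by blast
  ultimately have "rel_cluster (trace_rel_within (last cs)) (last cs) \<subseteq> Clos \<xi>" using Clos_trans by blast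
  then show ?thesis using loop_chain_le_ad[OF assms(1) alt_chain_loop_chain[OF cs(1)]] cs(3) by simp
qed simp

section \<open>The parity formula on the closure graph and its index\<close>

lemma G_of_simps [simp]:
  "PV (G_of \<xi>) = Clos \<xi>"
  "(a, b) \<in> PE (G_of \<xi>) \<longleftrightarrow> a \<in> Clos \<xi> \<and> b \<in> Clos \<xi> \<and> b \<in> succs a"
  "\<phi> \<in> Clos \<xi> \<Longrightarrow> PL (G_of \<xi>) \<phi> = L_n \<phi>"
  "\<phi> \<in> Clos \<xi> \<Longrightarrow> POm (G_of \<xi>) \<phi> = Omega_g \<phi>"
  "PI (G_of \<xi>) = \<xi>"
  by (auto simp: G_of_def)

lemma pf_cluster_G_of:
  assumes "v \<in> Clos \<xi>"
  shows "pf_cluster (G_of \<xi>) v \<subseteq> clos_cluster v"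
proof -
  have "(PE (G_of \<xi>))\<^sup>* \<subseteq> trace_rel\<^sup>*" by (rule rtrancl_mono) (auto simp: G_of_def)
  then show ?thesis unfolding pf_cluster_def clos_cluster_def by blast
qed

lemma Max_le_if_bounded:
  fixes A :: "nat set"
  assumes "A \<noteq> {}" "\<And>n. n \<in> A \<Longrightarrow> n \<le> k"
  shows "Max A \<le> k"
proof -
  have "finite A" using assms(2) by (intro finite_subset[of A "{..k}"]) auto
  then show ?thesis using assms by simp
qed

lemma ind_G_of_le_ad:
  assumes "tidy \<xi>"
  shows "ind (G_of \<xi>) \<le> ad \<xi>"
proof -
  have "cluster_index (G_of \<xi>) (pf_cluster (G_of \<xi>) v) \<le> ad \<xi>" if v: "v \<in> Clos \<xi>" for v
    unfolding cluster_index_def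
  proof (rule Max_le_if_bounded, goal_cases)
    case 1
    show ?case by (auto intro!: exI[of _ "[]"])
  next
    case (2 n)
    then obtain vs where vs: "n = length vs" "set vs \<subseteq> pf_cluster (G_of \<xi>) v"
      "\<forall>u\<in>set vs. POm (G_of \<xi>) u \<noteq> None"
      "\<forall>i. Suc i < length vs \<longrightarrow> the (POm (G_of \<xi>) (vs ! i)) < the (POm (G_of \<xi>) (vs ! Suc i))"
      by blast
    have c: "set vs \<subseteq> clos_cluster v" using vs pf_cluster_G_of[OF v] by blast
    then have Cl: "u \<in> Clos \<xi>" if "u \<in> set vs" for u
      using that clos_cluster_Clos[of v] Clos_trans[OF v] by blast
    have "length vs \<le> cd (clos_cluster v)"
    proof (rule priority_chain_le_cd)
      show "tidy v" using Clos_tidy assms v by blast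
      show "\<forall>u\<in>set vs. Omega_g u \<noteq> None" using vs(3) Cl by auto
      show "\<forall>i. Suc i < length vs \<longrightarrow> the (Omega_g (vs ! i)) < the (Omega_g (vs ! Suc i))"
        using vs(4) Cl by simp
    qed (rule c)
    then show ?case using cd_le_ad[OF assms v] vs(1) by simp
  qed
  moreover have "{cluster_index (G_of \<xi>) (pf_cluster (G_of \<xi>) v) | v. v \<in> PV (G_of \<xi>)} \<noteq> {}"
    by (simp add: ex_in_conv[symmetric]) (use Clos_refl[of \<xi>] in blast)
  ultimately show ?thesis unfolding ind_def by (intro Max_le_if_bounded) auto
qed

lemma parity_formula_G_of:
  assumes "tidy \<xi>"
  shows "parity_formula (G_of \<xi>)"
  unfolding parity_formula_def
proof (intro conjI ballI allI)
  show "finite (PV (G_of \<xi>))" using finite_Clos assms by simp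
  show "PE (G_of \<xi>) \<subseteq> PV (G_of \<xi>) \<times> PV (G_of \<xi>)" by auto
  show "PI (G_of \<xi>) \<in> PV (G_of \<xi>)" by simp
  show "{v. POm (G_of \<xi>) v \<noteq> None} \<subseteq> PV (G_of \<xi>)" by (auto simp: G_of_def split: if_splits)
next
  fix v assume "v \<in> PV (G_of \<xi>)"
  then show "case PL (G_of \<xi>) v of
         LAtom a \<Rightarrow> atomic a \<and> (\<forall>u. (v, u) \<notin> PE (G_of \<xi>))
       | LDia \<Rightarrow> (\<exists>!u. (v, u) \<in> PE (G_of \<xi>))
       | LBox \<Rightarrow> (\<exists>!u. (v, u) \<in> PE (G_of \<xi>))
       | LEps \<Rightarrow> (\<exists>!u. (v, u) \<in> PE (G_of \<xi>))
       | _ \<Rightarrow> True"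
    using Clos_step[of v \<xi>] by (cases v) auto
next
  fix v
  let ?E = "PE (G_of \<xi>) \<inter> {(a, b). POm (G_of \<xi>) a = None \<and> POm (G_of \<xi>) b = None}"
  \<comment> \<open>Members of the closure are tidy, so those without priority are not fixpoint
    formulas, and a step from them shrinks the formula. Hence no cycle avoids the
    priorities.\<close>
  have dec: "size b < size a" if e: "(a, b) \<in> ?E" for a b
  proof -
    have a: "a \<in> Clos \<xi>" "b \<in> succs a" "Omega_g a = None" using e by auto
    then have "\<not> is_fix a" using Clos_tidy[OF assms] by (auto simp: Omega_g_def Let_def)
    then show ?thesis using size_succs a by blast
  qed
  have "size b < size a" if "(a, b) \<in> ?E\<^sup>+" for a b
    using that
  proof (induction rule: trancl_induct)
    case (base y)
    then show ?case by (rule dec)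
  next
    case (step y y')
    then show ?case using dec[OF step.hyps(2)] by simp
  qed
  then show "(v, v) \<notin> ?E\<^sup>+" by blast
qed

subsection \<open>Semantics\<close>

lemma sem_mono: "\<forall>x. U x \<subseteq> U' x \<Longrightarrow> sem R V U \<phi> \<subseteq> sem R V U' \<phi>"
proof (induction \<phi> arbitrary: U U')
  case (And a b)
  show ?case using And.IH(1)[OF And.prems] And.IH(2)[OF And.prems] by auto
next
  case (Or a b)
  show ?case using Or.IH(1)[OF Or.prems] Or.IH(2)[OF Or.prems] by auto
next
  case (Dia a)
  show ?case using Dia.IH[OF Dia.prems] by auto
next
  case (Box a)
  show ?case using Box.IH[OF Box.prems] by auto
next
  case (Fix e x c)
  have "sem R V (U(x := A)) c \<subseteq> sem R V (U'(x := A)) c" for A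
    by (rule Fix.IH) (use Fix.prems in simp)
  then show ?case by (cases e) (auto intro!: lfp_mono gfp_mono)
qed auto

lemma mono_sem: "mono (\<lambda>A. sem R V (U(x := A)) c)"
  by (rule monoI, rule sem_mono) simp

lemma sem_cong: "\<forall>x\<in>FV \<phi>. U x = U' x \<Longrightarrow> sem R V U \<phi> = sem R V U' \<phi>"
proof (induction \<phi> arbitrary: U U')
  case (And a b)
  have "sem R V U a = sem R V U' a" by (rule And.IH(1)) (use And.prems in simp)
  moreover have "sem R V U b = sem R V U' b" by (rule And.IH(2)) (use And.prems in simp)
  ultimately show ?case by simp
next
  case (Or a b)
  have "sem R V U a = sem R V U' a" by (rule Or.IH(1)) (use Or.prems in simp)
  moreover have "sem R V U b = sem R V U' b" by (rule Or.IH(2)) (use Or.prems in simp)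
  ultimately show ?case by simp
next
  case (Dia a)
  have "sem R V U a = sem R V U' a" by (rule Dia.IH) (use Dia.prems in simp)
  then show ?case by simp
next
  case (Box a)
  have "sem R V U a = sem R V U' a" by (rule Box.IH) (use Box.prems in simp)
  then show ?case by simp
next
  case (Fix e x c)
  have "sem R V (U(x := A)) c = sem R V (U'(x := A)) c" for A
    by (rule Fix.IH) (use Fix.prems in auto)
  then show ?case by (cases e) auto
qed auto

lemma sem_subst_Var:
  assumes "z \<notin> FV c" "z \<notin> BV c"
  shows "sem R V (U(z := A)) (subst c (Var z) x) = sem R V (U(x := A)) c"
  using assms
proof (induction c arbitrary: U)
  case (Fix e y d)
  have "sem R V (U(z := A, y := B)) (if y = x then d else subst d (Var z) x)
    = sem R V (U(x := A, y := B)) d" for B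
  proof (cases "y = x")
    case True
    have "w \<noteq> z" if "w \<in> FV d" for w using that Fix.prems True by auto
    then have "\<forall>w\<in>FV d. (U(z := A, y := B)) w = (U(x := A, y := B)) w" using True by simp
    then have "sem R V (U(z := A, y := B)) d = sem R V (U(x := A, y := B)) d" by (rule sem_cong)
    then show ?thesis using True by (simp del: fun_upd_apply)
  next
    case False
    have "U(z := A, y := B) = U(y := B, z := A)" using Fix.prems by (intro fun_upd_twist) auto
    moreover have "U(x := A, y := B) = U(y := B, x := A)" using False by (intro fun_upd_twist) auto
    moreover have "sem R V (U(y := B, z := A)) (subst d (Var z) x) = sem R V (U(y := B, x := A)) d"
      using Fix.prems by (intro Fix.IH) auto
    ultimately show ?thesis using False by (simp del: fun_upd_apply)
  qed
  then show ?case by (cases e; cases "y = x") (simp_all del: fun_upd_apply)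
qed auto

lemma Compl_lfp: "- lfp f = gfp (\<lambda>A :: 'a set. - f (- A))"
proof -
  have "{u. u \<subseteq> - f (- u)} = uminus ` {u. f u \<subseteq> u}"
    by (auto simp: image_iff intro!: exI[of _ "- _"])
  then show ?thesis unfolding lfp_def gfp_def by (simp add: uminus_Inf)
qed

lemma Compl_gfp: "- gfp f = lfp (\<lambda>A :: 'a set. - f (- A))"
  using arg_cong[OF Compl_lfp[of "\<lambda>A. - f (- A)"], of uminus] by simp

subsection \<open>Dual formulas\<close>

text \<open>Variables occur only positively, so they are left alone and the valuation is
  complemented instead. In this form \<open>neg\<close> commutes with unfolding.\<close>

fun neg :: "'p fm \<Rightarrow> 'p fm" where
  "neg Top = Bot" | "neg Bot = Top" | "neg (Prop p) = NProp p" | "neg (NProp p) = Prop p"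
| "neg (Var x) = Var x"
| "neg (And a b) = Or (neg a) (neg b)" | "neg (Or a b) = And (neg a) (neg b)"
| "neg (Dia a) = Box (neg a)" | "neg (Box a) = Dia (neg a)"
| "neg (Fix e x c) = Fix (dual e) x (neg c)"

lemma sem_neg: "sem R V (\<lambda>x. - U x) (neg \<phi>) = - sem R V U \<phi>"
proof (induction \<phi> arbitrary: U)
  case (Fix e x c)
  have "(\<lambda>y. - U y)(x := A) = (\<lambda>y. - (U(x := - A)) y)" for A by (rule ext) simp
  then have "sem R V ((\<lambda>y. - U y)(x := A)) (neg c) = - sem R V (U(x := - A)) c" for A
    using Fix.IH by metis
  then show ?case by (cases e) (simp_all add: Compl_lfp Compl_gfp)
qed auto

lemma FV_neg [simp]: "FV (neg \<phi>) = FV \<phi>"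
  by (induction \<phi>) auto

lemma BV_neg [simp]: "BV (neg \<phi>) = BV \<phi>"
  by (induction \<phi>) auto

lemma tidy_neg [simp]: "tidy (neg \<phi>) = tidy \<phi>"
  by (simp add: tidy_def)

lemma neg_neg [simp]: "neg (neg \<phi>) = \<phi>"
proof (induction \<phi>)
  case (Fix e x c)
  then show ?case by (cases e) auto
qed auto

lemma neg_subst: "neg (subst \<phi> \<sigma> x) = subst (neg \<phi>) (neg \<sigma>) x"
  by (induction \<phi>) auto

lemma fs_neg: "fs \<psi> \<phi> \<Longrightarrow> fs (neg \<psi>) (neg \<phi>)"
  by (induction \<phi>) auto

lemma is_fix_neg: "is_fix \<psi> \<Longrightarrow> is_fix (neg \<psi>) \<and> fix_type (neg \<psi>) = dual (fix_type \<psi>)"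
  by (cases \<psi>) auto

subsection \<open>Ranking a least fixpoint\<close>

text \<open>Transfinite iteration of \<open>F\<close> along a well-order of the power set of the carrier; by
  Cantor's theorem the iteration becomes stationary.\<close>

lemma lfp_rank:
  fixes F :: "'a set \<Rightarrow> 'a set"
  assumes "mono F"
  shows "\<exists>r. wf r \<and> (\<forall>s\<in>lfp F. s \<in> F {t \<in> lfp F. (t, s) \<in> r})"
proof -
  obtain r0 :: "'a set rel" where r0: "well_order_on UNIV r0" using well_order_on ..
  define w where "w = r0 - Id"
  have wf: "wf w" using r0 by (simp add: w_def well_order_on_def)
  have tot: "X = Y \<or> (X, Y) \<in> w \<or> (Y, X) \<in> w" for X Y
    using r0 unfolding w_def well_order_on_def linear_order_on_def total_on_def by auto
  have trans: "(X, Z) \<in> w" if "(X, Y) \<in> w" "(Y, Z) \<in> w" for X Y Z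
  proof -
    have "trans r0" "antisym r0"
      using r0 unfolding well_order_on_def linear_order_on_def partial_order_on_def preorder_on_def by auto
    then show ?thesis using that unfolding w_def trans_def antisym_def by blast
  qed
  define G where "G = wfrec w (\<lambda>G X. F (\<Union>Y\<in>{Y. (Y, X) \<in> w}. G Y))"
  define L where "L X = (\<Union>Y\<in>{Y. (Y, X) \<in> w}. G Y)" for X
  have G: "G X = F (L X)" for X
  proof -
    have "(\<Union>Y\<in>{Y. (Y, X) \<in> w}. cut G w X Y) = L X" unfolding L_def by (auto simp: cut_apply)
    then show ?thesis unfolding G_def by (subst wfrec[OF wf]) (simp add: G_def[symmetric])
  qed
  have Glfp: "G X \<subseteq> lfp F" for X
    using wf
  proof (induction X rule: wf_induct_rule)
    case (less X)
    then have "L X \<subseteq> lfp F" unfolding L_def by blast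
    then have "F (L X) \<subseteq> F (lfp F)" by (rule monoD[OF assms])
    then show ?case using G lfp_unfold[OF assms] by blast
  qed
  have "\<exists>X. G X \<subseteq> L X"
  proof (rule ccontr)
    assume "\<not> ?thesis"
    then have "\<forall>X. \<exists>s. s \<in> G X \<and> s \<notin> L X" by blast
    \<comment> \<open>If every stage added a point, choosing one new point per stage would inject
      the power set into the carrier.\<close>
    then obtain f where f: "\<And>X. f X \<in> G X" "\<And>X. f X \<notin> L X" by metis
    have "f X \<noteq> f Y" if "(X, Y) \<in> w" for X Y
      using f(1)[of X] f(2)[of Y] that unfolding L_def by auto
    then have "inj f" using tot by (metis injI)
    then have "inv f ` UNIV = Pow UNIV" by (simp add: inj_imp_surj_inv)
    then show False using Cantors_theorem by blast
  qed
  then obtain X0 where "G X0 \<subseteq> L X0" by blast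
  then have "lfp F \<subseteq> L X0" using G by (intro lfp_lowerbound) blast
  then have ex: "\<exists>Y. s \<in> G Y" if "s \<in> lfp F" for s using that unfolding L_def by blast
  have "\<exists>Y. s \<in> G Y \<and> s \<notin> L Y" if s: "s \<in> lfp F" for s
  proof -
    obtain Y0 where "Y0 \<in> {Y. s \<in> G Y}" using ex[OF s] by blast
    then obtain Y where "Y \<in> {Y. s \<in> G Y}" "\<And>Z. (Z, Y) \<in> w \<Longrightarrow> Z \<notin> {Y. s \<in> G Y}"
      by (rule wfE_min[OF wf]) metis
    then show ?thesis unfolding L_def by blast
  qed
  \<comment> \<open>\<open>rk s\<close> is the first stage containing \<open>s\<close>; everything
    in earlier stages has smaller rank.\<close>
  then obtain rk where rk: "\<And>s. s \<in> lfp F \<Longrightarrow> s \<in> G (rk s) \<and> s \<notin> L (rk s)" by metis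
  have "wf (inv_image w rk)" using wf by simp
  moreover have "s \<in> F {t \<in> lfp F. (t, s) \<in> inv_image w rk}" if s: "s \<in> lfp F" for s
  proof -
    have "L (rk s) \<subseteq> {t \<in> lfp F. (t, s) \<in> inv_image w rk}"
    proof
      fix t assume "t \<in> L (rk s)"
      then obtain Z where Z: "(Z, rk s) \<in> w" "t \<in> G Z" unfolding L_def by blast
      then have t: "t \<in> lfp F" using Glfp by blast
      have "(Z, rk t) \<notin> w" using rk[OF t] Z unfolding L_def by blast
      then have "(rk t, rk s) \<in> w" using tot[of Z "rk t"] trans Z by blast
      then show "t \<in> {t \<in> lfp F. (t, s) \<in> inv_image w rk}" using t by simp
    qed
    then have "F (L (rk s)) \<subseteq> F {t \<in> lfp F. (t, s) \<in> inv_image w rk}" by (rule monoD[OF assms])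
    then show ?thesis using rk[OF s] G by blast
  qed
  ultimately show ?thesis by blast
qed

subsection \<open>Witness structures\<close>

text \<open>It stands in for the parity condition while strategies are built: priorities depend on
  the cluster of a formula, whereas this condition transfers along substitutions and
  dualization.\<close>

definition dominated :: "fp \<Rightarrow> (nat \<Rightarrow> 'p fm) \<Rightarrow> bool" where
  "dominated e \<tau> \<longleftrightarrow> (\<exists>\<psi>. is_fix \<psi> \<and> fix_type \<psi> = e \<and>
     (\<forall>k. \<exists>i\<ge>k. \<tau> i = \<psi>) \<and> (\<exists>k. \<forall>i\<ge>k. fs \<psi> (\<tau> i)))"

lemma dominated_shift:
  assumes "dominated e (\<lambda>i. \<tau> (i + k))"
  shows "dominated e \<tau>"
proof -
  obtain \<psi> j where \<psi>: "is_fix \<psi>" "fix_type \<psi> = e" "\<forall>l. \<exists>i\<ge>l. \<tau> (i + k) = \<psi>" "\<forall>i\<ge>j. fs \<psi> (\<tau> (i + k))"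
    using assms unfolding dominated_def by blast
  have "\<exists>i\<ge>l. \<tau> i = \<psi>" for l using \<psi>(3) by (meson trans_le_add1)
  moreover have "fs \<psi> (\<tau> i)" if "i \<ge> j + k" for i
    using \<psi>(4)[rule_format, of "i - k"] that by simp
  ultimately show ?thesis using \<psi>(1,2) unfolding dominated_def by blast
qed

text \<open>The map \<open>f\<close> on types is \<open>id\<close> when \<open>g\<close> is a
  substitution and \<open>dual\<close> when \<open>g\<close> is \<open>neg\<close>.\<close>

lemma dominated_image:
  assumes "dominated e \<tau>" "\<And>\<alpha> i. fs \<alpha> (\<tau> i) \<Longrightarrow> fs (g \<alpha>) (g (\<tau> i))"
    "\<And>\<psi>. is_fix \<psi> \<Longrightarrow> is_fix (g \<psi>) \<and> fix_type (g \<psi>) = f (fix_type \<psi>)"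
  shows "dominated (f e) (\<lambda>i. g (\<tau> i))"
proof -
  obtain \<psi> j where \<psi>: "is_fix \<psi>" "fix_type \<psi> = e" "\<forall>l. \<exists>i\<ge>l. \<tau> i = \<psi>" "\<forall>i\<ge>j. fs \<psi> (\<tau> i)"
    using assms(1) unfolding dominated_def by blast
  have "\<forall>l. \<exists>i\<ge>l. g (\<tau> i) = g \<psi>" using \<psi>(3) by metis
  moreover have "\<forall>i\<ge>j. fs (g \<psi>) (g (\<tau> i))" using \<psi>(4) assms(2) by blast
  ultimately show ?thesis using assms(3)[OF \<psi>(1)] \<psi>(2) unfolding dominated_def by blast
qed

text \<open>\<open>ok R V U \<rho> t L\<close>: Eloise's commitments at the position \<open>(\<rho>, t)\<close> are met by the
  set \<open>L\<close> of available successor positions.\<close>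

fun ok :: "('s \<times> 's) set \<Rightarrow> ('p \<Rightarrow> 's set) \<Rightarrow> (nat \<Rightarrow> 's set) \<Rightarrow> 'p fm \<Rightarrow> 's \<Rightarrow> ('p fm \<times> 's) set \<Rightarrow> bool" where
  "ok R V U (And a b) t L \<longleftrightarrow> (a, t) \<in> L \<and> (b, t) \<in> L"
| "ok R V U (Or a b) t L \<longleftrightarrow> (a, t) \<in> L \<or> (b, t) \<in> L"
| "ok R V U (Dia a) t L \<longleftrightarrow> (\<exists>u. (t, u) \<in> R \<and> (a, u) \<in> L)"
| "ok R V U (Box a) t L \<longleftrightarrow> (\<forall>u. (t, u) \<in> R \<longrightarrow> (a, u) \<in> L)"
| "ok R V U (Fix e x c) t L \<longleftrightarrow> (subst c (Fix e x c) x, t) \<in> L"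
| "ok R V U a t L \<longleftrightarrow> t \<in> sem R V U a"

lemma ok_mono: "ok R V U \<rho> t L \<Longrightarrow> L \<subseteq> L' \<Longrightarrow> ok R V U \<rho> t L'"
  by (cases \<rho>) auto

lemma ok_sem:
  "\<not> is_fix \<rho> \<Longrightarrow> t \<in> sem R V U \<rho> \<Longrightarrow> ok R V U \<rho> t {(a, u). a \<in> succs \<rho> \<and> u \<in> sem R V U a}"
  by (cases \<rho>) auto

text \<open>At \<open>Var z\<close> the commitment is only \<open>t \<in> B\<close>, which says
  nothing about successors of \<open>\<sigma>\<close>; that point is treated separately when copies
  are glued.\<close>

lemma (in subst_context) ok_lift:
  assumes "ok R V (U(z := B)) \<rho> t L" "\<rho> \<noteq> Var z" "\<rho> \<in> Clos \<phi>"
  shows "ok R V U (h \<rho>) t (map_prod h id ` L)"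
proof -
  have img: "(h a, u) \<in> map_prod h id ` L" if "(a, u) \<in> L" for a u
    using imageI[OF that, of "map_prod h id"] by simp
  show ?thesis
  proof (cases \<rho>)
    case (Fix e y c)
    have "h (subst c \<rho> y) \<in> succs (h \<rho>)" using succs_lift[OF assms(3,2)] Fix by simp
    moreover have "z \<noteq> y" using Clos_z[OF assms(3)] Fix by auto
    ultimately have "h (subst c \<rho> y) = subst (h c) (Fix e y (h c)) y" using Fix by auto
    moreover have "(h (subst c \<rho> y), t) \<in> map_prod h id ` L" using assms(1) Fix by (intro img) simp
    ultimately show ?thesis using Fix \<open>z \<noteq> y\<close> by auto
  next
    case (And a b)
    then show ?thesis using assms(1) img by simp
  next
    case (Or a b)
    then show ?thesis using assms(1) img by auto
  next
    case (Dia a)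
    then show ?thesis using assms(1) img by auto
  next
    case (Box a)
    then show ?thesis using assms(1) img by simp
  qed (use assms(1,2) in auto)
qed

text \<open>Nodes \<open>(m, \<rho>, t)\<close> are positions \<open>(\<rho>, t)\<close> equipped with a memory \<open>m\<close>; the edges
  describe all plays consistent with a strategy for Eloise.\<close>

type_synonym ('p, 's) node = "('p fm \<times> 's) list \<times> 'p fm \<times> 's"

definition witness :: "('s \<times> 's) set \<Rightarrow> ('p \<Rightarrow> 's set) \<Rightarrow> (nat \<Rightarrow> 's set) \<Rightarrow> 'p fm \<Rightarrow>
    ('p, 's) node set \<Rightarrow> (('p, 's) node \<times> ('p, 's) node) set \<Rightarrow> bool" where
  "witness R V U \<phi> X E \<longleftrightarrow>
     E \<subseteq> X \<times> X \<and>
     (\<forall>m \<rho> t. (m, \<rho>, t) \<in> X \<longrightarrow> \<rho> \<in> Clos \<phi> \<and> ok R V U \<rho> t (snd ` (E `` {(m, \<rho>, t)}))) \<and>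
     (\<forall>s \<in> sem R V U \<phi>. \<exists>m. (m, \<phi>, s) \<in> X) \<and>
     (\<forall>m \<rho> t m' \<rho>' t'. ((m, \<rho>, t), (m', \<rho>', t')) \<in> E \<longrightarrow> \<rho>' \<in> succs \<rho>) \<and>
     (\<forall>\<pi>. (\<forall>i. (\<pi> i, \<pi> (Suc i)) \<in> E) \<longrightarrow> dominated Nu (\<lambda>i. fst (snd (\<pi> i))))"

lemma witness_path:
  assumes "witness R V U \<phi> X E" "\<And>i. (\<pi> i, \<pi> (Suc i)) \<in> E"
  shows "dominated Nu (\<lambda>i. fst (snd (\<pi> i)))"
  using assms unfolding witness_def by blast

text \<open>Roots at \<open>\<phi>\<close> are placed above disjoint copies of the successors'
  structures. Modal steps may enter a copy at any true state, which is why a witness is rooted at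
  the whole truth set. After its first step a path stays in one copy.\<close>

lemma witness_succs:
  fixes XX :: "'p fm \<Rightarrow> ('p, 's) node set"
  assumes nf: "\<not> is_fix \<phi>"
    and W: "\<And>a. a \<in> succs \<phi> \<Longrightarrow> witness R V U a (XX a) (EE a)"
  shows "\<exists>X E. witness R V U \<phi> X E"
proof -
  \<comment> \<open>Only the formula matters as a tag here; \<open>undefined\<close> fills the state
    component. An empty memory is left to the roots.\<close>
  define tag :: "'p fm \<Rightarrow> ('p, 's) node \<Rightarrow> ('p, 's) node"
    where "tag a n = ((a, undefined) # fst n, snd n)" for a n
  have tag_inj: "tag a n = tag b n' \<longleftrightarrow> a = b \<and> n = n'" for a b n n'
    by (auto simp: tag_def prod_eq_iff)
  have tag_root: "tag a n \<noteq> ([], q)" for a n q by (simp add: tag_def)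
  have snd_tag: "snd (tag a n) = snd n" for a n by (simp add: tag_def)
  define X where "X = (\<lambda>s. ([], \<phi>, s)) ` sem R V U \<phi> \<union> (\<Union>a\<in>succs \<phi>. tag a ` XX a)"
  define E1 :: "(('p, 's) node \<times> ('p, 's) node) set" where "E1 = {(([], \<phi>, s), tag a (m, a, t)) | s a m t. s \<in> sem R V U \<phi> \<and> a \<in> succs \<phi> \<and> (m, a, t) \<in> XX a}"
  define E2 where "E2 = (\<Union>a\<in>succs \<phi>. map_prod (tag a) (tag a) ` EE a)"
  define E where "E = E1 \<union> E2"
  have E2I: "(tag a n, tag a n') \<in> E2" if "a \<in> succs \<phi>" "(n, n') \<in> EE a" for a n n'
    using that unfolding E2_def by force
  have E2D: "\<exists>a n n'. a \<in> succs \<phi> \<and> p = tag a n \<and> p' = tag a n' \<and> (n, n') \<in> EE a" if "(p, p') \<in> E2" for p p'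
    using that unfolding E2_def by force
  have EX: "EE a \<subseteq> XX a \<times> XX a" if "a \<in> succs \<phi>" for a using W[OF that] unfolding witness_def by blast
  have sub: "E \<subseteq> X \<times> X"
  proof -
    have "E1 \<subseteq> X \<times> X" unfolding E1_def X_def by blast
    moreover have "E2 \<subseteq> X \<times> X"
    proof
      fix q assume q: "q \<in> E2"
      obtain p p' where pp: "q = (p, p')" by (cases q)
      then obtain a n n' where a: "a \<in> succs \<phi>" "p = tag a n" "p' = tag a n'" "(n, n') \<in> EE a"
        using E2D q by blast
      then have "n \<in> XX a" "n' \<in> XX a" using EX by blast+
      then show "q \<in> X \<times> X" using a pp unfolding X_def by blast
    qed
    ultimately show ?thesis unfolding E_def by blast
  qed
  have nodes: "\<rho> \<in> Clos \<phi> \<and> ok R V U \<rho> t (snd ` (E `` {(m, \<rho>, t)}))" if n: "(m, \<rho>, t) \<in> X" for m \<rho> t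
  proof (cases "m = []")
    case True
    then have r: "\<rho> = \<phi>" "t \<in> sem R V U \<phi>" using n unfolding X_def by (auto simp: tag_def)
    have "{(a, u). a \<in> succs \<phi> \<and> u \<in> sem R V U a} \<subseteq> snd ` (E `` {([], \<phi>, t)})"
    proof (clarify)
      fix a u assume a: "a \<in> succs \<phi>" "u \<in> sem R V U a"
      then obtain m' where "(m', a, u) \<in> XX a" using W[OF a(1)] unfolding witness_def by blast
      then have "(([], \<phi>, t), tag a (m', a, u)) \<in> E" using r a unfolding E_def E1_def by blast
      then have "snd (tag a (m', a, u)) \<in> snd ` (E `` {([], \<phi>, t)})" by blast
      then show "(a, u) \<in> snd ` (E `` {([], \<phi>, t)})" by (simp add: snd_tag)
    qed
    then show ?thesis using ok_mono[OF ok_sem[OF nf r(2)]] r True by simp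
  next
    case False
    then obtain a n' where a: "a \<in> succs \<phi>" "n' \<in> XX a" "(m, \<rho>, t) = tag a n'" using n unfolding X_def by auto
    obtain m' where n': "n' = (m', \<rho>, t)" using a(3) by (auto simp: tag_def prod_eq_iff)
    have c: "\<rho> \<in> Clos a" "ok R V U \<rho> t (snd ` (EE a `` {n'}))" using W[OF a(1)] a(2) unfolding n' witness_def by blast+
    have sb: "snd ` (EE a `` {n'}) \<subseteq> snd ` (E `` {(m, \<rho>, t)})"
    proof
      fix q assume "q \<in> snd ` (EE a `` {n'})"
      then obtain k where "(n', k) \<in> EE a" "q = snd k" by blast
      then have "(tag a n', tag a k) \<in> E" "q = snd (tag a k)" using E2I a E_def snd_tag by auto
      then show "q \<in> snd ` (E `` {(m, \<rho>, t)})" using a(3) by (metis ImageI imageI singletonI)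
    qed
    have "a \<in> Clos \<phi>" using a(1) Clos_step Clos_refl by blast
    then show ?thesis using Clos_trans[OF _ c(1)] ok_mono[OF c(2) sb] by blast
  qed
  have roots: "\<exists>m. (m, \<phi>, s) \<in> X" if "s \<in> sem R V U \<phi>" for s using that unfolding X_def by blast
  have steps: "\<rho>' \<in> succs \<rho>" if e: "((m, \<rho>, t), (m', \<rho>', t')) \<in> E" for m \<rho> t m' \<rho>' t'
  proof (cases "((m, \<rho>, t), (m', \<rho>', t')) \<in> E1")
    case True
    then show ?thesis unfolding E1_def by (auto simp: tag_def)
  next
    case False
    then obtain a n n' where a: "a \<in> succs \<phi>" "(m, \<rho>, t) = tag a n" "(m', \<rho>', t') = tag a n'" "(n, n') \<in> EE a"
      using e E2D unfolding E_def by blast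
    obtain k k' where "n = (k, \<rho>, t)" "n' = (k', \<rho>', t')" using a(2,3) by (auto simp: tag_def prod_eq_iff)
    then show ?thesis using W[OF a(1)] a(4) unfolding witness_def by blast
  qed
  have paths: "dominated Nu (\<lambda>i. fst (snd (\<pi> i)))" if \<pi>: "\<forall>i. (\<pi> i, \<pi> (Suc i)) \<in> E" for \<pi>
  proof -
    have tg: "\<exists>a n. a \<in> succs \<phi> \<and> \<pi> (Suc i) = tag a n" for i
      using \<pi>[rule_format, of i] E2D unfolding E_def E1_def by blast
    have e2: "(\<pi> (Suc i), \<pi> (Suc (Suc i))) \<in> E2" for i
      using \<pi>[rule_format, of "Suc i"] tg[of i] unfolding E_def E1_def by (auto simp: tag_def)
    obtain a n0 where a: "a \<in> succs \<phi>" "\<pi> (Suc 0) = tag a n0" using tg by blast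
    have all: "\<exists>n. \<pi> (Suc i) = tag a n" for i
    proof (induction i)
      case (Suc i)
      then show ?case using E2D[OF e2[of i]] tag_inj by metis
    qed (use a in blast)
    then obtain nd where nd: "\<And>i. \<pi> (Suc i) = tag a (nd i)" by metis
    have "(nd i, nd (Suc i)) \<in> EE a" for i using E2D[OF e2[of i]] nd tag_inj by metis
    then have "dominated Nu (\<lambda>i. fst (snd (nd i)))" using W[OF a(1)] unfolding witness_def by blast
    then show ?thesis using dominated_shift[of Nu "\<lambda>i. fst (snd (\<pi> i))" 1] nd snd_tag by simp
  qed
  have "witness R V U \<phi> X E" unfolding witness_def using sub nodes roots steps paths by blast
  then show ?thesis by blast
qed

text \<open>A state \<open>s\<close> in the truth set of a fixpoint formula is supported by a set \<open>B s\<close> of states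
  at which the fixpoint may be regenerated; for \<open>Mu\<close> these have smaller rank.\<close>

lemma fixpoint_support:
  "\<exists>B r. wf r \<and> (\<forall>s\<in>sem R V U (Fix e x c).
      B s \<subseteq> sem R V U (Fix e x c) \<and> s \<in> sem R V (U(x := B s)) c) \<and>
    (e = Mu \<longrightarrow> (\<forall>s. \<forall>t\<in>B s. (t, s) \<in> r))"
proof (cases e)
  case Mu
  let ?F = "\<lambda>A. sem R V (U(x := A)) c"
  obtain r where r: "wf r \<and> (\<forall>s\<in>lfp ?F. s \<in> ?F {t \<in> lfp ?F. (t, s) \<in> r})"
    using lfp_rank[OF mono_sem[of R V U x c]] ..
  show ?thesis
    by (rule exI[of _ "\<lambda>s. {t \<in> lfp ?F. (t, s) \<in> r}"], rule exI[of _ r]) (use r Mu in auto)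
next
  case Nu
  let ?F = "\<lambda>A. sem R V (U(x := A)) c"
  have "gfp ?F = ?F (gfp ?F)" by (rule gfp_unfold[OF mono_sem])
  then have *: "s \<in> ?F (gfp ?F)" if "s \<in> gfp ?F" for s using that by blast
  show ?thesis
    by (rule exI[of _ "\<lambda>s. gfp ?F"], rule exI[of _ "{}"]) (use * Nu in simp)
qed

text \<open>There is one copy of a structure for the body per state \<open>s\<close> of
  regeneration, with \<open>z\<close> read as \<open>B s\<close>. \<open>E1\<close> enters a copy,
  \<open>E2\<close> moves inside it, and \<open>E3\<close> leaves it at \<open>Var z\<close> for the
  copy of the state reached. A path regenerating finitely often ends in one copy; one regenerating
  infinitely often is excluded for \<open>Mu\<close> by the rank and dominated by
  \<open>\<psi>\<close> for \<open>Nu\<close>.\<close>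

lemma (in fresh_unfolding) witness_fix:
  fixes U :: "nat \<Rightarrow> 's set" and XX :: "'s \<Rightarrow> ('p, 's) node set"
  assumes wf: "wf r"
    and BA: "\<And>s. s \<in> sem R V U \<psi> \<Longrightarrow> B s \<subseteq> sem R V U \<psi>"
    and Bc: "\<And>s. s \<in> sem R V U \<psi> \<Longrightarrow> s \<in> sem R V (U(x := B s)) c"
    and Br: "\<And>s t. e = Mu \<Longrightarrow> t \<in> B s \<Longrightarrow> (t, s) \<in> r"
    and W: "\<And>s. s \<in> sem R V U \<psi> \<Longrightarrow> witness R V (U(z := B s)) c' (XX s) (EE s)"
  shows "\<exists>X E. witness R V U \<psi> X E"
proof -
  define A where "A = sem R V U \<psi>"
  \<comment> \<open>As \<open>h\<close> is not injective, the memory stores the preimage of the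
    formula together with the copy; this makes \<open>tag\<close> injective.\<close>
  define tag :: "'s \<Rightarrow> ('p, 's) node \<Rightarrow> ('p, 's) node"
    where "tag s n = ((fst (snd n), s) # fst n, h (fst (snd n)), snd (snd n))" for s n
  have tag_inj: "tag s n = tag s' n' \<longleftrightarrow> s = s' \<and> n = n'" for s s' n n'
    by (auto simp: tag_def prod_eq_iff)
  have snd_tag: "snd (tag s n) = map_prod h id (snd n)" for s n by (simp add: tag_def map_prod_def split_beta)
  define X where "X = (\<lambda>s. ([], \<psi>, s)) ` A \<union> (\<Union>s\<in>A. tag s ` XX s)"
  define E1 :: "(('p, 's) node \<times> ('p, 's) node) set"
    where "E1 = {(([], \<psi>, s), tag s (m, c', s)) | s m. s \<in> A \<and> (m, c', s) \<in> XX s}"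
  define E2 where "E2 = {(tag s n, tag s n') | s n n'. s \<in> A \<and> (n, n') \<in> EE s}"
  \<comment> \<open>Under \<open>h\<close> the leaf \<open>Var z\<close> becomes
    \<open>\<psi>\<close>, so the step from it is an unfolding, straight to the start of the copy
    for \<open>t\<close>.\<close>
  define E3 where "E3 = {(tag s (m, Var z, t), tag t (m', c', t)) | s t m m'.
    s \<in> A \<and> (m, Var z, t) \<in> XX s \<and> t \<in> B s \<and> (m', c', t) \<in> XX t}"
  define E where "E = E1 \<union> E2 \<union> E3"
  have W': "witness R V (U(z := B s)) c' (XX s) (EE s)" if "s \<in> A" for s using W that A_def by blast
  have EX: "EE s \<subseteq> XX s \<times> XX s" if "s \<in> A" for s using W'[OF that] unfolding witness_def by blast
  have Xs: "\<rho> \<in> Clos c' \<and> ok R V (U(z := B s)) \<rho> t (snd ` (EE s `` {(m, \<rho>, t)}))"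
    if "s \<in> A" "(m, \<rho>, t) \<in> XX s" for s m \<rho> t
    using W'[OF that(1)] that(2) unfolding witness_def by blast
  have BA': "B s \<subseteq> A" if "s \<in> A" for s using BA that A_def by blast
  have root: "\<exists>m. (m, c', s) \<in> XX s" if "s \<in> A" for s
  proof -
    have "s \<in> sem R V (U(z := B s)) c'"
      unfolding c'_def sem_subst_Var[OF z_not_c(1,2)] using that A_def by (intro Bc) simp
    then show ?thesis using W'[OF that] unfolding witness_def by blast
  qed
  have sub: "E \<subseteq> X \<times> X"
  proof -
    have "E1 \<subseteq> X \<times> X" unfolding E1_def X_def by blast
    moreover have "E2 \<subseteq> X \<times> X"
    proof
      fix q assume "q \<in> E2"
      then obtain s n n' where q: "q = (tag s n, tag s n')" "s \<in> A" "(n, n') \<in> EE s" unfolding E2_def by blast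
      then have "n \<in> XX s" "n' \<in> XX s" using EX by blast+
      then show "q \<in> X \<times> X" using q unfolding X_def by blast
    qed
    moreover have "E3 \<subseteq> X \<times> X"
    proof
      fix q assume "q \<in> E3"
      then obtain s t m m' where q: "q = (tag s (m, Var z, t), tag t (m', c', t))"
        "s \<in> A" "(m, Var z, t) \<in> XX s" "t \<in> B s" "(m', c', t) \<in> XX t" unfolding E3_def by blast
      then have "t \<in> A" using BA' by blast
      then show "q \<in> X \<times> X" using q unfolding X_def by blast
    qed
    ultimately show ?thesis unfolding E_def by blast
  qed
  have \<psi>_ok: "ok R V U \<psi> t L \<longleftrightarrow> (h c', t) \<in> L" for t L
    unfolding unfold_psi by (simp add: psi_def)
  have nodes: "\<rho> \<in> Clos \<psi> \<and> ok R V U \<rho> t (snd ` (E `` {(m, \<rho>, t)}))" if n: "(m, \<rho>, t) \<in> X" for m \<rho> t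
  proof (cases "m = []")
    case True
    then have r: "\<rho> = \<psi>" "t \<in> A" using n unfolding X_def by (auto simp: tag_def)
    obtain m' where "(m', c', t) \<in> XX t" using root r by blast
    then have "(([], \<psi>, t), tag t (m', c', t)) \<in> E" using r unfolding E_def E1_def by blast
    then have "snd (tag t (m', c', t)) \<in> snd ` (E `` {([], \<psi>, t)})" by blast
    then show ?thesis using r True by (simp add: snd_tag \<psi>_ok)
  next
    case False
    then obtain s n where sn: "s \<in> A" "n \<in> XX s" "(m, \<rho>, t) = tag s n" using n unfolding X_def by auto
    obtain m' \<rho>' where n: "n = (m', \<rho>', t)" and \<rho>: "\<rho> = h \<rho>'" using sn(3) by (cases n) (auto simp: tag_def)
    have c: "\<rho>' \<in> Clos c'" "ok R V (U(z := B s)) \<rho>' t (snd ` (EE s `` {n}))"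
      using Xs[OF sn(1)] sn(2) unfolding n by blast+
    have "h \<rho>' \<in> Clos \<psi>" using c(1)
    proof (induction rule: Clos_induct)
      case base
      have "h c' \<in> succs \<psi>" by (simp add: succs_psi)
      then show ?case using Clos_step Clos_refl by blast
    next
      case (step \<sigma> \<sigma>')
      have s: "\<sigma> \<in> Clos c'" "\<sigma>' \<in> succs \<sigma>" "h \<sigma> \<in> Clos \<psi>" by fact+
      then have "\<sigma> \<noteq> Var z" by auto
      then have "h \<sigma>' \<in> succs (h \<sigma>)" using succs_lift s by blast
      then show ?case using Clos_step s by blast
    qed
    moreover have "ok R V U (h \<rho>') t (snd ` (E `` {tag s n}))"
    proof (cases "\<rho>' = Var z")
      case True
      then have t: "t \<in> B s" using c(2) by simp
      then have "t \<in> A" using BA' sn by blast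
      then obtain k where "(k, c', t) \<in> XX t" using root by blast
      then have "(tag s n, tag t (k, c', t)) \<in> E" using sn t True unfolding n E_def E3_def by blast
      then have "snd (tag t (k, c', t)) \<in> snd ` (E `` {tag s n})" by blast
      then show ?thesis using True by (simp add: snd_tag \<psi>_ok)
    next
      case False
      have "map_prod h id ` (snd ` (EE s `` {n})) \<subseteq> snd ` (E `` {tag s n})"
      proof
        fix q assume "q \<in> map_prod h id ` (snd ` (EE s `` {n}))"
        then obtain k where nk: "(n, k) \<in> EE s" and "q = map_prod h id (snd k)" by auto
        then have k: "(n, k) \<in> EE s" "q = snd (tag s k)" by (simp_all add: snd_tag)
        then have "(tag s n, tag s k) \<in> E" using sn(1) unfolding E_def E2_def by blast
        then show "q \<in> snd ` (E `` {tag s n})" using k by blast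
      qed
      then show ?thesis using ok_mono[OF ok_lift[OF c(2) False c(1)]] by blast
    qed
    ultimately show ?thesis using sn(3) \<rho> by simp
  qed
  have roots: "\<exists>m. (m, \<psi>, s) \<in> X" if "s \<in> sem R V U \<psi>" for s using that unfolding X_def A_def by blast
  have EE_succs: "fst (snd n') \<in> succs (fst (snd n))" if "s \<in> A" "(n, n') \<in> EE s" for s n n'
  proof -
    obtain m \<rho> t m' \<rho>' t' where n: "n = (m, \<rho>, t)" "n' = (m', \<rho>', t')" by (cases n; cases n')
    have "\<rho>' \<in> succs \<rho>" using W'[OF that(1)] that(2) unfolding n witness_def by blast
    then show ?thesis by (simp add: n)
  qed
  have steps: "\<rho>' \<in> succs \<rho>" if st: "((m, \<rho>, t), (m', \<rho>', t')) \<in> E" for m \<rho> t m' \<rho>' t'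
  proof -
    have hc: "h c' \<in> succs \<psi>" by (simp add: succs_psi)
    consider "((m, \<rho>, t), (m', \<rho>', t')) \<in> E1" | "((m, \<rho>, t), (m', \<rho>', t')) \<in> E2"
      | "((m, \<rho>, t), (m', \<rho>', t')) \<in> E3" using st unfolding E_def by blast
    then show ?thesis
    proof cases
      case 1
      then show ?thesis using hc unfolding E1_def by (auto simp: tag_def)
    next
      case 2
      then obtain s n n' where a: "s \<in> A" "(m, \<rho>, t) = tag s n" "(m', \<rho>', t') = tag s n'" "(n, n') \<in> EE s"
        unfolding E2_def by blast
      have \<rho>: "\<rho> = h (fst (snd n))" "\<rho>' = h (fst (snd n'))" using a(2,3) by (auto simp: tag_def)
      have "n \<in> XX s" using EX[OF a(1)] a(4) by blast
      then have "fst (snd n) \<in> Clos c'" using Xs[OF a(1), of "fst n" "fst (snd n)" "snd (snd n)"] by simp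
      moreover have su: "fst (snd n') \<in> succs (fst (snd n))" using EE_succs a by blast
      moreover from su have "fst (snd n) \<noteq> Var z" by auto
      ultimately show ?thesis unfolding \<rho> using succs_lift by blast
    next
      case 3
      then show ?thesis using hc unfolding E3_def by (auto simp: tag_def)
    qed
  qed
  have paths: "dominated Nu (\<lambda>i. fst (snd (\<pi> i)))" if \<pi>: "\<forall>i. (\<pi> i, \<pi> (Suc i)) \<in> E" for \<pi>
  proof -
    have "\<exists>s n. \<pi> (Suc i) = tag s n \<and> s \<in> A \<and> n \<in> XX s" for i
    proof -
      have "\<pi> (Suc i) \<in> X" using \<pi>[rule_format, of i] sub by blast
      moreover have "\<exists>s n. \<pi> (Suc i) = tag s n"
        using \<pi>[rule_format, of i] unfolding E_def E1_def E2_def E3_def by blast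
      then have "\<pi> (Suc i) \<notin> range (\<lambda>s. ([], \<psi>, s))" by (auto simp: tag_def)
      ultimately show ?thesis unfolding X_def by blast
    qed
    then obtain sg nd where sn: "\<And>i. \<pi> (Suc i) = tag (sg i) (nd i)" "\<And>i. sg i \<in> A" "\<And>i. nd i \<in> XX (sg i)"
      by metis
    define rho where "rho i = fst (snd (nd i))" for i
    define pass where "pass i \<longleftrightarrow> rho i = Var z \<and> sg (Suc i) \<in> B (sg i)" for i
    have inner: "sg (Suc i) = sg i \<and> (nd i, nd (Suc i)) \<in> EE (sg i)" if np: "\<not> pass i" for i
    proof -
      have "(tag (sg i) (nd i), tag (sg (Suc i)) (nd (Suc i))) \<in> E"
        using \<pi>[rule_format, of "Suc i"] sn(1) by simp
      moreover have "(tag (sg i) (nd i), q) \<notin> E1" for q unfolding E1_def by (auto simp: tag_def)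
      moreover have "(tag (sg i) (nd i), tag (sg (Suc i)) (nd (Suc i))) \<notin> E3"
      proof
        assume "(tag (sg i) (nd i), tag (sg (Suc i)) (nd (Suc i))) \<in> E3"
        then obtain s t m m' where q: "tag (sg i) (nd i) = tag s (m, Var z, t)"
          "tag (sg (Suc i)) (nd (Suc i)) = tag t (m', c', t)" "t \<in> B s" unfolding E3_def by blast
        then show False using np unfolding tag_inj pass_def rho_def by simp
      qed
      ultimately have "(tag (sg i) (nd i), tag (sg (Suc i)) (nd (Suc i))) \<in> E2" unfolding E_def by blast
      then obtain s n n' where q: "tag (sg i) (nd i) = tag s n"
          "tag (sg (Suc i)) (nd (Suc i)) = tag s n'" "(n, n') \<in> EE s" unfolding E2_def by blast
      then show ?thesis unfolding tag_inj by simp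
    qed
    have rhoC: "rho i \<in> Clos c'" for i
      using Xs[OF sn(2), of "fst (nd i)" "rho i" "snd (snd (nd i))"] sn(3)[of i] by (simp add: rho_def)
    have lab: "fst (snd (\<pi> (Suc i))) = h (rho i)" for i by (simp add: sn(1) tag_def rho_def)
    have "dominated Nu (\<lambda>i. h (rho i))"
    proof (cases "\<exists>k. \<forall>i\<ge>k. \<not> pass i")
      case True
      then obtain k where k: "\<And>i. i \<ge> k \<Longrightarrow> \<not> pass i" by blast
      have "sg (i + k) = sg k" for i
      proof (induction i)
        case (Suc i)
        then show ?case using inner[OF k, of "i + k"] by simp
      qed simp
      then have "(nd (i + k), nd (Suc i + k)) \<in> EE (sg k)" for i using inner[OF k, of "i + k"] by simp
      then have "dominated Nu (\<lambda>i. fst (snd (nd (i + k))))"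
        using witness_path[OF W'[OF sn(2)[of k]], of "\<lambda>i. nd (i + k)"] by blast
      then have "dominated Nu (\<lambda>i. rho (i + k))" by (simp add: rho_def)
      then have "dominated (id Nu) (\<lambda>i. h (rho (i + k)))"
        by (rule dominated_image) (simp_all add: fs_lift rhoC is_fix_subst)
      then show ?thesis using dominated_shift[of Nu "\<lambda>i. h (rho i)" k] by simp
    next
      case False
      then have io: "\<exists>i\<ge>k. pass i" for k by blast
      have "e = Nu"
      proof (rule ccontr)
        assume "e \<noteq> Nu"
        then have Mu: "e = Mu" by (cases e) auto
        have desc: "(sg (i + k), sg k) \<in> r\<^sup>*" for i k
        proof (induction i)
          case (Suc i)
          have "(sg (Suc (i + k)), sg (i + k)) \<in> r\<^sup>*"
            using inner[of "i + k"] Br[OF Mu] unfolding pass_def by (cases "pass (i + k)") (auto simp: pass_def)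
          then show ?case using Suc by simp
        qed simp
        \<comment> \<open>Copy labels stay equal or drop in \<open>r\<close>, so any regeneration
          after a minimal label would fall below it.\<close>
        obtain k where k: "\<And>j. (sg j, sg k) \<notin> r\<^sup>+"
          using wfE_min[OF wf_trancl[OF wf], of "sg 0" "range sg"] by (metis rangeE rangeI)
        obtain i where i: "i \<ge> k" "pass i" using io by blast
        have "(sg (Suc i), sg i) \<in> r" using i(2) Br[OF Mu] unfolding pass_def by blast
        moreover have "(sg i, sg k) \<in> r\<^sup>*" using desc[of "i - k" k] i(1) by simp
        ultimately show False using k[of "Suc i"] by (meson rtrancl_into_trancl2)
      qed
      \<comment> \<open>Up to the next regeneration the preimages form a trace ending in
        \<open>Var z\<close>; hence all images contain \<open>\<psi>\<close>.\<close>
      have reach: "Var z \<in> Clos (rho i)" if "pass (i + n)" for i n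
        using that
      proof (induction n arbitrary: i)
        case 0
        then show ?case by (simp add: pass_def)
      next
        case (Suc n)
        then have IH: "Var z \<in> Clos (rho (Suc i))" by simp
        show ?case
        proof (cases "pass i")
          case True
          then show ?thesis by (simp add: pass_def)
        next
          case False
          then have "rho (Suc i) \<in> succs (rho i)" using EE_succs[OF sn(2)] inner unfolding rho_def by blast
          then have "rho (Suc i) \<in> Clos (rho i)" using Clos_step Clos_refl by blast
          then show ?thesis using IH Clos_trans by blast
        qed
      qed
      have "fs \<psi> (h (rho i))" for i
      proof -
        obtain j where "j \<ge> i" "pass j" using io by blast
        then have "Var z \<in> Clos (rho i)" using reach[of i "j - i"] by simp
        then show ?thesis using fs_sigma_lift rhoC by blast
      qed
      moreover have "\<exists>i\<ge>k. h (rho i) = \<psi>" for k using io[of k] unfolding pass_def by auto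
      moreover have "is_fix \<psi>" "fix_type \<psi> = Nu" using \<open>e = Nu\<close> by (simp_all add: psi_def)
      ultimately show ?thesis unfolding dominated_def by blast
    qed
    then show ?thesis using dominated_shift[of Nu "\<lambda>i. fst (snd (\<pi> i))" 1] lab by simp
  qed
  have "witness R V U \<psi> X E" unfolding witness_def using sub nodes roots steps paths by blast
  then show ?thesis by blast
qed

theorem witness_exists:
  fixes R :: "('s \<times> 's) set"
  assumes "tidy \<phi>"
  shows "\<exists>X E. witness R V U \<phi> X E"
  using assms
proof (induction "size \<phi>" arbitrary: \<phi> U rule: less_induct)
  case less
  show ?case
  proof (cases "is_fix \<phi>")
    case False
    have "\<forall>a\<in>succs \<phi>. \<exists>X E. witness R V U a X E"
      using less.hyps size_succs[OF _ False] tidy_succs[OF less.prems] by blast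
    then obtain XX EE where "\<forall>a\<in>succs \<phi>. witness R V U a (XX a) (EE a)" by metis
    then show ?thesis using witness_succs[OF False] by blast
  next
    case True
    then obtain e x c where \<phi>: "\<phi> = Fix e x c" by (cases \<phi>) auto
    obtain z where z: "fresh_unfolding e x c z (Fix e x c) (subst c (Var z) x)"
      using fresh_unfolding_exists less.prems \<phi> by blast
    define c' where "c' = subst c (Var z) x"
    interpret fresh_unfolding e x c z \<phi> c' using z \<phi> c'_def by simp
    obtain B r where B: "wf r" "\<forall>s\<in>sem R V U \<phi>. B s \<subseteq> sem R V U \<phi> \<and> s \<in> sem R V (U(x := B s)) c"
      "e = Mu \<longrightarrow> (\<forall>s. \<forall>t\<in>B s. (t, s) \<in> r)"
      using fixpoint_support[of R V U e x c] unfolding \<phi> by blast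
    have "\<forall>s. \<exists>X E. witness R V (U(z := B s)) c' X E"
      using less.hyps[OF size_c' tidy_c'] by blast
    then obtain XX EE where "\<And>s. witness R V (U(z := B s)) c' (XX s) (EE s)" by metis
    then show ?thesis by (intro witness_fix[OF B(1), of R V U B]) (use B(2,3) in blast)+
  qed
qed

subsection \<open>The evaluation game\<close>

lemma winner_dominated:
  assumes "tidy \<xi>" "\<And>i. \<tau> i \<in> Clos \<xi>" "\<And>i. \<tau> (Suc i) \<in> succs (\<tau> i)" "dominated e \<tau>"
  shows "odd (Max {n. infinite {i. POm (G_of \<xi>) (\<tau> i) = Some n}}) = fp_odd e"
proof -
  obtain \<psi> k where \<psi>: "is_fix \<psi>" "fix_type \<psi> = e" "\<forall>l. \<exists>i\<ge>l. \<tau> i = \<psi>" "\<forall>i\<ge>k. fs \<psi> (\<tau> i)"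
    using assms(4) unfolding dominated_def by blast
  obtain i where i: "i \<ge> k" "\<tau> i = \<psi>" using \<psi>(3) by blast
  have td: "tidy (\<tau> j)" for j using Clos_tidy assms(1,2) by blast
  obtain n where n: "Omega_g \<psi> = Some n" "odd n = fp_odd e"
    using Omega_g_cases[of \<psi>] td[of i] i(2) \<psi>(1,2) by metis
  let ?M = "{n. infinite {i. POm (G_of \<xi>) (\<tau> i) = Some n}}"
  have Om: "POm (G_of \<xi>) (\<tau> j) = Omega_g (\<tau> j)" for j using assms(2) by simp
  have "infinite {i. \<tau> i = \<psi>}" using \<psi>(3) by (auto simp: infinite_nat_iff_unbounded_le)
  moreover have "{i. \<tau> i = \<psi>} \<subseteq> {i. POm (G_of \<xi>) (\<tau> i) = Some n}" using n Om by auto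
  ultimately have nM: "n \<in> ?M" using infinite_super by blast
  \<comment> \<open>From a late visit to \<open>\<psi>\<close> on, the match itself is the trace
    that the closure order asks for.\<close>
  have path: "(\<psi>, \<tau> (i + j)) \<in> (trace_rel_within \<psi>)\<^sup>*" for j
  proof (induction j)
    case (Suc j)
    have "(\<tau> (i + j), \<tau> (i + Suc j)) \<in> trace_rel_within \<psi>"
      using assms(3)[of "i + j"] \<psi>(4) i(1) by (simp add: within_iff)
    then show ?case using Suc by (rule rtrancl_into_rtrancl[rotated])
  qed (simp add: i)
  have le: "m \<le> n" if m: "m \<in> ?M" for m
  proof -
    obtain j where j: "j \<ge> i" "POm (G_of \<xi>) (\<tau> j) = Some m"
      using m by (auto simp: infinite_nat_iff_unbounded_le)
    then have Omj: "Omega_g (\<tau> j) = Some m" using Om by simp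
    then have "is_fix (\<tau> j)" by (auto simp: Omega_g_def split: if_splits)
    moreover have "(\<psi>, \<tau> j) \<in> (trace_rel_within \<psi>)\<^sup>*" using path[of "j - i"] j(1) by simp
    ultimately have "clos_le (\<tau> j) \<psi>" using \<psi>(1) by (simp add: clos_le_iff)
    then show ?thesis using Omega_g_mono td Omj n(1) by blast
  qed
  have "finite ?M" using le by (intro finite_subset[of ?M "{..n}"]) auto
  then have "Max ?M = n" using nM le by (intro Max_eqI) auto
  then show ?thesis using n by simp
qed

section \<open>Moves of the game against the commitments of a witness\<close>

lemma moves_succs:
  assumes "q' \<in> moves (G_of \<xi>) R q" "fst q \<in> Clos \<xi>"
  shows "fst q' \<in> succs (fst q) \<and> fst q' \<in> Clos \<xi>"
  using assms by (cases q; cases "fst q") (auto simp: moves_def)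

lemma ok_eloise:
  assumes "ok R V U \<rho> t L" "\<rho> \<in> Clos \<xi>" "eloise_pos (G_of \<xi>) (\<rho>, t)"
  shows "moves (G_of \<xi>) R (\<rho>, t) \<inter> L \<noteq> {}"
  using assms Clos_step[OF assms(2)] by (cases \<rho>) (auto simp: moves_def eloise_pos_def)

lemma ok_abelard:
  assumes "ok R V U \<rho> t L" "\<rho> \<in> Clos \<xi>" "\<not> eloise_pos (G_of \<xi>) (\<rho>, t)"
  shows "moves (G_of \<xi>) R (\<rho>, t) \<subseteq> L"
  using assms by (cases \<rho>) (auto simp: moves_def eloise_pos_def)

lemma ok_stuck:
  assumes "ok R V U \<rho> t L" "\<rho> \<in> Clos \<xi>" "moves (G_of \<xi>) R (\<rho>, t) = {}" "last ps = (\<rho>, t)"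
  shows "fin_won (G_of \<xi>) R V U ps"
proof (cases "eloise_pos (G_of \<xi>) (\<rho>, t)")
  case True
  then show ?thesis using ok_eloise[OF assms(1,2)] assms(3) by blast
next
  case False
  then show ?thesis using assms(1,2,4) by (cases \<rho>) (auto simp: fin_won_def)
qed

text \<open>Dualization exchanges the players: where Eloise moves, the commitments of the dual
  formula cover all her choices; elsewhere they provide a reply. The forced move at an unfolding
  fits the first reading.\<close>

lemma ok_neg_eloise:
  assumes "ok R V U (neg \<rho>) t L" "\<rho> \<in> Clos \<xi>" "eloise_pos (G_of \<xi>) (\<rho>, t)" "q \<in> moves (G_of \<xi>) R (\<rho>, t)"
  shows "(neg (fst q), snd q) \<in> L"
  using assms by (cases \<rho>) (auto simp: moves_def eloise_pos_def neg_subst)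

lemma ok_neg_abelard:
  assumes "ok R V U (neg \<rho>) t L" "\<rho> \<in> Clos \<xi>" "\<not> eloise_pos (G_of \<xi>) (\<rho>, t)" "\<not> atomic \<rho>"
  shows "\<exists>q \<in> moves (G_of \<xi>) R (\<rho>, t). (neg (fst q), snd q) \<in> L"
  using assms Clos_step[OF assms(2)] by (cases \<rho>) (force simp: moves_def eloise_pos_def)+

lemma ok_neg_stuck:
  assumes "ok R V (\<lambda>x. - U x) (neg \<rho>) t L" "\<rho> \<in> Clos \<xi>" "moves (G_of \<xi>) R (\<rho>, t) = {}" "last ps = (\<rho>, t)"
  shows "\<not> fin_won (G_of \<xi>) R V U ps"
proof (cases "atomic \<rho>")
  case True
  then show ?thesis using assms(1,2,4) by (cases \<rho>) (auto simp: fin_won_def)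
next
  case False
  then have "eloise_pos (G_of \<xi>) (\<rho>, t)" using ok_neg_abelard[OF assms(1,2)] assms(3) by blast
  then show ?thesis using assms(2,4) by (cases \<rho>) (auto simp: fin_won_def eloise_pos_def)
qed

text \<open>The common finite prefixes of \<open>fin_match\<close> and \<open>inf_match\<close>, in
  a form that allows induction along the history.\<close>

inductive play :: "('v, 'p) pform \<Rightarrow> ('s \<times> 's) set \<Rightarrow> (('v \<times> 's) list \<Rightarrow> 'v \<times> 's) \<Rightarrow> 'v \<times> 's \<Rightarrow> ('v \<times> 's) list \<Rightarrow> bool"
  for G R \<sigma> p0 where
  start: "play G R \<sigma> p0 [p0]"
| move: "play G R \<sigma> p0 h \<Longrightarrow> q \<in> moves G R (last h) \<Longrightarrow> (eloise_pos G (last h) \<Longrightarrow> q = \<sigma> h)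
    \<Longrightarrow> play G R \<sigma> p0 (h @ [q])"

lemma play_hd: "play G R \<sigma> p0 h \<Longrightarrow> h \<noteq> [] \<and> hd h = p0"
  by (induction rule: play.induct) auto

lemma play_take:
  assumes "ps \<noteq> []" "hd ps = p0"
    "\<forall>i. Suc i < length ps \<longrightarrow> ps ! Suc i \<in> moves G R (ps ! i) \<and>
       (eloise_pos G (ps ! i) \<longrightarrow> ps ! Suc i = \<sigma> (take (Suc i) ps))"
    "i < length ps"
  shows "play G R \<sigma> p0 (take (Suc i) ps)"
  using assms(4)
proof (induction i)
  case 0
  then show ?case using assms(1,2) play.start by (cases ps) auto
next
  case (Suc i)
  have l: "last (take (Suc i) ps) = ps ! i" using Suc.prems by (simp add: take_Suc_conv_app_nth)
  have "play G R \<sigma> p0 (take (Suc i) ps @ [ps ! Suc i])"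
    by (rule play.move) (use Suc assms(3) l in auto)
  then show ?case using Suc.prems by (simp add: take_Suc_conv_app_nth)
qed

lemma play_inf:
  assumes "inf_match G R \<sigma> p0 \<pi>"
  shows "play G R \<sigma> p0 (map \<pi> [0..<Suc i])"
proof (induction i)
  case 0
  then show ?case using assms play.start by (simp add: inf_match_def)
next
  case (Suc i)
  have "play G R \<sigma> p0 (map \<pi> [0..<Suc i] @ [\<pi> (Suc i)])"
    by (rule play.move) (use Suc assms in \<open>auto simp: inf_match_def\<close>)
  then show ?case by simp
qed

lemma play_nth:
  assumes "play G R \<sigma> p0 ps"
  shows "\<forall>i. Suc i < length ps \<longrightarrow> ps ! Suc i \<in> moves G R (ps ! i) \<and>
       (eloise_pos G (ps ! i) \<longrightarrow> ps ! Suc i = \<sigma> (take (Suc i) ps))"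
  using assms
proof (induction rule: play.induct)
  case (move h q)
  have h: "h \<noteq> []" using play_hd move.hyps(1) by blast
  show ?case
  proof (intro allI impI)
    fix i assume i: "Suc i < length (h @ [q])"
    show "(h @ [q]) ! Suc i \<in> moves G R ((h @ [q]) ! i) \<and>
       (eloise_pos G ((h @ [q]) ! i) \<longrightarrow> (h @ [q]) ! Suc i = \<sigma> (take (Suc i) (h @ [q])))"
    proof (cases "Suc i < length h")
      case True
      then show ?thesis using move.IH by (simp add: nth_append)
    next
      case False
      then have "Suc i = length h" using i by simp
      moreover from this have "h ! i = last h" using h by (metis diff_Suc_1 last_conv_nth)
      ultimately show ?thesis using move.hyps by (simp add: nth_append)
    qed
  qed
qed simp

section \<open>The two directions of the equivalence\<close>

lemma pf_sat_if_sem: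
  assumes "tidy \<xi>" and s: "s \<in> sem R V U \<xi>"
  shows "pf_sat (G_of \<xi>) R V U s"
proof -
  let ?G = "G_of \<xi>"
  obtain X E where W: "witness R V U \<xi> X E" using witness_exists assms(1) by blast
  obtain m0 where m0: "(m0, \<xi>, s) \<in> X" using W s unfolding witness_def by blast
  \<comment> \<open>The history is replayed in the witness structure to recover the memory; its
    first position is the root.\<close>
  define lift where "lift h = foldl (\<lambda>n q. SOME n'. (n, n') \<in> E \<and> snd n' = q) (m0, \<xi>, s) (tl h)" for h
  define good where "good h n' \<longleftrightarrow> (lift h, n') \<in> E \<and> snd n' \<in> moves ?G R (last h)" for h n'
  \<comment> \<open>The fallback choice serves histories that do not arise in consistent plays,
    since legality is demanded on all histories.\<close>
  define \<sigma> where "\<sigma> h = (if \<exists>n'. good h n' then snd (SOME n'. good h n') else SOME q. q \<in> moves ?G R (last h))" for h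
  have sig: "\<exists>n'. good h n' \<and> \<sigma> h = snd n'" if "\<exists>n'. good h n'" for h
    unfolding \<sigma>_def using someI_ex[OF that] that by (metis (no_types, lifting))
  have legal: "legal_strategy ?G R \<sigma>"
    unfolding legal_strategy_def
  proof (intro allI impI)
    fix h assume h: "h \<noteq> [] \<and> eloise_pos ?G (last h) \<and> moves ?G R (last h) \<noteq> {}"
    show "\<sigma> h \<in> moves ?G R (last h)"
    proof (cases "\<exists>n'. good h n'")
      case True
      then show ?thesis using sig unfolding good_def by metis
    next
      case False
      then show ?thesis using h unfolding \<sigma>_def by (simp add: some_in_eq)
    qed
  qed
  have node: "fst (snd n) \<in> Clos \<xi> \<and> ok R V U (fst (snd n)) (snd (snd n)) (snd ` (E `` {n}))" if "n \<in> X" for n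
  proof -
    obtain m \<rho> t where n: "n = (m, \<rho>, t)" by (cases n)
    then show ?thesis using W that unfolding witness_def by auto
  qed
  have EX: "n' \<in> X" if "(n, n') \<in> E" for n n' using W that unfolding witness_def by blast
  have snoc: "(lift h, lift (h @ [q])) \<in> E \<and> snd (lift (h @ [q])) = q"
    if h: "h \<noteq> []" "lift h \<in> X" "snd (lift h) = last h" "q \<in> moves ?G R (last h)"
      "eloise_pos ?G (last h) \<Longrightarrow> q = \<sigma> h" for h q
  proof -
    let ?n = "lift h"
    have n: "fst (snd ?n) \<in> Clos \<xi>" "ok R V U (fst (snd ?n)) (snd (snd ?n)) (snd ` (E `` {?n}))"
      using node[OF h(2)] by auto
    have "\<exists>n'. (?n, n') \<in> E \<and> snd n' = q"
    proof (cases "eloise_pos ?G (last h)")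
      case True
      have "moves ?G R (last h) \<inter> snd ` (E `` {?n}) \<noteq> {}"
        using ok_eloise[OF n(2,1)] True h(3) by simp
      then have "\<exists>n'. good h n'" unfolding good_def by blast
      then show ?thesis using sig h(5)[OF True] unfolding good_def by metis
    next
      case False
      then have "moves ?G R (last h) \<subseteq> snd ` (E `` {?n})"
        using ok_abelard[OF n(2,1)] h(3) by simp
      then show ?thesis using h(4) by blast
    qed
    moreover have "lift (h @ [q]) = (SOME n'. (?n, n') \<in> E \<and> snd n' = q)"
      using h(1) unfolding lift_def by (cases h) auto
    ultimately show ?thesis using someI_ex[of "\<lambda>n'. (?n, n') \<in> E \<and> snd n' = q"] by simp
  qed
  have inv: "lift h \<in> X \<and> snd (lift h) = last h" if "play ?G R \<sigma> (\<xi>, s) h" for h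
    using that
  proof (induction rule: play.induct)
    case start
    then show ?case using m0 by (simp add: lift_def)
  next
    case (move h q)
    then have "(lift h, lift (h @ [q])) \<in> E \<and> snd (lift (h @ [q])) = q"
      using snoc[of h q] play_hd[OF move.hyps(1)] by blast
    then show ?case using EX by (metis last_snoc)
  qed
  have "fin_won ?G R V U ps" if fm: "fin_match ?G R \<sigma> (\<xi>, s) ps" for ps
  proof -
    have ne: "ps \<noteq> []" "hd ps = (\<xi>, s)" "moves ?G R (last ps) = {}" using fm by (auto simp: fin_match_def)
    have "play ?G R \<sigma> (\<xi>, s) (take (Suc (length ps - 1)) ps)"
      by (rule play_take) (use fm in \<open>auto simp: fin_match_def\<close>)
    then have "play ?G R \<sigma> (\<xi>, s) ps" using ne(1) by simp
    then have "lift ps \<in> X" "snd (lift ps) = last ps" using inv by auto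
    then show ?thesis using node[of "lift ps"] ne(3) ok_stuck[of R V U "fst (last ps)" "snd (last ps)" _ \<xi> ps]
      by auto
  qed
  moreover have "inf_won ?G \<pi>" if im: "inf_match ?G R \<sigma> (\<xi>, s) \<pi>" for \<pi>
  proof -
    define hh where "hh i = map \<pi> [0..<Suc i]" for i
    have pl: "play ?G R \<sigma> (\<xi>, s) (hh i)" for i using play_inf[OF im] unfolding hh_def .
    have ne: "hh i \<noteq> []" and la: "last (hh i) = \<pi> i" and su: "hh (Suc i) = hh i @ [\<pi> (Suc i)]" for i
      by (simp_all add: hh_def)
    have lf: "lift (hh i) \<in> X" "snd (lift (hh i)) = \<pi> i" for i using inv[OF pl[of i]] la by auto
    have "(lift (hh i), lift (hh (Suc i))) \<in> E" for i
      unfolding su using snoc[OF ne lf(1)] lf(2) la im unfolding inf_match_def hh_def by simp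
    then have "dominated Nu (\<lambda>i. fst (snd (lift (hh i))))" by (rule witness_path[OF W])
    then have dom: "dominated Nu (\<lambda>i. fst (\<pi> i))" by (simp add: lf)
    have Cl: "fst (\<pi> i) \<in> Clos \<xi>" for i using node[OF lf(1)[of i]] lf(2) by simp
    have "fst (\<pi> (Suc i)) \<in> succs (fst (\<pi> i))" for i
      using moves_succs[OF _ Cl] im unfolding inf_match_def by blast
    then show ?thesis unfolding inf_won_def using winner_dominated[OF assms(1) Cl _ dom] by simp
  qed
  ultimately show ?thesis unfolding pf_sat_def using legal by auto
qed

text \<open>A play against \<open>\<sigma>\<close> is grown alongside a path in a witness for the
  dual formula, from which the replies of the opponent are read off. The play never stops, and its
  trace is dominated by a least fixpoint.\<close>

lemma sem_if_pf_sat: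
  fixes \<xi> :: "'p fm" and s :: 's
  assumes "tidy \<xi>" and sat: "pf_sat (G_of \<xi>) R V U s"
  shows "s \<in> sem R V U \<xi>"
proof (rule ccontr)
  assume "s \<notin> sem R V U \<xi>"
  let ?G = "G_of \<xi>"
  let ?U = "\<lambda>x. - U x"
  have s: "s \<in> sem R V ?U (neg \<xi>)" using \<open>s \<notin> sem R V U \<xi>\<close> sem_neg[of R V U \<xi>] by blast
  obtain \<sigma> where \<sigma>: "legal_strategy ?G R \<sigma>" "\<And>ps. fin_match ?G R \<sigma> (\<xi>, s) ps \<Longrightarrow> fin_won ?G R V U ps"
    "\<And>\<pi>. inf_match ?G R \<sigma> (\<xi>, s) \<pi> \<Longrightarrow> inf_won ?G \<pi>"
    using sat unfolding pf_sat_def G_of_simps by blast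
  obtain X E where W: "witness R V ?U (neg \<xi>) X E" using witness_exists assms(1) tidy_neg by blast
  obtain m0 where m0: "(m0, neg \<xi>, s) \<in> X" using W s unfolding witness_def by blast
  have EX: "n' \<in> X" if "(n, n') \<in> E" for n n' using W that unfolding witness_def by blast
  define inv where "inv hn \<longleftrightarrow> play ?G R \<sigma> (\<xi>, s) (fst hn) \<and> snd hn \<in> X \<and> fst (last (fst hn)) \<in> Clos \<xi> \<and>
    snd (snd hn) = (neg (fst (last (fst hn))), snd (last (fst hn)))" for hn
  define nxt :: "('p fm \<times> 's) list \<times> ('p, 's) node \<Rightarrow> ('p fm \<times> 's) list \<times> ('p, 's) node \<Rightarrow> bool"
    where "nxt hn hn' \<longleftrightarrow> (\<exists>q. fst hn' = fst hn @ [q]) \<and> (snd hn, snd hn') \<in> E" for hn hn'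
  have step: "\<exists>hn'. inv hn' \<and> nxt hn hn'" if "inv hn" for hn
  proof -
    obtain h m \<rho>' t' where hn: "hn = (h, m, \<rho>', t')" by (cases hn)
    obtain \<rho> t where l: "last h = (\<rho>, t)" by (cases "last h")
    have i: "play ?G R \<sigma> (\<xi>, s) h" "(m, neg \<rho>, t) \<in> X" "\<rho> \<in> Clos \<xi>" "\<rho>' = neg \<rho>" "t' = t"
      using that l unfolding hn inv_def by auto
    let ?L = "snd ` (E `` {(m, neg \<rho>, t)})"
    have o: "ok R V ?U (neg \<rho>) t ?L" using W i(2) unfolding witness_def by blast
    have h: "h \<noteq> []" "hd h = (\<xi>, s)" using play_hd[OF i(1)] by auto
    \<comment> \<open>A stuck position would complete a finite match that \<open>\<sigma>\<close>
      wins, but the dual commitments show it lost.\<close>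
    have mv: "moves ?G R (\<rho>, t) \<noteq> {}"
    proof
      assume no: "moves ?G R (\<rho>, t) = {}"
      then have "fin_match ?G R \<sigma> (\<xi>, s) h"
        using h l play_nth[OF i(1)] unfolding fin_match_def by simp
      then show False using \<sigma>(2) ok_neg_stuck[OF o i(3) no l] by blast
    qed
    have "\<exists>q \<in> moves ?G R (\<rho>, t). (eloise_pos ?G (\<rho>, t) \<longrightarrow> q = \<sigma> h) \<and> (neg (fst q), snd q) \<in> ?L"
    proof (cases "eloise_pos ?G (\<rho>, t)")
      case True
      then have "\<sigma> h \<in> moves ?G R (\<rho>, t)" using \<sigma>(1) h l mv unfolding legal_strategy_def by metis
      then show ?thesis using ok_neg_eloise[OF o i(3) True] by blast
    next
      case False
      have "\<not> atomic \<rho>" using mv i(3) by (cases \<rho>) (auto simp: moves_def)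
      then show ?thesis using ok_neg_abelard[OF o i(3) False] False by blast
    qed
    then obtain q where q: "q \<in> moves ?G R (\<rho>, t)" "eloise_pos ?G (\<rho>, t) \<longrightarrow> q = \<sigma> h"
      and qL: "(neg (fst q), snd q) \<in> ?L" by blast
    from qL obtain n' where n': "((m, neg \<rho>, t), n') \<in> E" and "(neg (fst q), snd q) = snd n'" by blast
    then have sn: "snd n' = (neg (fst q), snd q)" by simp
    have "play ?G R \<sigma> (\<xi>, s) (h @ [q])" using q l by (intro play.move[OF i(1)]) auto
    moreover have "fst q \<in> Clos \<xi>" using moves_succs[OF q(1)] i(3) by simp
    ultimately have "inv (h @ [q], n')" using EX[OF n'] sn by (simp add: inv_def)
    moreover have "nxt hn (h @ [q], n')" using n' i(4,5) by (simp add: nxt_def hn)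
    ultimately show ?thesis by blast
  qed
  have "inv ([(\<xi>, s)], (m0, neg \<xi>, s))" using m0 play.start by (simp add: inv_def)
  define f where "f = rec_nat ([(\<xi>, s)], (m0, neg \<xi>, s)) (\<lambda>_ hn. SOME hn'. inv hn' \<and> nxt hn hn')"
  have f0: "f 0 = ([(\<xi>, s)], (m0, neg \<xi>, s))" by (simp add: f_def)
  have fS: "f (Suc i) = (SOME hn'. inv hn' \<and> nxt (f i) hn')" for i by (simp add: f_def)
  have finv: "inv (f i)" for i
  proof (induction i)
    case 0
    then show ?case using \<open>inv ([(\<xi>, s)], (m0, neg \<xi>, s))\<close> by (simp add: f0)
  next
    case (Suc i)
    then show ?case unfolding fS using someI_ex[OF step[OF Suc]] by blast
  qed
  have fnxt: "nxt (f i) (f (Suc i))" for i unfolding fS using someI_ex[OF step[OF finv[of i]]] by blast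
  define \<pi> where "\<pi> i = last (fst (f i))" for i
  have h\<pi>: "fst (f i) = map \<pi> [0..<Suc i]" for i
  proof (induction i)
    case 0
    then show ?case by (simp add: \<pi>_def f0)
  next
    case (Suc i)
    obtain q where "fst (f (Suc i)) = fst (f i) @ [q]" using fnxt[of i] unfolding nxt_def by blast
    moreover from this have "\<pi> (Suc i) = q" by (simp add: \<pi>_def)
    ultimately show ?case using Suc by simp
  qed
  have pl: "play ?G R \<sigma> (\<xi>, s) (map \<pi> [0..<Suc i])" for i using finv[of i] h\<pi> unfolding inv_def by simp
  have im: "inf_match ?G R \<sigma> (\<xi>, s) \<pi>"
    unfolding inf_match_def
  proof (intro conjI allI)
    show "\<pi> 0 = (\<xi>, s)" by (simp add: \<pi>_def f0)
    fix i
    have "take (Suc i) (map \<pi> [0..<Suc (Suc i)]) = map \<pi> [0..<Suc i]" by (simp add: take_map)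
    then have "\<pi> (Suc i) \<in> moves ?G R (\<pi> i) \<and> (eloise_pos ?G (\<pi> i) \<longrightarrow> \<pi> (Suc i) = \<sigma> (map \<pi> [0..<Suc i]))"
      using play_nth[OF pl[of "Suc i"], rule_format, of i] by (simp del: upt_Suc)
    then show "\<pi> (Suc i) \<in> moves ?G R (\<pi> i)"
      and "eloise_pos ?G (\<pi> i) \<longrightarrow> \<pi> (Suc i) = \<sigma> (map \<pi> [0..<Suc i])" by blast+
  qed
  have Cl: "fst (\<pi> i) \<in> Clos \<xi>" for i using finv[of i] unfolding inv_def \<pi>_def by blast
  have su: "fst (\<pi> (Suc i)) \<in> succs (fst (\<pi> i))" for i
    using moves_succs[OF _ Cl] im unfolding inf_match_def by blast
  have "(snd (f i), snd (f (Suc i))) \<in> E" for i using fnxt unfolding nxt_def by blast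
  then have "dominated Nu (\<lambda>i. fst (snd (snd (f i))))" by (rule witness_path[OF W])
  moreover have "fst (snd (snd (f i))) = neg (fst (\<pi> i))" for i
    using finv[of i] unfolding inv_def \<pi>_def by simp
  ultimately have "dominated Nu (\<lambda>i. neg (fst (\<pi> i)))" by simp
  then have "dominated (dual Nu) (\<lambda>i. neg (neg (fst (\<pi> i))))"
    by (rule dominated_image) (rule fs_neg is_fix_neg; assumption)+
  then have "dominated Mu (\<lambda>i. fst (\<pi> i))" by simp
  then have "\<not> inf_won ?G \<pi>"
    unfolding inf_won_def using winner_dominated[of \<xi> "\<lambda>i. fst (\<pi> i)", OF assms(1) Cl su] by simp
  then show False using \<sigma>(3)[OF im] by blast
qed

theorem mainTheorem1:
  fixes \<xi> :: "'p fm"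
  assumes "tidy \<xi>"
  shows "parity_formula (G_of \<xi>)
    \<and> (\<forall>(R :: ('s \<times> 's) set) V U s. pf_sat (G_of \<xi>) R V U s \<longleftrightarrow> s \<in> sem R V U \<xi>)
    \<and> card (PV (G_of \<xi>)) = card (Clos \<xi>)
    \<and> ind (G_of \<xi>) \<le> ad \<xi>"
  using parity_formula_G_of[OF assms] pf_sat_if_sem[OF assms] sem_if_pf_sat[OF assms]
    ind_G_of_le_ad[OF assms] by auto

end
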